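(* Let $N\in\mathbb{N}$, $N\ge2$. Put $\sigma_i=+1$ for $1\le i\le N-1$ and $\sigma_N=-1$, and let $\sigma\in M_N(\{\pm1\})$ be given by $\sigma_{ij}=\sigma_i\sigma_j$ for $i<j$ and $\sigma_{ij}=+1$ for $i\ge j$. In $\mathscr{P}(2,2)$ let $\times$ have blocks $\{1,2'\},\{2,1'\}$, let $r_1$ have blocks $\{1,2'\},\{2\},\{1'\}$, let $r_2$ have blocks $\{2,1'\},\{1\},\{2'\}$, and let $s$ consist of four singletons. Then the non-easy linear category of partitions $$\mathscr{K}=\Big\langle\times-\tfrac{2}{N}(r_1+r_2)+\tfrac{4}{N^2}\,s\Big\rangle_N$$ corresponds to the quantum group $G=U_{(N,\pm)}^*\,O_N^\sigma\,U_{(N,\pm)}$; that is, with $\hat u$ the fundamental representation of $O_N^\sigma$ and $v:=U_{(N,\pm)}^*\,\hat u\,U_{(N,\pm)}$, one has $\operatorname{Mor}(v^{\otimes k},v^{\otimes l})=\{T_p\mid p\in\mathscr{K}(k,l)\}$ for all $k,l\in\mathbb{N}_0$.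
   Context: Partitions. For $k,l\in\mathbb{N}_0$ let $\mathscr{P}(k,l)$ be the set of set partitions of $k$ upper points $1,\dots,k$ and $l$ lower points $1',\dots,l'$. For $\delta\in\mathbb{C}$, $\mathbf{Part}_\delta(k,l)$ is the complex vector space with basis $\mathscr{P}(k,l)$. Category operations: tensor product (side by side, bilinear); composition $qp=\delta^c r$ for $p\in\mathscr{P}(k,l),q\in\mathscr{P}(l,m)$, where the lower points of $p$ are identified with the upper points of $q$, $r\in\mathscr{P}(k,m)$ is the induced partition and $c$ is the number of connected components consisting only of middle points (bilinear); involution $p^*$ (interchange upper and lower rows, antilinear). A linear category of partitions is a collection of subspaces $\mathscr{K}(k,l)\subseteq\mathbf{Part}_\delta(k,l)$ closed under these operations and containing $\{1,1'\}\in\mathscr{P}(1,1)$ and $\{1',2'\}\in\mathscr{P}(0,2)$; $\langle p_1,\dots,p_n\rangle_\delta$ is the smallest one containing $p_1,\dots,p_n$. It is easy if every $\mathscr{K}(k,l)$ is spanned by a set of partitions, and non-easy otherwise. For $\delta=N$ and $p\in\mathscr{P}(k,l)$ let $T_p:(\mathbb{C}^N)^{\otimes k}\to(\mathbb{C}^N)^{\otimes l}$ have entries $[T_p]_{\mathbf{i}\mathbf{j}}=1$ if labelling the upper points by $\mathbf{j}=(j_1,\dots,j_k)$ and the lower points by $\mathbf{i}=(i_1,\dots,i_l)$ is constant on each block of $p$, and $0$ otherwise; extend linearly. The matrix $U_{(N,\pm)}\in M_N(\mathbb{R})$ (one fixed choice of sign throughout) is the orthogonal matrix with entries, for $1\le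 i\le N-1$: $U_{ij}=\delta_{ij}-\frac{1}{N-1}\big(1\pm\frac1{\sqrt N}\big)$ for $1\le j\le N-1$ and $U_{iN}=\pm\frac{1}{\sqrt N}$; and last row $U_{Nj}=\frac1{\sqrt N}$ for all $j$. Twist. $\operatorname{Pol}O_N$ is the universal commutative $*$-algebra generated by self-adjoint $u_{ij}$, $1\le i,j\le N$, with $u=(u_{ij})$ orthogonal; it is a Hopf $*$-algebra with $\Delta(u_{ij})=\sum_k u_{ik}\otimes u_{kj}$. Let $q:\operatorname{Pol}O_N\to\mathbb{C}\mathbb{Z}_2^N$, $u_{ij}\mapsto\delta_{ij}t_i$, where $t_1,\dots,t_N$ are the canonical generators of $\mathbb{Z}_2^N$. The matrix $\sigma$ determines a unique bicharacter on $\mathbb{Z}_2^N$ with $(t_i,t_j)\mapsto\sigma_{ij}$; extended bilinearly and composed with $q\otimes q$ it gives a unitary 2-cocycle on $\operatorname{Pol}O_N$, again denoted $\sigma$, with convolution inverse $\sigma^{-1}$. $O_N^\sigma$ is the compact quantum group for which $\operatorname{Pol}O_N^\sigma$ equals $\operatorname{Pol}O_N$ as a coalgebra (with $\hat x$ denoting $x$ viewed in $\operatorname{Pol}O_N^\sigma$) and, in Sweedler notation, $\hat x\hat y=\sigma(x_{(1)},y_{(1)})\sigma^{-1}(x_{(3)},y_{(3)})\widehat{x_{(2)}y_{(2)}}$ and $\hat x^*=\sigma(S(x_{(5)})^*,x_{(4)}^* )\,\sigma^{-1}(x_{(2)}^*,S(x_{(1)})^* )\,\widehat{x_{(3)}^*}$.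 Its fundamental representation is $\hat u=(\hat u_{ij})$. $U^*O_N^\sigma U$ denotes the same quantum group with fundamental representation $U^*\hat uU$. For a matrix $v$ over an algebra, $[v^{\otimes k}]_{\mathbf{i}\mathbf{j}}=v_{i_1j_1}\cdots v_{i_kj_k}$ and $\operatorname{Mor}(v^{\otimes k},v^{\otimes l})=\{T:(\mathbb{C}^N)^{\otimes k}\to(\mathbb{C}^N)^{\otimes l}\mid Tv^{\otimes k}=v^{\otimes l}T\}$. *)

theory Defs
  imports
    "HOL-Analysis.Analysis"
    "HOL-Library.Poly_Mapping"
    "HOL-Library.Z2"
    "HOL-Library.Disjoint_Sets"
begin

section \<open>Complex vector spaces and commutative algebras\<close>

class complex_vector = ab_group_add +
  fixes scaleC :: "complex \<Rightarrow> 'a \<Rightarrow> 'a" (infixr "*\<^sub>C" 75)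
  assumes scaleC_add_right: "a *\<^sub>C (x + y) = a *\<^sub>C x + a *\<^sub>C y"
    and scaleC_add_left: "(a + b) *\<^sub>C x = a *\<^sub>C x + b *\<^sub>C x"
    and scaleC_scaleC: "a *\<^sub>C b *\<^sub>C x = (a * b) *\<^sub>C x"
    and scaleC_one: "1 *\<^sub>C x = x"

class complex_comm_algebra = complex_vector + comm_ring_1 +
  assumes mult_scaleC_left: "(a *\<^sub>C x) * y = a *\<^sub>C (x * y)"
begin

lemma mult_scaleC_right: "x * (a *\<^sub>C y) = a *\<^sub>C (x * y)"
  by (metis local.mult.commute local.mult_scaleC_left)

end

global_interpretation complex_vector: vector_space "scaleC :: complex \<Rightarrow> 'a \<Rightarrow> 'a::complex_vector"
  by unfold_locales (simp_all add: scaleC_add_right scaleC_add_left scaleC_scaleC scaleC_one)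

instantiation complex :: complex_comm_algebra
begin

definition scaleC_complex_def [simp]: "scaleC a (z::complex) = a * z"

instance by standard (simp_all add: algebra_simps)

end

instantiation poly_mapping :: (type, complex_vector) complex_vector
begin

lift_definition scaleC_poly_mapping :: "complex \<Rightarrow> ('a \<Rightarrow>\<^sub>0 'b) \<Rightarrow> ('a \<Rightarrow>\<^sub>0 'b)"
  is "\<lambda>a f k. a *\<^sub>C f k"
  by (metis (mono_tags, lifting) Collect_mono complex_vector.scale_zero_right finite_subset)

instance
  by standard
    (rule poly_mapping_eqI, simp add: scaleC_poly_mapping.rep_eq lookup_add scaleC_add_right
      scaleC_add_left scaleC_scaleC scaleC_one)+

end

lemma lookup_scaleC [simp]: "Poly_Mapping.lookup (a *\<^sub>C f) k = a *\<^sub>C Poly_Mapping.lookup f k"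
  by (simp add: scaleC_poly_mapping.rep_eq)

definition lin_ext :: "('k \<Rightarrow> 'b::complex_vector) \<Rightarrow> ('k \<Rightarrow>\<^sub>0 complex) \<Rightarrow> 'b" where
  "lin_ext h f = (\<Sum>x\<in>Poly_Mapping.keys f. Poly_Mapping.lookup f x *\<^sub>C h x)"

lemma lin_ext_superset:
  assumes "finite A" "Poly_Mapping.keys f \<subseteq> A"
  shows "lin_ext h f = (\<Sum>x\<in>A. Poly_Mapping.lookup f x *\<^sub>C h x)"
  unfolding lin_ext_def using assms
  by (intro sum.mono_neutral_left) (auto simp: in_keys_iff)

lemma lin_ext_add: "lin_ext h (f + g) = lin_ext h f + lin_ext h g"
proof -
  let ?A = "Poly_Mapping.keys f \<union> Poly_Mapping.keys g"
  have "Poly_Mapping.keys (f + g) \<subseteq> ?A" by (rule keys_add)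
  then show ?thesis
    by (simp add: lin_ext_superset[of ?A] lookup_add scaleC_add_left sum.distrib)
qed

lemma lin_ext_scaleC: "lin_ext h (a *\<^sub>C f) = a *\<^sub>C lin_ext h f"
proof -
  have "Poly_Mapping.keys (a *\<^sub>C f) \<subseteq> Poly_Mapping.keys f" by (auto simp: in_keys_iff)
  then show ?thesis
    by (simp add: lin_ext_superset[of "Poly_Mapping.keys f"] complex_vector.scale_sum_right scaleC_scaleC)
qed

lemma lin_ext_zero [simp]: "lin_ext h 0 = 0"
  by (simp add: lin_ext_def)

lemma lin_ext_single [simp]: "lin_ext h (Poly_Mapping.single x c) = c *\<^sub>C h x"
  by (simp add: lin_ext_def)

lemma lin_ext_diff: "lin_ext h (f - g) = lin_ext h f - lin_ext h g"
  by (metis add_diff_cancel_right' diff_add_cancel lin_ext_add)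

lemma lin_ext_sum: "lin_ext h (\<Sum>i\<in>I. f i) = (\<Sum>i\<in>I. lin_ext h (f i))"
  by (induction I rule: infinite_finite_induct) (simp_all add: lin_ext_add)

lemma lin_ext_fun_add: "lin_ext (\<lambda>x. h x + k x) f = lin_ext h f + lin_ext k f"
  by (simp add: lin_ext_def scaleC_add_right sum.distrib)

lemma lin_ext_fun_scaleC: "lin_ext (\<lambda>x. a *\<^sub>C h x) f = a *\<^sub>C lin_ext h f"
  by (simp add: lin_ext_def complex_vector.scale_sum_right scaleC_scaleC mult.commute)

lemma lin_ext_fun_zero [simp]: "lin_ext (\<lambda>x. 0) f = 0"
  by (simp add: lin_ext_def)

lemma poly_mapping_eq_sum: "f = (\<Sum>x\<in>Poly_Mapping.keys f. Poly_Mapping.single x (Poly_Mapping.lookup f x))"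
  for f :: "'k \<Rightarrow>\<^sub>0 'b::comm_monoid_add"
  by (rule poly_mapping_eqI)
    (auto simp: lookup_sum lookup_single when_def sum.delta in_keys_iff)

lemma poly_mapping_induct_single [case_names zero sgl add]:
  fixes f :: "'k \<Rightarrow>\<^sub>0 'b::comm_monoid_add"
  assumes "P 0" "\<And>x c. P (Poly_Mapping.single x c)" "\<And>f g. P f \<Longrightarrow> P g \<Longrightarrow> P (f + g)"
  shows "P f"
proof -
  have "P (\<Sum>x\<in>A. Poly_Mapping.single x (Poly_Mapping.lookup f x))" for A
    by (induction A rule: infinite_finite_induct) (auto intro: assms)
  then show ?thesis by (metis poly_mapping_eq_sum)
qed

instance poly_mapping :: (comm_monoid_add, complex_comm_algebra) complex_comm_algebra
proof
  fix a :: complex and x y :: "'a \<Rightarrow>\<^sub>0 'b"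
  have s: "a *\<^sub>C Poly_Mapping.single k c = Poly_Mapping.single k (a *\<^sub>C c)" for k and c :: 'b
    by (rule poly_mapping_eqI) (simp add: lookup_single when_def)
  show "(a *\<^sub>C x) * y = a *\<^sub>C (x * y)"
  proof (induction x rule: poly_mapping_induct_single)
    case (sgl k c)
    show ?case
      by (induction y rule: poly_mapping_induct_single)
        (simp_all add: s mult_single mult_scaleC_left distrib_left scaleC_add_right)
  qed (simp_all add: distrib_right scaleC_add_right)
qed

lemma scaleC_single: "a *\<^sub>C Poly_Mapping.single k c = Poly_Mapping.single k (a *\<^sub>C c)"
  by (rule poly_mapping_eqI) (simp add: lookup_single when_def)


section \<open>Tensor products\<close>

definition bilin_relations ::
    "(('a::complex_vector \<times> 'b::complex_vector) \<Rightarrow>\<^sub>0 complex) set" where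
  "bilin_relations =
     {Poly_Mapping.single (a + a', b) 1 - Poly_Mapping.single (a, b) 1 - Poly_Mapping.single (a', b) 1 | a a' b. True} \<union>
     {Poly_Mapping.single (a, b + b') 1 - Poly_Mapping.single (a, b) 1 - Poly_Mapping.single (a, b') 1 | a b b'. True} \<union>
     {Poly_Mapping.single (c *\<^sub>C a, b) 1 - Poly_Mapping.single (a, b) c | c a b. True} \<union>
     {Poly_Mapping.single (a, c *\<^sub>C b) 1 - Poly_Mapping.single (a, b) c | c a b. True}"

definition tensor_eq ::
    "(('a::complex_vector \<times> 'b::complex_vector) \<Rightarrow>\<^sub>0 complex) \<Rightarrow> (('a \<times> 'b) \<Rightarrow>\<^sub>0 complex) \<Rightarrow> bool" where
  "tensor_eq f g \<longleftrightarrow> f - g \<in> complex_vector.span bilin_relations"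

quotient_type (overloaded) ('a, 'b) tensor =
  "('a::complex_vector \<times> 'b::complex_vector) \<Rightarrow>\<^sub>0 complex" / tensor_eq
proof (rule equivpI)
  show "reflp (tensor_eq :: (('a \<times> 'b) \<Rightarrow>\<^sub>0 complex) \<Rightarrow> _)"
    by (rule reflpI) (simp add: tensor_eq_def complex_vector.span_zero)
  show "symp (tensor_eq :: (('a \<times> 'b) \<Rightarrow>\<^sub>0 complex) \<Rightarrow> _)"
    by (rule sympI) (metis tensor_eq_def complex_vector.span_neg minus_diff_eq)
  show "transp (tensor_eq :: (('a \<times> 'b) \<Rightarrow>\<^sub>0 complex) \<Rightarrow> _)"
  proof (rule transpI)
    fix x y z :: "('a \<times> 'b) \<Rightarrow>\<^sub>0 complex"
    assume "tensor_eq x y" "tensor_eq y z"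
    then have "(x - y) + (y - z) \<in> complex_vector.span bilin_relations"
      unfolding tensor_eq_def by (rule complex_vector.span_add)
    then show "tensor_eq x z" by (simp add: tensor_eq_def)
  qed
qed

instantiation tensor :: (complex_vector, complex_vector) complex_vector
begin

lift_definition zero_tensor :: "('a, 'b) tensor" is 0 .

lift_definition plus_tensor :: "('a, 'b) tensor \<Rightarrow> ('a, 'b) tensor \<Rightarrow> ('a, 'b) tensor" is "(+)"
  unfolding tensor_eq_def by (metis add_diff_add complex_vector.span_add)

lift_definition minus_tensor :: "('a, 'b) tensor \<Rightarrow> ('a, 'b) tensor \<Rightarrow> ('a, 'b) tensor" is "(-)"
proof -
  fix f f' g g' :: "('a \<times> 'b) \<Rightarrow>\<^sub>0 complex"
  assume "tensor_eq f f'" "tensor_eq g g'"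
  then have "(f - f') - (g - g') \<in> complex_vector.span bilin_relations"
    unfolding tensor_eq_def by (rule complex_vector.span_diff)
  then show "tensor_eq (f - g) (f' - g')" by (simp add: tensor_eq_def algebra_simps)
qed

lift_definition uminus_tensor :: "('a, 'b) tensor \<Rightarrow> ('a, 'b) tensor" is uminus
  unfolding tensor_eq_def by (metis complex_vector.span_neg minus_diff_minus)

lift_definition scaleC_tensor :: "complex \<Rightarrow> ('a, 'b) tensor \<Rightarrow> ('a, 'b) tensor" is scaleC
  unfolding tensor_eq_def by (metis complex_vector.scale_right_diff_distrib complex_vector.span_scale)

instance
proof
  have *: "x = y \<Longrightarrow> tensor_eq x y" for x y :: "('a \<times> 'b) \<Rightarrow>\<^sub>0 complex"
    by (simp add: tensor_eq_def complex_vector.span_zero)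
  fix a b :: complex and x y z :: "('a, 'b) tensor"
  show "x + y + z = x + (y + z)" by transfer (rule *, simp add: add.assoc)
  show "x + y = y + x" by transfer (rule *, simp add: add.commute)
  show "0 + x = x" by transfer (rule *, simp)
  show "- x + x = 0" by transfer (rule *, simp)
  show "x - y = x + - y" by transfer (rule *, simp)
  show "a *\<^sub>C (x + y) = a *\<^sub>C x + a *\<^sub>C y" by transfer (rule *, simp add: scaleC_add_right)
  show "(a + b) *\<^sub>C x = a *\<^sub>C x + b *\<^sub>C x" by transfer (rule *, simp add: scaleC_add_left)
  show "a *\<^sub>C b *\<^sub>C x = (a * b) *\<^sub>C x" by transfer (rule *, simp add: scaleC_scaleC)
  show "1 *\<^sub>C x = x" by transfer (rule *, simp add: scaleC_one)
qed

end

lift_definition pure_tensor :: "'a::complex_vector \<Rightarrow> 'b::complex_vector \<Rightarrow> ('a, 'b) tensor"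
  (infixr "\<otimes>\<^sub>t" 72) is "\<lambda>a b. Poly_Mapping.single (a, b) 1" .

lemma pure_tensor_add_left: "(a + a') \<otimes>\<^sub>t b = a \<otimes>\<^sub>t b + a' \<otimes>\<^sub>t b"
  apply transfer
  unfolding tensor_eq_def diff_diff_add[symmetric]
  by (rule complex_vector.span_base) (unfold bilin_relations_def, blast)

lemma pure_tensor_add_right: "a \<otimes>\<^sub>t (b + b') = a \<otimes>\<^sub>t b + a \<otimes>\<^sub>t b'"
  apply transfer
  unfolding tensor_eq_def diff_diff_add[symmetric]
  by (rule complex_vector.span_base) (unfold bilin_relations_def, blast)

lemma pure_tensor_scaleC_left: "(c *\<^sub>C a) \<otimes>\<^sub>t b = c *\<^sub>C (a \<otimes>\<^sub>t b)"
  apply transfer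
  unfolding tensor_eq_def scaleC_single scaleC_complex_def mult_1_right
  by (rule complex_vector.span_base) (unfold bilin_relations_def, blast)

lemma pure_tensor_scaleC_right: "a \<otimes>\<^sub>t (c *\<^sub>C b) = c *\<^sub>C (a \<otimes>\<^sub>t b)"
  apply transfer
  unfolding tensor_eq_def scaleC_single scaleC_complex_def mult_1_right
  by (rule complex_vector.span_base) (unfold bilin_relations_def, blast)

lemma abs_tensor_eq: "abs_tensor f = lin_ext (\<lambda>(a, b). a \<otimes>\<^sub>t b) f"
proof (induction f rule: poly_mapping_induct_single)
  case zero
  then show ?case by (simp add: zero_tensor_def)
next
  case (sgl x c)
  obtain a b where x: "x = (a, b)" by force
  have "abs_tensor (c *\<^sub>C Poly_Mapping.single (a, b) 1) = c *\<^sub>C (a \<otimes>\<^sub>t b)"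
    by (metis pure_tensor.abs_eq scaleC_tensor.abs_eq)
  then show ?case by (simp add: x scaleC_single)
next
  case (add f g)
  then show ?case by (metis plus_tensor.abs_eq lin_ext_add)
qed

lemma tensor_induct [case_names pure add]:
  assumes "\<And>a b. P (a \<otimes>\<^sub>t b)" "\<And>s t. P s \<Longrightarrow> P t \<Longrightarrow> P (s + t)"
  shows "P t"
proof -
  have "P (abs_tensor f)" for f
  proof (induction f rule: poly_mapping_induct_single)
    case zero
    have "0 \<otimes>\<^sub>t 0 = (0 :: ('a, 'b) tensor)"
      using pure_tensor_scaleC_left[of 0 0 0] by simp
    then show ?case
      by (metis assms(1) zero_tensor_def)
  next
    case (sgl x c)
    obtain a b where x: "x = (a, b)" by force
    have "abs_tensor (Poly_Mapping.single x c) = (c *\<^sub>C a) \<otimes>\<^sub>t b"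
      by (simp add: abs_tensor_eq x pure_tensor_scaleC_left)
    then show ?case by (simp add: assms)
  next
    case (add f g)
    then show ?case by (metis plus_tensor.abs_eq assms(2))
  qed
  then show ?thesis using Quotient3_abs_rep[OF Quotient3_tensor, of t] by metis
qed

text \<open>
  Evaluation of a tensor \<open>\<Sum> a\<^sub>i \<otimes> b\<^sub>i\<close> as \<open>\<Sum> B a\<^sub>i b\<^sub>i\<close>.  The coefficients are absorbed into
  the first leg, so that the result does not depend on the representative whenever \<open>B\<close> is biadditive
  and \<open>B (c a) b = B a (c b)\<close>; this covers bilinear as well as antilinear expressions.
\<close>

definition tensor_sum ::
    "('a::complex_vector \<Rightarrow> 'b::complex_vector \<Rightarrow> 'c::comm_monoid_add) \<Rightarrow> ('a, 'b) tensor \<Rightarrow> 'c" where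
  "tensor_sum B t =
     (\<Sum>(a, b)\<in>Poly_Mapping.keys (rep_tensor t). B (Poly_Mapping.lookup (rep_tensor t) (a, b) *\<^sub>C a) b)"

definition balanced ::
    "('a::complex_vector \<Rightarrow> 'b::complex_vector \<Rightarrow> 'c::comm_monoid_add) \<Rightarrow> bool" where
  "balanced B \<longleftrightarrow> (\<forall>a a' b. B (a + a') b = B a b + B a' b) \<and>
     (\<forall>a b b'. B a (b + b') = B a b + B a b') \<and> (\<forall>c a b. B (c *\<^sub>C a) b = B a (c *\<^sub>C b))"

context
  fixes B :: "'a::complex_vector \<Rightarrow> 'b::complex_vector \<Rightarrow> 'c::ab_group_add"
  assumes B: "balanced B"
begin

private definition "ts f = (\<Sum>(a, b)\<in>Poly_Mapping.keys f. B (Poly_Mapping.lookup f (a, b) *\<^sub>C a) b)"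

private lemma B0: "B 0 b = 0" "B a 0 = 0"
  using B unfolding balanced_def by (metis add_cancel_right_right)+

private lemma Bsimps: "B (a + a') b = B a b + B a' b" "B a (b + b') = B a b + B a b'"
  "B a (c *\<^sub>C b) = B (c *\<^sub>C a) b"
  using B unfolding balanced_def by metis+

private lemma ts_superset:
  assumes "finite A" "Poly_Mapping.keys f \<subseteq> A"
  shows "ts f = (\<Sum>(a, b)\<in>A. B (Poly_Mapping.lookup f (a, b) *\<^sub>C a) b)"
  unfolding ts_def using assms
  by (intro sum.mono_neutral_left) (auto simp: in_keys_iff B0)

private lemma ts_add: "ts (f + g) = ts f + ts g"
proof -
  let ?A = "Poly_Mapping.keys f \<union> Poly_Mapping.keys g"
  have "Poly_Mapping.keys (f + g) \<subseteq> ?A" by (rule keys_add)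
  then show ?thesis
    by (simp add: ts_superset[of ?A] lookup_add scaleC_add_left sum.distrib Bsimps case_prod_beta)
qed

private lemma ts_single: "ts (Poly_Mapping.single (a, b) c) = B (c *\<^sub>C a) b"
  by (simp add: ts_def B0)

private lemma ts_diff: "ts (f - g) = ts f - ts g"
  by (metis add_diff_cancel_right' diff_add_cancel ts_add)

private lemma ts_relation:
  assumes "f \<in> bilin_relations"
  shows "ts (c *\<^sub>C f) = 0"
  using assms unfolding bilin_relations_def
  by (auto simp: complex_vector.scale_right_diff_distrib scaleC_single ts_diff ts_single
      scaleC_add_right Bsimps scaleC_scaleC mult.commute)

private lemma ts_span:
  assumes "f \<in> complex_vector.span bilin_relations"
  shows "ts f = 0"
  using assms
proof (induction rule: complex_vector.span_induct_alt)
  case base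
  then show ?case by (simp add: ts_def)
next
  case (step c x y)
  then show ?case by (simp add: ts_add ts_relation)
qed

private lemma tensor_sum_abs: "tensor_sum B (abs_tensor f) = ts f"
proof -
  have "tensor_eq (rep_tensor (abs_tensor f)) f"
    by (simp add: Quotient3_abs_rep[OF Quotient3_tensor] flip: tensor.abs_eq_iff)
  then have "ts (rep_tensor (abs_tensor f) - f) = 0"
    unfolding tensor_eq_def by (rule ts_span)
  then have "ts (rep_tensor (abs_tensor f)) = ts f"
    by (simp add: ts_diff)
  then show ?thesis by (simp add: tensor_sum_def ts_def)
qed

lemma tensor_sum_pure: "tensor_sum B (a \<otimes>\<^sub>t b) = B a b"
  by (simp add: pure_tensor.abs_eq tensor_sum_abs ts_single scaleC_one)

lemma tensor_sum_add: "tensor_sum B (s + t) = tensor_sum B s + tensor_sum B t"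
proof -
  have "s = abs_tensor (rep_tensor s)" "t = abs_tensor (rep_tensor t)"
    by (simp_all add: Quotient3_abs_rep[OF Quotient3_tensor])
  then show ?thesis by (metis plus_tensor.abs_eq tensor_sum_abs ts_add)
qed

end


lemma tensor_sum_scaleC:
  fixes B :: "'a::complex_vector \<Rightarrow> 'b::complex_vector \<Rightarrow> 'c::complex_vector"
  assumes "balanced B" "\<And>c a b. B (c *\<^sub>C a) b = c *\<^sub>C B a b"
  shows "tensor_sum B (c *\<^sub>C t) = c *\<^sub>C tensor_sum B t"
proof (induction t rule: tensor_induct)
  case (pure a b)
  then show ?case
    by (simp add: tensor_sum_pure assms flip: pure_tensor_scaleC_left)
next
  case (add s t)
  then show ?case by (simp add: scaleC_add_right tensor_sum_add assms)
qed

lemma tensor_sum_zero: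
  fixes B :: "'a::complex_vector \<Rightarrow> 'b::complex_vector \<Rightarrow> 'c::ab_group_add"
  assumes "balanced B"
  shows "tensor_sum B 0 = 0"
  using tensor_sum_add[OF assms, of 0 0] by simp

lemma tensor_sum_sum:
  fixes B :: "'a::complex_vector \<Rightarrow> 'b::complex_vector \<Rightarrow> 'c::ab_group_add"
  assumes "balanced B"
  shows "tensor_sum B (\<Sum>i\<in>I. t i) = (\<Sum>i\<in>I. tensor_sum B (t i))"
  by (induction I rule: infinite_finite_induct) (simp_all add: assms tensor_sum_add tensor_sum_zero)

lemma exists_functional_one:
  "\<exists>\<phi> :: 'a::complex_comm_algebra \<Rightarrow> complex.
     (\<forall>x y. \<phi> (x + y) = \<phi> x + \<phi> y) \<and> (\<forall>c x. \<phi> (c *\<^sub>C x) = c * \<phi> x) \<and> \<phi> 1 = 1"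
proof -
  interpret vp: vector_space_pair "scaleC :: complex \<Rightarrow> 'a \<Rightarrow> 'a" "scaleC :: complex \<Rightarrow> complex \<Rightarrow> complex"
    by unfold_locales
  have "complex_vector.independent {1::'a}"
    by (simp add: complex_vector.dependent_single)
  then obtain \<phi> :: "'a \<Rightarrow> complex" where \<phi>: "Vector_Spaces.linear scaleC scaleC \<phi>" "\<phi> 1 = 1"
    using vp.linear_independent_extend[of "{1}" "\<lambda>_. 1"] by auto
  then show ?thesis
    by (intro exI[of _ \<phi>]) (auto simp: vp.linear_add vp.linear_scale)
qed

instantiation tensor :: (complex_comm_algebra, complex_comm_algebra) complex_comm_algebra
begin

definition one_tensor :: "('a, 'b) tensor" where "1 = 1 \<otimes>\<^sub>t 1"

definition times_tensor :: "('a, 'b) tensor \<Rightarrow> ('a, 'b) tensor \<Rightarrow> ('a, 'b) tensor" where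
  "s * t = tensor_sum (\<lambda>a b. tensor_sum (\<lambda>c d. (a * c) \<otimes>\<^sub>t (b * d)) t) s"

context
begin

private lemma inner: "balanced (\<lambda>c d. (a * c) \<otimes>\<^sub>t (b * d) :: ('a, 'b) tensor)"
  unfolding balanced_def
  by (simp add: distrib_left pure_tensor_add_left pure_tensor_add_right mult_scaleC_right
      pure_tensor_scaleC_left pure_tensor_scaleC_right)

private lemma outer: "balanced (\<lambda>a b. tensor_sum (\<lambda>c d. (a * c) \<otimes>\<^sub>t (b * d) :: ('a, 'b) tensor) t)"
proof (induction t rule: tensor_induct)
  case (pure c d)
  show ?case
    unfolding tensor_sum_pure[OF inner] balanced_def
    by (simp add: distrib_right pure_tensor_add_left pure_tensor_add_right mult_scaleC_left
        pure_tensor_scaleC_left pure_tensor_scaleC_right)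
next
  case (add s t)
  then show ?case
    unfolding balanced_def by (simp add: tensor_sum_add[OF inner])
qed

lemma mult_pure_tensor: "(a \<otimes>\<^sub>t b) * (c \<otimes>\<^sub>t d) = (a * c) \<otimes>\<^sub>t (b * d :: 'b)" for a c :: 'a
  unfolding times_tensor_def by (subst tensor_sum_pure[OF outer]) (rule tensor_sum_pure[OF inner])

private lemma tmult_add_left: "(s + s') * t = s * t + s' * t" for s t :: "('a, 'b) tensor"
  unfolding times_tensor_def by (rule tensor_sum_add[OF outer])

private lemma tmult_commute: "s * t = t * s" for s t :: "('a, 'b) tensor"
proof -
  have add_right: "s * (t + t') = s * t + s * t'" for s t t' :: "('a, 'b) tensor"
  proof (induction s rule: tensor_induct)
    case (pure a b)
    then show ?case
      unfolding times_tensor_def tensor_sum_pure[OF outer] by (rule tensor_sum_add[OF inner])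
  next
    case (add s s')
    then show ?case by (simp add: tmult_add_left algebra_simps)
  qed
  show ?thesis
  proof (induction s rule: tensor_induct)
    case (pure a b)
    show ?case
      by (induction t rule: tensor_induct)
        (simp_all add: mult_pure_tensor mult.commute add_right tmult_add_left)
  next
    case (add s s')
    then show ?case by (simp add: tmult_add_left add_right)
  qed
qed

private lemma tmult_add_right: "s * (t + t') = s * t + s * t'" for s t :: "('a, 'b) tensor"
  by (simp add: tmult_commute[of s] tmult_add_left)

private lemma tmult_scaleC: "(c *\<^sub>C s) * t = c *\<^sub>C (s * t)" for s t :: "('a, 'b) tensor"
proof (induction s rule: tensor_induct)
  case (pure a b)
  show ?case
    by (induction t rule: tensor_induct)
      (simp_all add: mult_pure_tensor tmult_add_right scaleC_add_right mult_scaleC_left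
        flip: pure_tensor_scaleC_left)
next
  case (add s s')
  then show ?case by (simp add: tmult_add_left scaleC_add_right)
qed

private lemma tmult_assoc: "r * s * t = r * (s * t)" for r s t :: "('a, 'b) tensor"
proof (induction r rule: tensor_induct)
  case (pure a b)
  show ?case
  proof (induction s rule: tensor_induct)
    case (pure c d)
    show ?case
      by (induction t rule: tensor_induct) (simp_all add: mult_pure_tensor tmult_add_right mult.assoc)
  next
    case (add s s')
    then show ?case by (simp add: tmult_add_left tmult_add_right)
  qed
next
  case (add r r')
  then show ?case by (simp add: tmult_add_left)
qed

private lemma tmult_one: "1 * t = t" for t :: "('a, 'b) tensor"
  by (induction t rule: tensor_induct) (simp_all add: one_tensor_def mult_pure_tensor tmult_add_right)

private lemma tensor_zero_neq_one: "0 \<noteq> (1 :: ('a, 'b) tensor)"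
proof
  assume eq: "0 = (1 :: ('a, 'b) tensor)"
  obtain \<phi> :: "'a \<Rightarrow> complex" and \<psi> :: "'b \<Rightarrow> complex" where
    *: "\<And>x y. \<phi> (x + y) = \<phi> x + \<phi> y" "\<And>c x. \<phi> (c *\<^sub>C x) = c * \<phi> x" "\<phi> 1 = 1"
       "\<And>x y. \<psi> (x + y) = \<psi> x + \<psi> y" "\<And>c x. \<psi> (c *\<^sub>C x) = c * \<psi> x" "\<psi> 1 = 1"
    using exists_functional_one[where 'a = 'a] exists_functional_one[where 'a = 'b] by metis
  have b: "balanced (\<lambda>a b. \<phi> a * \<psi> b)"
    by (simp add: balanced_def * algebra_simps)
  have "tensor_sum (\<lambda>a b. \<phi> a * \<psi> b) 1 = 1"
    unfolding one_tensor_def tensor_sum_pure[OF b] by (simp add: *)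
  then show False
    using tensor_sum_zero[OF b] by (simp flip: eq)
qed

instance
  by standard
    (simp_all add: tmult_assoc tmult_one tmult_add_left tmult_scaleC tensor_zero_neq_one,
     simp add: tmult_commute)

end

end


section \<open>The Hopf algebra Pol O_N\<close>

global_interpretation ideal: module "(*) :: 'a::comm_ring_1 \<Rightarrow> 'a \<Rightarrow> 'a"
  by unfold_locales (simp_all add: algebra_simps)

type_synonym 'g cpoly = "('g \<Rightarrow>\<^sub>0 nat) \<Rightarrow>\<^sub>0 complex"

definition cvar :: "'g \<Rightarrow> 'g cpoly" where
  "cvar g = Poly_Mapping.single (Poly_Mapping.single g 1) 1"

definition cpoly_eval :: "('g::finite \<Rightarrow> 'b::complex_comm_algebra) \<Rightarrow> 'g cpoly \<Rightarrow> 'b" where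
  "cpoly_eval h = lin_ext (\<lambda>m. \<Prod>g\<in>UNIV. h g ^ Poly_Mapping.lookup m g)"

lemma cpoly_eval_var: "cpoly_eval h (cvar g) = h g"
proof -
  have "(\<Prod>g'\<in>UNIV. h g' ^ Poly_Mapping.lookup (Poly_Mapping.single g 1) g')
      = (\<Prod>g'\<in>UNIV. if g' = g then h g' else 1)"
    by (rule prod.cong) (auto simp: lookup_single when_def)
  then show ?thesis
    by (simp add: cpoly_eval_def cvar_def scaleC_one)
qed

lemma cpoly_eval_one: "cpoly_eval h 1 = 1"
  by (simp add: cpoly_eval_def scaleC_one flip: single_one)

lemma cpoly_eval_add: "cpoly_eval h (f + g) = cpoly_eval h f + cpoly_eval h g"
  by (simp add: cpoly_eval_def lin_ext_add)

lemma cpoly_eval_zero: "cpoly_eval h 0 = 0"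
  by (simp add: cpoly_eval_def)

lemma cpoly_eval_diff: "cpoly_eval h (f - g) = cpoly_eval h f - cpoly_eval h g"
  by (simp add: cpoly_eval_def lin_ext_diff)

lemma cpoly_eval_scaleC: "cpoly_eval h (c *\<^sub>C f) = c *\<^sub>C cpoly_eval h f"
  by (simp add: cpoly_eval_def lin_ext_scaleC)

lemma cpoly_eval_sum: "cpoly_eval h (\<Sum>i\<in>I. f i) = (\<Sum>i\<in>I. cpoly_eval h (f i))"
  by (simp add: cpoly_eval_def lin_ext_sum)

lemma cpoly_eval_mult: "cpoly_eval h (f * g) = cpoly_eval h f * cpoly_eval h g"
proof (induction f rule: poly_mapping_induct_single)
  case (sgl m c)
  show ?case
  proof (induction g rule: poly_mapping_induct_single)
    case (sgl m' c')
    show ?case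
      by (simp add: cpoly_eval_def mult_single lookup_add power_add prod.distrib
          mult_scaleC_left mult_scaleC_right scaleC_scaleC)
  qed (simp_all add: cpoly_eval_zero distrib_left cpoly_eval_add)
qed (simp_all add: cpoly_eval_zero distrib_right cpoly_eval_add)

lemma cpoly_induct [case_names one var add scale]:
  fixes f :: "'g cpoly"
  assumes "P 1" "\<And>g f. P f \<Longrightarrow> P (cvar g * f)"
    and add: "\<And>f f'. P f \<Longrightarrow> P f' \<Longrightarrow> P (f + f')" and scale: "\<And>c f. P f \<Longrightarrow> P (c *\<^sub>C f)"
  shows "P f"
proof -
  have pow: "P (Poly_Mapping.single (Poly_Mapping.single g e) 1 * f)" if "P f" for g e f
  proof (induction e)
    case 0
    then show ?case using that by (simp add: single_one)
  next
    case (Suc e)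
    then have "P (cvar g * (Poly_Mapping.single (Poly_Mapping.single g e) 1 * f))"
      by (rule assms(2))
    moreover have "Poly_Mapping.single (Poly_Mapping.single g (Suc e)) 1
        = cvar g * Poly_Mapping.single (Poly_Mapping.single g e) (1::complex)"
      by (simp add: cvar_def mult_single flip: single_add)
    ultimately show ?case by (simp only: mult.assoc)
  qed
  have mon: "P (Poly_Mapping.single m 1 * f)" if "P f" for m :: "'g \<Rightarrow>\<^sub>0 nat" and f
    using that
  proof (induction m arbitrary: f rule: poly_mapping_induct_single)
    case zero
    then show ?case by (simp add: single_one)
  next
    case (sgl g e)
    then show ?case by (rule pow)
  next
    case (add m m')
    then have "P (Poly_Mapping.single m 1 * (Poly_Mapping.single m' 1 * f))" by blast
    moreover have "Poly_Mapping.single (m + m') 1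
        = Poly_Mapping.single m 1 * Poly_Mapping.single m' (1::complex)"
      by (simp add: mult_single)
    ultimately show ?case by (simp only: mult.assoc)
  qed
  show ?thesis
  proof (induction f rule: poly_mapping_induct_single)
    case zero
    then show ?case using scale[OF assms(1), of 0] by simp
  next
    case (sgl m c)
    then show ?case using scale[OF mon[OF assms(1), of m], of c] by (simp add: scaleC_single)
  qed (rule add)
qed

definition orthogonal_entries :: "('n::finite \<Rightarrow> 'n \<Rightarrow> 'b::comm_ring_1) \<Rightarrow> bool" where
  "orthogonal_entries h \<longleftrightarrow>
     (\<forall>i j. (\<Sum>k\<in>UNIV. h i k * h j k) = (if i = j then 1 else 0)) \<and>
     (\<forall>i j. (\<Sum>k\<in>UNIV. h k i * h k j) = (if i = j then 1 else 0))"

definition orthogonality_relations :: "('n::finite \<times> 'n) cpoly set" where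
  "orthogonality_relations =
     {(\<Sum>k\<in>UNIV. cvar (i, k) * cvar (j, k)) - (if i = j then 1 else 0) | i j. True} \<union>
     {(\<Sum>k\<in>UNIV. cvar (k, i) * cvar (k, j)) - (if i = j then 1 else 0) | i j. True}"

definition polO_eq :: "('n::finite \<times> 'n) cpoly \<Rightarrow> ('n \<times> 'n) cpoly \<Rightarrow> bool" where
  "polO_eq f g \<longleftrightarrow> f - g \<in> ideal.span orthogonality_relations"

text \<open>
  The free commutative *-algebra on self-adjoint generators \<open>x\<^sub>i\<^sub>j\<close> is the polynomial algebra with
  the conjugate-linear involution fixing the variables; the ideal below is stable under it.
  The size \<open>N\<close> is \<open>CARD('n)\<close>.
\<close>

quotient_type (overloaded) 'n polO = "('n::finite \<times> 'n) cpoly" / polO_eq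
proof (rule equivpI)
  show "reflp (polO_eq :: ('n \<times> 'n) cpoly \<Rightarrow> _)"
    by (rule reflpI) (simp add: polO_eq_def ideal.span_zero)
  show "symp (polO_eq :: ('n \<times> 'n) cpoly \<Rightarrow> _)"
    by (rule sympI) (metis polO_eq_def ideal.span_neg minus_diff_eq)
  show "transp (polO_eq :: ('n \<times> 'n) cpoly \<Rightarrow> _)"
  proof (rule transpI)
    fix x y z :: "('n \<times> 'n) cpoly"
    assume "polO_eq x y" "polO_eq y z"
    then have "(x - y) + (y - z) \<in> ideal.span orthogonality_relations"
      unfolding polO_eq_def by (rule ideal.span_add)
    then show "polO_eq x z" by (simp add: polO_eq_def)
  qed
qed

lemma cpoly_eval_ideal:
  assumes "orthogonal_entries h" "f \<in> ideal.span orthogonality_relations"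
  shows "cpoly_eval (\<lambda>(i, j). h i j) f = 0"
  using assms(2)
proof (induction rule: ideal.span_induct_alt)
  case base
  then show ?case by (simp add: cpoly_eval_zero)
next
  case (step c x y)
  from step(1) assms(1) have "cpoly_eval (\<lambda>(i, j). h i j) x = 0"
    unfolding orthogonality_relations_def orthogonal_entries_def
    by (auto simp: cpoly_eval_diff cpoly_eval_sum cpoly_eval_mult cpoly_eval_var
        cpoly_eval_one cpoly_eval_zero)
  with step show ?case by (simp add: cpoly_eval_add cpoly_eval_mult)
qed

lemma orthogonal_entries_id:
  "orthogonal_entries (\<lambda>i j :: 'a::finite. if i = j then 1 else 0 :: 'b::comm_ring_1)"
proof -
  have "(\<Sum>k\<in>UNIV. (if i = k then 1 else 0) * (if j = k then 1 else 0) :: 'b)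
      = (\<Sum>k\<in>UNIV. if k = i then (if i = j then 1 else 0) else 0)" for i j :: 'a
    by (rule sum.cong) auto
  moreover have "(\<Sum>k\<in>UNIV. (if k = i then 1 else 0) * (if k = j then 1 else 0) :: 'b)
      = (\<Sum>k\<in>UNIV. if k = i then (if i = j then 1 else 0) else 0)" for i j :: 'a
    by (rule sum.cong) auto
  ultimately show ?thesis unfolding orthogonal_entries_def by simp
qed

instantiation polO :: (finite) complex_comm_algebra
begin

lift_definition zero_polO :: "'a polO" is 0 .

lift_definition one_polO :: "'a polO" is 1 .

lift_definition plus_polO :: "'a polO \<Rightarrow> 'a polO \<Rightarrow> 'a polO" is "(+)"
  unfolding polO_eq_def by (metis add_diff_add ideal.span_add)

lift_definition minus_polO :: "'a polO \<Rightarrow> 'a polO \<Rightarrow> 'a polO" is "(-)"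
proof -
  fix f f' g g' :: "('a \<times> 'a) cpoly"
  assume "polO_eq f f'" "polO_eq g g'"
  then have "(f - f') - (g - g') \<in> ideal.span orthogonality_relations"
    unfolding polO_eq_def by (rule ideal.span_diff)
  then show "polO_eq (f - g) (f' - g')" by (simp add: polO_eq_def algebra_simps)
qed

lift_definition uminus_polO :: "'a polO \<Rightarrow> 'a polO" is uminus
  unfolding polO_eq_def by (metis ideal.span_neg minus_diff_minus)

lift_definition times_polO :: "'a polO \<Rightarrow> 'a polO \<Rightarrow> 'a polO" is "(*)"
proof -
  fix f f' g g' :: "('a \<times> 'a) cpoly"
  assume "polO_eq f f'" "polO_eq g g'"
  then have "f * (g - g') + g' * (f - f') \<in> ideal.span orthogonality_relations"
    unfolding polO_eq_def by (intro ideal.span_add ideal.span_scale)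
  then show "polO_eq (f * g) (f' * g')" by (simp add: polO_eq_def algebra_simps)
qed

lift_definition scaleC_polO :: "complex \<Rightarrow> 'a polO \<Rightarrow> 'a polO" is scaleC
proof -
  fix c and f g :: "('a \<times> 'a) cpoly"
  assume "polO_eq f g"
  then have "(c *\<^sub>C 1) * (f - g) \<in> ideal.span orthogonality_relations"
    unfolding polO_eq_def by (rule ideal.span_scale)
  then show "polO_eq (c *\<^sub>C f) (c *\<^sub>C g)"
    by (simp add: polO_eq_def mult_scaleC_left complex_vector.scale_right_diff_distrib)
qed

instance
proof
  have *: "x = y \<Longrightarrow> polO_eq x y" for x y :: "('a \<times> 'a) cpoly"
    by (simp add: polO_eq_def ideal.span_zero)
  fix a b :: complex and x y z :: "'a polO"
  show "x + y + z = x + (y + z)" by transfer (rule *, simp add: add.assoc)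
  show "x + y = y + x" by transfer (rule *, simp add: add.commute)
  show "0 + x = x" by transfer (rule *, simp)
  show "- x + x = 0" by transfer (rule *, simp)
  show "x - y = x + - y" by transfer (rule *, simp)
  show "a *\<^sub>C (x + y) = a *\<^sub>C x + a *\<^sub>C y" by transfer (rule *, simp add: scaleC_add_right)
  show "(a + b) *\<^sub>C x = a *\<^sub>C x + b *\<^sub>C x" by transfer (rule *, simp add: scaleC_add_left)
  show "a *\<^sub>C b *\<^sub>C x = (a * b) *\<^sub>C x" by transfer (rule *, simp add: scaleC_scaleC)
  show "1 *\<^sub>C x = x" by transfer (rule *, simp add: scaleC_one)
  show "x * y * z = x * (y * z)" by transfer (rule *, rule mult.assoc)
  show "x * y = y * x" by transfer (rule *, rule mult.commute)
  show "1 * x = x" by transfer (rule *, simp)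
  show "(x + y) * z = x * z + y * z" by transfer (rule *, rule distrib_right)
  show "(a *\<^sub>C x) * y = a *\<^sub>C (x * y)" by transfer (rule *, rule mult_scaleC_left)
  show "0 \<noteq> (1 :: 'a polO)"
  proof
    assume "0 = (1 :: 'a polO)"
    then have "(0 - 1 :: ('a \<times> 'a) cpoly) \<in> ideal.span orthogonality_relations"
      by transfer (simp add: polO_eq_def)
    then have "cpoly_eval (\<lambda>(i, j). if i = j then 1 else 0 :: complex)
        (0 - 1 :: ('a \<times> 'a) cpoly) = 0"
      by (rule cpoly_eval_ideal[OF orthogonal_entries_id])
    then show False
      unfolding cpoly_eval_diff cpoly_eval_zero cpoly_eval_one by simp
  qed
qed

end

lift_definition polO_gen :: "'n::finite \<Rightarrow> 'n \<Rightarrow> 'n polO" is "\<lambda>i j. cvar (i, j)" .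

lemma polO_induct [case_names one gen add scale]:
  fixes x :: "'n::finite polO"
  assumes "P 1" "\<And>i j x. P x \<Longrightarrow> P (polO_gen i j * x)"
    "\<And>x y. P x \<Longrightarrow> P y \<Longrightarrow> P (x + y)" "\<And>c x. P x \<Longrightarrow> P (c *\<^sub>C x)"
  shows "P x"
proof -
  have "P (abs_polO f)" for f
  proof (induction f rule: cpoly_induct)
    case (var g f)
    then show ?case by (cases g) (metis assms(2) polO_gen.abs_eq times_polO.abs_eq)
  qed (use assms in \<open>simp_all add: one_polO_def flip: plus_polO.abs_eq scaleC_polO.abs_eq\<close>)
  then show ?thesis using Quotient3_abs_rep[OF Quotient3_polO, of x] by metis
qed

lemma orthogonal_entries_gen: "orthogonal_entries (polO_gen :: 'n::finite \<Rightarrow> _)"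
proof -
  have s: "(\<Sum>k\<in>A. abs_polO (f k)) = abs_polO (\<Sum>k\<in>A. f k)" for f :: "'n \<Rightarrow> ('n \<times> 'n) cpoly" and A
    by (induction A rule: infinite_finite_induct) (simp_all add: zero_polO_def plus_polO.abs_eq)
  have d: "(if i = j then 1 else 0) = abs_polO (if i = j then 1 else 0)" for i j :: 'n
    by (simp add: zero_polO_def one_polO_def)
  show ?thesis
    unfolding orthogonal_entries_def polO_gen.abs_eq times_polO.abs_eq s d polO.abs_eq_iff polO_eq_def
    by (intro conjI allI ideal.span_base) (unfold orthogonality_relations_def, blast+)
qed

text \<open>
  The algebra homomorphism with \<open>u\<^sub>i\<^sub>j \<mapsto> h i j\<close>; meaningful only for \<open>h\<close> with
  \<open>orthogonal_entries h\<close>, see \<open>polO_universal_property\<close>.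
\<close>

definition polO_hom ::
    "('n::finite \<Rightarrow> 'n \<Rightarrow> 'b::complex_comm_algebra) \<Rightarrow> 'n polO \<Rightarrow> 'b" where
  "polO_hom h x = cpoly_eval (\<lambda>(i, j). h i j) (rep_polO x)"

lemma polO_hom_abs:
  assumes "orthogonal_entries h"
  shows "polO_hom h (abs_polO f) = cpoly_eval (\<lambda>(i, j). h i j) f"
proof -
  have "polO_eq (rep_polO (abs_polO f)) f"
    by (simp add: Quotient3_abs_rep[OF Quotient3_polO] flip: polO.abs_eq_iff)
  then have "cpoly_eval (\<lambda>(i, j). h i j) (rep_polO (abs_polO f) - f) = 0"
    unfolding polO_eq_def by (rule cpoly_eval_ideal[OF assms])
  then show ?thesis by (simp add: polO_hom_def cpoly_eval_diff)
qed

lemma polO_universal_property: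
  assumes "orthogonal_entries h"
  shows "polO_hom h (polO_gen i j) = h i j" "polO_hom h 1 = 1"
    "polO_hom h (x + y) = polO_hom h x + polO_hom h y"
    "polO_hom h (x * y) = polO_hom h x * polO_hom h y"
    "polO_hom h (c *\<^sub>C x) = c *\<^sub>C polO_hom h x"
proof -
  obtain f g where x: "x = abs_polO f" and y: "y = abs_polO g"
    using Quotient3_abs_rep[OF Quotient3_polO] by metis
  note hom = polO_hom_abs[OF assms]
  show "polO_hom h (polO_gen i j) = h i j"
    by (simp add: polO_gen.abs_eq hom cpoly_eval_var)
  show "polO_hom h 1 = 1"
    by (simp add: one_polO_def hom cpoly_eval_one)
  show "polO_hom h (x + y) = polO_hom h x + polO_hom h y"
    by (simp add: x y plus_polO.abs_eq hom cpoly_eval_add)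
  show "polO_hom h (x * y) = polO_hom h x * polO_hom h y"
    by (simp add: x y times_polO.abs_eq hom cpoly_eval_mult)
  show "polO_hom h (c *\<^sub>C x) = c *\<^sub>C polO_hom h x"
    by (simp add: x scaleC_polO.abs_eq hom cpoly_eval_scaleC)
qed

lemma map_cnj_mult:
  "Poly_Mapping.map cnj (f * g) = Poly_Mapping.map cnj f * Poly_Mapping.map cnj g"
  and map_cnj_add: "Poly_Mapping.map cnj (f + g) = Poly_Mapping.map cnj f + Poly_Mapping.map cnj g"
  for f g :: "'g cpoly"
proof -
  have lk: "Poly_Mapping.lookup (Poly_Mapping.map cnj f) k = cnj (Poly_Mapping.lookup f k)"
    for f :: "'g cpoly" and k
    by (simp add: Poly_Mapping.map.rep_eq when_def)
  have add: "Poly_Mapping.map cnj (f + g) = Poly_Mapping.map cnj f + Poly_Mapping.map cnj g"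
    for f g :: "'g cpoly"
    by (rule poly_mapping_eqI) (simp add: lk lookup_add)
  then show "Poly_Mapping.map cnj (f + g) = Poly_Mapping.map cnj f + Poly_Mapping.map cnj g" .
  have sgl: "Poly_Mapping.map cnj (Poly_Mapping.single k c) = Poly_Mapping.single k (cnj c)"
    for k :: "'g \<Rightarrow>\<^sub>0 nat" and c
    by (rule poly_mapping_eqI) (simp add: lk lookup_single when_def)
  have z: "Poly_Mapping.map cnj 0 = (0 :: 'g cpoly)"
    by (rule poly_mapping_eqI) (simp add: lk)
  show "Poly_Mapping.map cnj (f * g) = Poly_Mapping.map cnj f * Poly_Mapping.map cnj g"
  proof (induction f rule: poly_mapping_induct_single)
    case (sgl k c)
    show ?case
      by (induction g rule: poly_mapping_induct_single)
        (simp_all add: sgl z add mult_single distrib_left \<open>\<And>k c. Poly_Mapping.map cnj (Poly_Mapping.single k c) = _\<close>)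
  qed (simp_all add: z add distrib_right)
qed

lift_definition polO_star :: "'n::finite polO \<Rightarrow> 'n polO" is "Poly_Mapping.map cnj"
proof -
  fix f g :: "('n \<times> 'n) cpoly"
  let ?c = "Poly_Mapping.map cnj :: ('n \<times> 'n) cpoly \<Rightarrow> _"
  have lk: "Poly_Mapping.lookup (?c f) k = cnj (Poly_Mapping.lookup f k)" for f k
    by (simp add: Poly_Mapping.map.rep_eq when_def)
  have diff: "?c (f - g) = ?c f - ?c g" for f g
    by (rule poly_mapping_eqI) (simp add: lk lookup_minus)
  have z: "?c 0 = 0" by (rule poly_mapping_eqI) (simp add: lk)
  have o: "?c 1 = 1" by (rule poly_mapping_eqI) (simp add: lk lookup_one when_def)
  have v: "?c (cvar x) = cvar x" for x
    by (rule poly_mapping_eqI) (simp add: lk cvar_def lookup_single when_def)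
  have s: "?c (\<Sum>i\<in>I. f i) = (\<Sum>i\<in>I. ?c (f i))" for f and I :: "'n set"
    by (induction I rule: infinite_finite_induct) (simp_all add: z map_cnj_add)
  have rel: "?c f = f" if "f \<in> orthogonality_relations" for f
    using that unfolding orthogonality_relations_def
    by (auto simp: diff s map_cnj_mult v o z)
  assume "polO_eq f g"
  then have "?c (f - g) \<in> ideal.span orthogonality_relations"
    unfolding polO_eq_def
  proof (induction rule: ideal.span_induct_alt)
    case base
    then show ?case by (simp add: z ideal.span_zero)
  next
    case (step a x y)
    then show ?case
      by (simp add: map_cnj_add map_cnj_mult rel ideal.span_add ideal.span_scale ideal.span_base)
  qed
  then show "polO_eq (?c f) (?c g)" by (simp add: polO_eq_def diff)
qed

definition comult :: "'n::finite polO \<Rightarrow> ('n polO, 'n polO) tensor" where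
  "comult = polO_hom (\<lambda>i j. \<Sum>k\<in>UNIV. polO_gen i k \<otimes>\<^sub>t polO_gen k j)"

definition counit :: "'n::finite polO \<Rightarrow> complex" where
  "counit = polO_hom (\<lambda>i j. if i = j then 1 else 0)"

definition antipode :: "'n::finite polO \<Rightarrow> 'n polO" where
  "antipode = polO_hom (\<lambda>i j. polO_gen j i)"

lemma pure_tensor_zero [simp]: "0 \<otimes>\<^sub>t b = 0" "a \<otimes>\<^sub>t 0 = 0"
  using pure_tensor_scaleC_left[of 0 0 b] pure_tensor_scaleC_right[of a 0 0] by simp_all

lemma pure_tensor_sum_left: "(\<Sum>i\<in>I. f i) \<otimes>\<^sub>t b = (\<Sum>i\<in>I. f i \<otimes>\<^sub>t b)"
  by (induction I rule: infinite_finite_induct) (simp_all add: pure_tensor_add_left)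

lemma pure_tensor_sum_right: "a \<otimes>\<^sub>t (\<Sum>i\<in>I. f i) = (\<Sum>i\<in>I. a \<otimes>\<^sub>t f i)"
  by (induction I rule: infinite_finite_induct) (simp_all add: pure_tensor_add_right)

lemma orthogonal_entries_comult:
  "orthogonal_entries (\<lambda>i j. \<Sum>k\<in>UNIV. polO_gen i k \<otimes>\<^sub>t polO_gen k j)"
proof -
  note o = orthogonal_entries_gen[unfolded orthogonal_entries_def]
  have 1: "(\<Sum>k\<in>UNIV. (\<Sum>a\<in>UNIV. polO_gen i a \<otimes>\<^sub>t polO_gen a k) *
        (\<Sum>b\<in>UNIV. polO_gen j b \<otimes>\<^sub>t polO_gen b k)) = (if i = j then 1 else 0)" for i j :: 'a
  proof -
    have "(\<Sum>k\<in>UNIV. (\<Sum>a\<in>UNIV. polO_gen i a \<otimes>\<^sub>t polO_gen a k) *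
        (\<Sum>b\<in>UNIV. polO_gen j b \<otimes>\<^sub>t polO_gen b k))
      = (\<Sum>k\<in>UNIV. \<Sum>a\<in>UNIV. \<Sum>b\<in>UNIV.
          (polO_gen i a * polO_gen j b) \<otimes>\<^sub>t (polO_gen a k * polO_gen b k))"
      by (simp add: sum_product mult_pure_tensor)
    also have "\<dots> = (\<Sum>a\<in>UNIV. \<Sum>b\<in>UNIV. \<Sum>k\<in>UNIV.
          (polO_gen i a * polO_gen j b) \<otimes>\<^sub>t (polO_gen a k * polO_gen b k))"
      by (subst sum.swap, rule sum.cong[OF refl], rule sum.swap)
    also have "\<dots> = (\<Sum>a\<in>UNIV. \<Sum>b\<in>UNIV.
          if a = b then (polO_gen i a * polO_gen j b) \<otimes>\<^sub>t 1 else 0)"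
      by (intro sum.cong refl) (simp add: o flip: pure_tensor_sum_right)
    also have "\<dots> = (if i = j then 1 else 0)"
      by (simp add: o sum.delta one_tensor_def flip: pure_tensor_sum_left)
    finally show ?thesis .
  qed
  have 2: "(\<Sum>k\<in>UNIV. (\<Sum>a\<in>UNIV. polO_gen k a \<otimes>\<^sub>t polO_gen a i) *
        (\<Sum>b\<in>UNIV. polO_gen k b \<otimes>\<^sub>t polO_gen b j)) = (if i = j then 1 else 0)" for i j :: 'a
  proof -
    have "(\<Sum>k\<in>UNIV. (\<Sum>a\<in>UNIV. polO_gen k a \<otimes>\<^sub>t polO_gen a i) *
        (\<Sum>b\<in>UNIV. polO_gen k b \<otimes>\<^sub>t polO_gen b j))
      = (\<Sum>k\<in>UNIV. \<Sum>a\<in>UNIV. \<Sum>b\<in>UNIV.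
          (polO_gen k a * polO_gen k b) \<otimes>\<^sub>t (polO_gen a i * polO_gen b j))"
      by (simp add: sum_product mult_pure_tensor)
    also have "\<dots> = (\<Sum>a\<in>UNIV. \<Sum>b\<in>UNIV. \<Sum>k\<in>UNIV.
          (polO_gen k a * polO_gen k b) \<otimes>\<^sub>t (polO_gen a i * polO_gen b j))"
      by (subst sum.swap, rule sum.cong[OF refl], rule sum.swap)
    also have "\<dots> = (\<Sum>a\<in>UNIV. \<Sum>b\<in>UNIV.
          if a = b then 1 \<otimes>\<^sub>t (polO_gen a i * polO_gen b j) else 0)"
      by (intro sum.cong refl) (simp add: o flip: pure_tensor_sum_left)
    also have "\<dots> = (if i = j then 1 else 0)"
      by (simp add: o sum.delta one_tensor_def flip: pure_tensor_sum_right)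
    finally show ?thesis .
  qed
  show ?thesis unfolding orthogonal_entries_def using 1 2 by blast
qed

lemma orthogonal_entries_transpose: "orthogonal_entries h \<Longrightarrow> orthogonal_entries (\<lambda>i j. h j i)"
  unfolding orthogonal_entries_def by blast



section \<open>The twist\<close>

text \<open>The group \<open>\<int>\<^sub>2\<^sup>N\<close> is the additive group \<open>bit ^ 'n\<close>, its generators are \<open>t\<^sub>i = axis i 1\<close>,
  and its group algebra is \<open>bit ^ 'n \<Rightarrow>\<^sub>0 complex\<close> with the convolution product.\<close>

definition torus_hom :: "'n::finite polO \<Rightarrow> ((bit ^ 'n) \<Rightarrow>\<^sub>0 complex)" where
  "torus_hom = polO_hom (\<lambda>i j. if i = j then Poly_Mapping.single (axis i 1) 1 else 0)"

lemma orthogonal_entries_torus: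
  "orthogonal_entries (\<lambda>i j :: 'n::finite.
     if i = j then Poly_Mapping.single (axis i 1) 1 else 0 :: (bit ^ 'n) \<Rightarrow>\<^sub>0 complex)"
proof -
  let ?h = "\<lambda>i j :: 'n. if i = j then Poly_Mapping.single (axis i 1) 1 else 0 :: (bit ^ 'n) \<Rightarrow>\<^sub>0 complex"
  have t: "axis i (1::bit) + axis i 1 = 0" for i :: 'n
    by (simp add: vec_eq_iff axis_def)
  have "(\<Sum>k\<in>UNIV. ?h i k * ?h j k) = (\<Sum>k\<in>UNIV. if k = i then (if i = j then 1 else 0) else 0)" for i j
    by (rule sum.cong) (auto simp: mult_single t)
  moreover have "(\<Sum>k\<in>UNIV. ?h k i * ?h k j) = (\<Sum>k\<in>UNIV. if k = i then (if i = j then 1 else 0) else 0)" for i j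
    by (rule sum.cong) (auto simp: mult_single t)
  ultimately show ?thesis unfolding orthogonal_entries_def by simp
qed

definition bicharacter :: "('g::ab_group_add \<Rightarrow> 'g \<Rightarrow> complex) \<Rightarrow> bool" where
  "bicharacter \<beta> \<longleftrightarrow> (\<forall>g h. \<beta> g h \<noteq> 0) \<and>
     (\<forall>g g' h. \<beta> (g + g') h = \<beta> g h * \<beta> g' h) \<and> (\<forall>g h h'. \<beta> g (h + h') = \<beta> g h * \<beta> g h')"

text \<open>The unique bicharacter with \<open>(t\<^sub>i, t\<^sub>j) \<mapsto> s i j\<close>, for \<open>s\<close> with entries \<open>1, -1\<close>; see
  \<open>bicharacter_unique\<close>.\<close>

definition bicharacter_of :: "('n::finite \<Rightarrow> 'n \<Rightarrow> complex) \<Rightarrow> bit ^ 'n \<Rightarrow> bit ^ 'n \<Rightarrow> complex" where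
  "bicharacter_of s g h = (\<Prod>i\<in>UNIV. \<Prod>j\<in>UNIV. if g $ i = 1 \<and> h $ j = 1 then s i j else 1)"

lemma bicharacter_of:
  assumes "\<And>i j. s i j \<in> {1, -1}"
  shows "bicharacter (bicharacter_of s)" "bicharacter_of s (axis i 1) (axis j 1) = s i j"
proof -
  have nz: "s i j \<noteq> 0" for i j using assms[of i j] by auto
  have sq: "s i j * s i j = 1" for i j using assms[of i j] by auto
  have bit: "(a::bit) = 0 \<or> a = 1" for a by (cases a) auto
  have l: "(if a + a' = 1 \<and> b = 1 then s i j else 1) =
      (if a = 1 \<and> b = 1 then s i j else 1) * (if a' = 1 \<and> b = 1 then s i j else 1)"
    for a a' b :: bit and i j
    using bit[of a] bit[of a'] by (auto simp: sq)
  have r: "(if b = 1 \<and> a + a' = 1 then s i j else 1) =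
      (if b = 1 \<and> a = 1 then s i j else 1) * (if b = 1 \<and> a' = 1 then s i j else 1)"
    for a a' b :: bit and i j
    using bit[of a] bit[of a'] by (auto simp: sq)
  have "bicharacter_of s g h \<noteq> 0" for g h
    by (simp add: bicharacter_of_def nz)
  moreover have "bicharacter_of s (g + g') h = bicharacter_of s g h * bicharacter_of s g' h" for g g' h
    unfolding bicharacter_of_def prod.distrib[symmetric] vector_add_component
    by (intro prod.cong refl l)
  moreover have "bicharacter_of s g (h + h') = bicharacter_of s g h * bicharacter_of s g h'" for g h h'
    unfolding bicharacter_of_def prod.distrib[symmetric] vector_add_component
    by (intro prod.cong refl r)
  ultimately show "bicharacter (bicharacter_of s)"
    unfolding bicharacter_def by blast
  have "bicharacter_of s (axis i 1) (axis j 1) = (\<Prod>i'\<in>UNIV. \<Prod>j'\<in>UNIV.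
      if j' = j then (if i' = i then s i j else 1) else 1)"
    unfolding bicharacter_of_def by (intro prod.cong refl) (auto simp: axis_def)
  also have "\<dots> = s i j" by simp
  finally show "bicharacter_of s (axis i 1) (axis j 1) = s i j" .
qed

lemma bicharacter_unique:
  assumes \<beta>: "bicharacter \<beta>" "\<And>i j :: 'n::finite. \<beta> (axis i 1) (axis j 1) = s i j"
  shows "\<beta> = bicharacter_of s"
proof -
  have z: "\<beta> 0 h = 1" "\<beta> g 0 = 1" for g h
    using \<beta>(1) unfolding bicharacter_def
    by (metis add_0 mult_cancel_right1)+
  have s1: "\<beta> (\<Sum>i\<in>I. f i) h = (\<Prod>i\<in>I. \<beta> (f i) h)" for I :: "'n set" and f h
    by (induction I rule: infinite_finite_induct) (use z \<beta>(1) in \<open>auto simp: bicharacter_def\<close>)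
  have s2: "\<beta> g (\<Sum>i\<in>I. f i) = (\<Prod>i\<in>I. \<beta> g (f i))" for I :: "'n set" and f g
    by (induction I rule: infinite_finite_induct) (use z \<beta>(1) in \<open>auto simp: bicharacter_def\<close>)
  have e: "g = (\<Sum>i\<in>UNIV. if g $ i = 1 then axis i 1 else 0)" for g :: "bit ^ 'n"
  proof -
    have "(\<Sum>i\<in>UNIV. (if g $ i = 1 then axis i 1 else 0) $ k) = (\<Sum>i\<in>UNIV. if i = k then g $ k else 0)" for k
      by (rule sum.cong) (auto simp: axis_def)
    then show ?thesis by (simp add: vec_eq_iff)
  qed
  show ?thesis
  proof (intro ext)
    fix g h :: "bit ^ 'n"
    have "\<beta> g h = \<beta> (\<Sum>i\<in>UNIV. if g $ i = 1 then axis i 1 else 0) (\<Sum>j\<in>UNIV. if h $ j = 1 then axis j 1 else 0)"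
      using e by metis
    also have "\<dots> = bicharacter_of s g h"
      unfolding s1 unfolding s2 bicharacter_of_def by (intro prod.cong refl) (auto simp: z \<beta>(2))
    finally show "\<beta> g h = bicharacter_of s g h" .
  qed
qed

text \<open>Bilinear extension of a function on the group, composed with \<open>torus_hom\<close> in both arguments.\<close>

definition torus_form ::
    "(bit ^ 'n \<Rightarrow> bit ^ 'n \<Rightarrow> complex) \<Rightarrow> 'n::finite polO \<Rightarrow> 'n polO \<Rightarrow> complex" where
  "torus_form \<beta> x y = lin_ext (\<lambda>g. lin_ext (\<lambda>h. \<beta> g h) (torus_hom y)) (torus_hom x)"

definition twist_cocycle :: "('n::finite \<Rightarrow> 'n \<Rightarrow> complex) \<Rightarrow> 'n polO \<Rightarrow> 'n polO \<Rightarrow> complex" where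
  "twist_cocycle s = torus_form (bicharacter_of s)"

text \<open>The convolution inverse of \<open>twist_cocycle s\<close>, see \<open>twist_cocycle_convolution_inverse\<close>.\<close>

definition twist_cocycle_inv :: "('n::finite \<Rightarrow> 'n \<Rightarrow> complex) \<Rightarrow> 'n polO \<Rightarrow> 'n polO \<Rightarrow> complex" where
  "twist_cocycle_inv s = torus_form (\<lambda>g h. inverse (bicharacter_of s g h))"

text \<open>Sweedler notation: \<open>sweedler2 x (\<lambda>x\<^sub>1 x\<^sub>2. e)\<close> stands for \<open>e\<close> with \<open>x\<^sub>i = x\<^bsub>(i)\<^esub>\<close> and
  summation understood, and similarly for more legs.\<close>

definition sweedler2 ::
    "'n::finite polO \<Rightarrow> ('n polO \<Rightarrow> 'n polO \<Rightarrow> 'b::comm_monoid_add) \<Rightarrow> 'b" where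
  "sweedler2 x f = tensor_sum f (comult x)"

definition sweedler3 ::
    "'n::finite polO \<Rightarrow> ('n polO \<Rightarrow> 'n polO \<Rightarrow> 'n polO \<Rightarrow> 'b::comm_monoid_add) \<Rightarrow> 'b" where
  "sweedler3 x f = sweedler2 x (\<lambda>x1 y. sweedler2 y (\<lambda>x2 x3. f x1 x2 x3))"

definition sweedler5 ::
    "'n::finite polO \<Rightarrow>
     ('n polO \<Rightarrow> 'n polO \<Rightarrow> 'n polO \<Rightarrow> 'n polO \<Rightarrow> 'n polO \<Rightarrow> 'b::comm_monoid_add) \<Rightarrow> 'b" where
  "sweedler5 x f = sweedler3 x (\<lambda>x1 x2 y. sweedler3 y (\<lambda>x3 x4 x5. f x1 x2 x3 x4 x5))"

context
begin

private lemmas hom = polO_universal_property[OF orthogonal_entries_torus, folded torus_hom_def]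
private lemmas chom = polO_universal_property[OF orthogonal_entries_comult, folded comult_def]
private lemmas ehom = polO_universal_property[OF orthogonal_entries_id[where 'b = complex], folded counit_def]

private lemma lin_ext_one: "lin_ext F 1 = F 0"
  by (simp add: scaleC_one flip: single_one)

private lemma lin_ext_times: "lin_ext (\<lambda>g. c * h g) f = c * lin_ext h f" for c :: complex
  using lin_ext_fun_scaleC[of c h f] by simp

private lemma form_balanced: "balanced (torus_form \<beta>)"
  by (simp add: balanced_def torus_form_def hom lin_ext_add lin_ext_fun_add lin_ext_scaleC
      lin_ext_times)

private lemma lin_ext_swap:
  "lin_ext (\<lambda>g. lin_ext (\<lambda>h. F g h) f') f = lin_ext (\<lambda>h. lin_ext (\<lambda>g. F g h) f) f'"
  for F :: "_ \<Rightarrow> _ \<Rightarrow> complex"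
  unfolding lin_ext_def scaleC_complex_def sum_distrib_left
  by (subst sum.swap, intro sum.cong refl) (rule mult.left_commute)

private lemma lin_ext_product:
  "lin_ext a f * lin_ext b g = lin_ext (\<lambda>x. lin_ext (\<lambda>y. a x * b y) g) f" for a b :: "_ \<Rightarrow> complex"
  unfolding lin_ext_def scaleC_complex_def sum_product unfolding sum_distrib_left
  by (intro sum.cong refl) (simp only: mult_ac)

private lemma lin_ext_shift: "lin_ext F (Poly_Mapping.single g 1 * f) = lin_ext (\<lambda>h. F (g + h)) f"
  by (induction f rule: poly_mapping_induct_single)
    (simp_all add: mult_single distrib_left lin_ext_add)

private lemma form_comult:
  "tensor_sum (torus_form F) (comult x) = lin_ext (\<lambda>g. F g g) (torus_hom x)"
proof (induction x arbitrary: F rule: polO_induct)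
  case one
  show ?case
    unfolding chom one_tensor_def tensor_sum_pure[OF form_balanced]
    by (simp add: torus_form_def hom lin_ext_one)
next
  case (gen i j x)
  have m: "tensor_sum (torus_form F) ((a \<otimes>\<^sub>t b) * t) =
      tensor_sum (\<lambda>c d. torus_form F (a * c) (b * d)) t" for a b t
  proof -
    have b: "balanced (\<lambda>c d. torus_form F (a * c) (b * d))"
      using form_balanced[of F] unfolding balanced_def
      by (simp add: distrib_left mult_scaleC_right)
    show ?thesis
      by (induction t rule: tensor_induct)
        (simp_all add: mult_pure_tensor tensor_sum_pure[OF form_balanced] tensor_sum_pure[OF b]
          tensor_sum_add[OF form_balanced] tensor_sum_add[OF b] distrib_left)
  qed
  have s: "torus_form F (polO_gen i k * c) (polO_gen k j * d) =
     (if i = k \<and> k = j then torus_form (\<lambda>g h. F (axis i 1 + g) (axis i 1 + h)) c d else 0)" for k c d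
    by (auto simp: torus_form_def hom lin_ext_shift)
  have z: "tensor_sum (\<lambda>c d. 0 :: complex) t = 0" for t :: "('a polO, 'a polO) tensor"
    by (simp add: tensor_sum_def)
  have "tensor_sum (torus_form F) (comult (polO_gen i j * x)) =
      (\<Sum>k\<in>UNIV. if k = i then (if i = j then lin_ext (\<lambda>g. F (axis i 1 + g) (axis i 1 + g)) (torus_hom x) else 0) else 0)"
    unfolding chom sum_distrib_right tensor_sum_sum[OF form_balanced] m s
    by (intro sum.cong refl) (auto simp: gen z)
  also have "\<dots> = lin_ext (\<lambda>g. F g g) (torus_hom (polO_gen i j * x))"
    by (auto simp: hom lin_ext_shift)
  finally show ?case .
next
  case (add x y)
  then show ?case by (simp add: chom hom tensor_sum_add[OF form_balanced] lin_ext_add)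
next
  case (scale c x)
  have "torus_form F (c *\<^sub>C a) b = c *\<^sub>C torus_form F a b" for a b c
    by (simp add: torus_form_def hom lin_ext_scaleC)
  with scale show ?case
    by (simp add: chom hom tensor_sum_scaleC[OF form_balanced] lin_ext_scaleC)
qed

private lemma counit_torus: "counit x = lin_ext (\<lambda>_. 1) (torus_hom x)"
  by (induction x rule: polO_induct)
    (auto simp: hom ehom lin_ext_one lin_ext_add lin_ext_scaleC lin_ext_shift)

lemma torus_form_convolution_inverse:
  assumes "\<And>g h. \<beta> g h * \<gamma> g h = 1"
  shows "sweedler2 x (\<lambda>x1 x2. sweedler2 y (\<lambda>y1 y2. torus_form \<beta> x1 y1 * torus_form \<gamma> x2 y2))
    = counit x * counit y"
proof -
  have "torus_form \<beta> x1 y1 * torus_form \<gamma> x2 y2 =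
      torus_form (\<lambda>h h'. lin_ext (\<lambda>g. \<beta> g h) (torus_hom x1) * lin_ext (\<lambda>g. \<gamma> g h') (torus_hom x2)) y1 y2"
    for x1 x2 y1 y2
    unfolding torus_form_def lin_ext_product[symmetric]
    by (rule arg_cong2[where f = "(*)"]) (rule lin_ext_swap)+
  then have 1: "sweedler2 y (\<lambda>y1 y2. torus_form \<beta> x1 y1 * torus_form \<gamma> x2 y2) =
     lin_ext (\<lambda>h. lin_ext (\<lambda>g. \<beta> g h) (torus_hom x1) * lin_ext (\<lambda>g. \<gamma> g h) (torus_hom x2)) (torus_hom y)"
    for x1 x2
    by (simp add: sweedler2_def form_comult)
  have 2: "lin_ext (\<lambda>h. lin_ext (\<lambda>g. \<beta> g h) (torus_hom x1) * lin_ext (\<lambda>g. \<gamma> g h) (torus_hom x2)) (torus_hom y)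
      = torus_form (\<lambda>g g'. lin_ext (\<lambda>h. \<beta> g h * \<gamma> g' h) (torus_hom y)) x1 x2" for x1 x2
    unfolding torus_form_def lin_ext_product
    by (subst lin_ext_swap, rule arg_cong[where f = "\<lambda>F. lin_ext F _"], rule ext, rule lin_ext_swap)
  have "sweedler2 x (\<lambda>x1 x2. sweedler2 y (\<lambda>y1 y2. torus_form \<beta> x1 y1 * torus_form \<gamma> x2 y2))
    = lin_ext (\<lambda>g. lin_ext (\<lambda>h. \<beta> g h * \<gamma> g h) (torus_hom y)) (torus_hom x)"
    unfolding 1 2 unfolding sweedler2_def form_comult ..
  also have "\<dots> = counit x * counit y"
    by (simp add: assms counit_torus lin_ext_product)
  finally show ?thesis .
qed

end

lemma twist_cocycle_convolution_inverse:
  assumes "\<And>i j. s i j \<in> {1, -1}"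
  shows "sweedler2 x (\<lambda>x1 x2. sweedler2 y (\<lambda>y1 y2.
      twist_cocycle s x1 y1 * twist_cocycle_inv s x2 y2)) = counit x * counit y"
    and "sweedler2 x (\<lambda>x1 x2. sweedler2 y (\<lambda>y1 y2.
      twist_cocycle_inv s x1 y1 * twist_cocycle s x2 y2)) = counit x * counit y"
proof -
  have nz: "bicharacter_of s g h \<noteq> 0" for g h
    using bicharacter_of(1)[of s, OF assms] unfolding bicharacter_def by blast
  show "sweedler2 x (\<lambda>x1 x2. sweedler2 y (\<lambda>y1 y2.
      twist_cocycle s x1 y1 * twist_cocycle_inv s x2 y2)) = counit x * counit y"
    unfolding twist_cocycle_def twist_cocycle_inv_def
    by (rule torus_form_convolution_inverse) (rule right_inverse[OF nz])
  show "sweedler2 x (\<lambda>x1 x2. sweedler2 y (\<lambda>y1 y2.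
      twist_cocycle_inv s x1 y1 * twist_cocycle s x2 y2)) = counit x * counit y"
    unfolding twist_cocycle_def twist_cocycle_inv_def
    by (rule torus_form_convolution_inverse) (rule left_inverse[OF nz])
qed

text \<open>
  The algebra of the twisted quantum group has the same underlying coalgebra, so its elements are
  again of type \<open>'n polO\<close> and the canonical map from the untwisted to the twisted algebra is the identity.
\<close>

definition twisted_mult ::
    "('n::finite \<Rightarrow> 'n \<Rightarrow> complex) \<Rightarrow> 'n polO \<Rightarrow> 'n polO \<Rightarrow> 'n polO" where
  "twisted_mult s x y =
     sweedler3 x (\<lambda>x1 x2 x3. sweedler3 y (\<lambda>y1 y2 y3.
       (twist_cocycle s x1 y1 * twist_cocycle_inv s x3 y3) *\<^sub>C (x2 * y2)))"

definition twisted_star :: "('n::finite \<Rightarrow> 'n \<Rightarrow> complex) \<Rightarrow> 'n polO \<Rightarrow> 'n polO" where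
  "twisted_star s x =
     sweedler5 x (\<lambda>x1 x2 x3 x4 x5.
       (twist_cocycle s (polO_star (antipode x5)) (polO_star x4) *
        twist_cocycle_inv s (polO_star x2) (polO_star (antipode x1))) *\<^sub>C polO_star x3)"


section \<open>Compact matrix quantum groups and their representation categories\<close>

text \<open>
  A compact matrix quantum group is given by its Hopf *-algebra (with underlying vector space the type
  \<open>'a\<close>) and its fundamental representation.
\<close>

record (overloaded) ('a, 'n) quantum_group =
  qg_mult :: "'a::complex_vector \<Rightarrow> 'a \<Rightarrow> 'a"
  qg_unit :: 'a
  qg_star :: "'a \<Rightarrow> 'a"
  qg_comult :: "'a \<Rightarrow> ('a, 'a) tensor"
  qg_fund :: "'n \<Rightarrow> 'n \<Rightarrow> 'a"

definition twisted_O :: "('n::finite \<Rightarrow> 'n \<Rightarrow> complex) \<Rightarrow> ('n polO, 'n) quantum_group" where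
  "twisted_O s =
     \<lparr>qg_mult = twisted_mult s, qg_unit = 1, qg_star = twisted_star s,
      qg_comult = comult, qg_fund = polO_gen\<rparr>"

text \<open>The quantum group \<open>U\<^sup>* G U\<close>; as \<open>U\<close> is real, \<open>U\<^sup>*\<close> is the transpose.\<close>

definition qg_conj ::
    "real ^ 'n ^ 'n \<Rightarrow> ('a::complex_vector, 'n::finite) quantum_group \<Rightarrow> ('a, 'n) quantum_group" where
  "qg_conj U G = G\<lparr>qg_fund := \<lambda>i j. \<Sum>k\<in>UNIV. \<Sum>l\<in>UNIV.
     complex_of_real (transpose U $ i $ k * U $ l $ j) *\<^sub>C qg_fund G k l\<rparr>"

text \<open>
  The entry of \<open>v\<^sup>\<otimes>\<^sup>k\<close> at multi-indices \<open>is\<close>, \<open>js\<close> of length \<open>k\<close>, for \<open>v\<close> the fundamental representation.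
\<close>

definition qg_fund_power :: "('a::complex_vector, 'n) quantum_group \<Rightarrow> 'n list \<Rightarrow> 'n list \<Rightarrow> 'a" where
  "qg_fund_power G is js =
     foldr (\<lambda>(i, j) a. qg_mult G (qg_fund G i j) a) (zip is js) (qg_unit G)"

text \<open>
  Linear maps \<open>(\<complex>\<^sup>N)\<^sup>\<otimes>\<^sup>k \<rightarrow> (\<complex>\<^sup>N)\<^sup>\<otimes>\<^sup>l\<close> are matrices whose rows and columns are indexed by lists of length
  \<open>l\<close> and \<open>k\<close>, respectively; they are extended by zero to all lists.
\<close>

type_synonym 'n tensor_map = "'n list \<Rightarrow> 'n list \<Rightarrow> complex"

definition tensor_maps :: "nat \<Rightarrow> nat \<Rightarrow> 'n tensor_map set" where
  "tensor_maps k l = {T. \<forall>is js. T is js \<noteq> 0 \<longrightarrow> length is = l \<and> length js = k}"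

definition qg_Mor ::
    "('a::complex_vector, 'n::finite) quantum_group \<Rightarrow> nat \<Rightarrow> nat \<Rightarrow> 'n tensor_map set" where
  "qg_Mor G k l = {T \<in> tensor_maps k l. \<forall>is js. length is = l \<longrightarrow> length js = k \<longrightarrow>
     (\<Sum>ms | length ms = k. T is ms *\<^sub>C qg_fund_power G ms js) =
     (\<Sum>ms | length ms = l. T ms js *\<^sub>C qg_fund_power G is ms)}"


section \<open>Linear categories of partitions\<close>

text \<open>
  Points are numbered from zero: \<open>Inl i\<close> is the upper point \<open>i + 1\<close> and \<open>Inr j\<close> the
  lower point \<open>(j + 1)'\<close>.
\<close>

type_synonym partition = "(nat + nat) set set"

definition partitions :: "nat \<Rightarrow> nat \<Rightarrow> partition set" where
  "partitions k l = {p. partition_on ({..<k} <+> {..<l}) p}"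

definition part_tensor :: "nat \<Rightarrow> nat \<Rightarrow> partition \<Rightarrow> partition \<Rightarrow> partition" where
  "part_tensor k l p q = p \<union> (`) (map_sum (\<lambda>i. k + i) (\<lambda>j. l + j)) ` q"

definition part_invol :: "partition \<Rightarrow> partition" where
  "part_invol p = (`) (case_sum Inr Inl) ` p"

text \<open>
  For the composition \<open>qp\<close>, the point set consists of the upper points \<open>Inl i\<close> of \<open>p\<close>, the middle points
  \<open>Inr (Inl j)\<close> and the lower points \<open>Inr (Inr m)\<close> of \<open>q\<close>.
\<close>

definition part_stack :: "partition \<Rightarrow> partition \<Rightarrow> (nat + nat + nat) set set" where
  "part_stack q p = (`) (map_sum id Inl) ` p \<union> (`) Inr ` q"

definition components :: "'a set set \<Rightarrow> 'a set set" where
  "components B = \<Union>B // (\<Union>b\<in>B. b \<times> b)\<^sup>+"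

definition outer_points :: "(nat + nat + nat) set \<Rightarrow> (nat + nat) set" where
  "outer_points C = map_sum id Inr -` C"

definition part_comp :: "partition \<Rightarrow> partition \<Rightarrow> partition" where
  "part_comp q p = outer_points ` components (part_stack q p) - {{}}"

definition part_loops :: "partition \<Rightarrow> partition \<Rightarrow> nat" where
  "part_loops q p = card {C \<in> components (part_stack q p). outer_points C = {}}"

type_synonym lin_partition = "partition \<Rightarrow>\<^sub>0 complex"

definition Part :: "nat \<Rightarrow> nat \<Rightarrow> lin_partition set" where
  "Part k l = {f. Poly_Mapping.keys f \<subseteq> partitions k l}"

definition lin_tensor :: "nat \<Rightarrow> nat \<Rightarrow> lin_partition \<Rightarrow> lin_partition \<Rightarrow> lin_partition" where
  "lin_tensor k l f g =
     lin_ext (\<lambda>p. lin_ext (\<lambda>q. Poly_Mapping.single (part_tensor k l p q) 1) g) f"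

definition lin_comp :: "complex \<Rightarrow> lin_partition \<Rightarrow> lin_partition \<Rightarrow> lin_partition" where
  "lin_comp \<delta> g f =
     lin_ext (\<lambda>q. lin_ext (\<lambda>p. Poly_Mapping.single (part_comp q p) (\<delta> ^ part_loops q p)) f) g"

definition lin_invol :: "lin_partition \<Rightarrow> lin_partition" where
  "lin_invol f =
     (\<Sum>p\<in>Poly_Mapping.keys f. Poly_Mapping.single (part_invol p) (cnj (Poly_Mapping.lookup f p)))"

definition linear_category :: "complex \<Rightarrow> (nat \<Rightarrow> nat \<Rightarrow> lin_partition set) \<Rightarrow> bool" where
  "linear_category \<delta> K \<longleftrightarrow>
     (\<forall>k l. K k l \<subseteq> Part k l \<and> complex_vector.subspace (K k l)) \<and>
     (\<forall>k l k' l'. \<forall>f\<in>K k l. \<forall>g\<in>K k' l'. lin_tensor k l f g \<in> K (k + k') (l + l')) \<and>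
     (\<forall>k l m. \<forall>f\<in>K k l. \<forall>g\<in>K l m. lin_comp \<delta> g f \<in> K k m) \<and>
     (\<forall>k l. \<forall>f\<in>K k l. lin_invol f \<in> K l k) \<and>
     Poly_Mapping.single {{Inl 0, Inr 0}} 1 \<in> K 1 1 \<and>
     Poly_Mapping.single {{Inr 0, Inr 1}} 1 \<in> K 0 2"

text \<open>A generator is a triple \<open>(k, l, f)\<close> with \<open>f \<in> Part k l\<close>.\<close>

definition generated_category ::
    "complex \<Rightarrow> (nat \<times> nat \<times> lin_partition) set \<Rightarrow> nat \<Rightarrow> nat \<Rightarrow> lin_partition set" where
  "generated_category \<delta> X k l =
     \<Inter> {K k l | K. linear_category \<delta> K \<and> (\<forall>(k', l', f)\<in>X. f \<in> K k' l')}"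

definition easy_category :: "(nat \<Rightarrow> nat \<Rightarrow> lin_partition set) \<Rightarrow> bool" where
  "easy_category K \<longleftrightarrow> (\<forall>k l. \<exists>P \<subseteq> partitions k l.
     K k l = complex_vector.span ((\<lambda>p. Poly_Mapping.single p 1) ` P))"

lemma part_tensor_partitions:
  assumes "p \<in> partitions k l" "q \<in> partitions k' l'"
  shows "part_tensor k l p q \<in> partitions (k + k') (l + l')"
proof -
  let ?f = "map_sum (\<lambda>i. k + i) (\<lambda>j. l + j)"
  have inj: "inj ?f" by (rule sum.inj_map) (auto simp: inj_def)
  have im: "?f ` ({..<k'} <+> {..<l'}) = {k..<k + k'} <+> {l..<l + l'}"
  proof -
    have "?f ` ({..<k'} <+> {..<l'}) = (\<lambda>i. k + i) ` {..<k'} <+> (\<lambda>i. l + i) ` {..<l'}"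
      by (simp add: Plus_def image_Un image_image)
    also have "\<dots> = {k..<k + k'} <+> {l..<l + l'}"
      by (simp add: lessThan_atLeast0 add.commute)
    finally show ?thesis .
  qed
  have "{} \<notin> (`) ?f ` q" using assms(2) by (auto simp: partitions_def dest: partition_onD3)
  moreover have "partition_on (?f ` ({..<k'} <+> {..<l'})) ((`) ?f ` q - {{}})"
    using assms(2) by (intro partition_on_inj_image) (auto simp: partitions_def intro: inj_on_subset[OF inj])
  ultimately have q: "partition_on ({k..<k + k'} <+> {l..<l + l'}) ((`) ?f ` q)"
    by (simp add: im)
  have p: "partition_on ({..<k} <+> {..<l}) p" using assms(1) by (simp add: partitions_def)
  have "({..<k} <+> {..<l}) \<union> ({k..<k + k'} <+> {l..<l + l'}) = {..<k + k'} <+> {..<l + l'}"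
    by (auto simp: Plus_def image_iff)
  moreover have "({..<k} <+> {..<l}) \<inter> ({k..<k + k'} <+> {l..<l + l'}) = {}"
    by (auto simp: Plus_def)
  moreover have "disjoint (p \<union> (`) ?f ` q)"
    using calculation(2) partition_onD1[OF p] partition_onD1[OF q]
    by (intro disjoint_union partition_onD2[OF p] partition_onD2[OF q]) simp
  ultimately show ?thesis
    using partition_onD1[OF p] partition_onD1[OF q] partition_onD3[OF p] partition_onD3[OF q]
    by (simp add: part_tensor_def partitions_def partition_on_def)
qed

lemma part_invol_partitions:
  assumes "p \<in> partitions k l"
  shows "part_invol p \<in> partitions l k"
proof -
  let ?f = "case_sum Inr Inl :: nat + nat \<Rightarrow> nat + nat"
  have inj: "inj ?f" by (rule inj_on_inverseI[where g = ?f], rename_tac x, case_tac x) simp_all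
  have "?f ` ({..<k} <+> {..<l}) = {..<l} <+> {..<k}"
    by (auto simp: Plus_def image_Un image_image)
  moreover have "{} \<notin> (`) ?f ` p" using assms by (auto simp: partitions_def dest: partition_onD3)
  moreover have "partition_on (?f ` ({..<k} <+> {..<l})) ((`) ?f ` p - {{}})"
    using assms by (intro partition_on_inj_image) (auto simp: partitions_def intro: inj_on_subset[OF inj])
  ultimately show ?thesis by (simp add: part_invol_def partitions_def)
qed

lemma partition_on_components: "partition_on (\<Union>B) (components B)"
proof -
  let ?r = "\<Union>b\<in>B. b \<times> b"
  have "equiv (\<Union>B) (?r\<^sup>+)"
  proof (rule equivI)
    show "?r\<^sup>+ \<subseteq> \<Union>B \<times> \<Union>B" by (rule trancl_subset_Sigma) auto
    show "refl_on (\<Union>B) (?r\<^sup>+)" by (rule refl_onI) auto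
    show "sym (?r\<^sup>+)" by (rule sym_trancl) (auto simp: sym_def)
    show "trans (?r\<^sup>+)" by (rule trans_trancl)
  qed
  then show ?thesis unfolding components_def by (rule partition_on_quotient)
qed

lemma part_comp_partitions:
  assumes "p \<in> partitions k l" "q \<in> partitions l m"
  shows "part_comp q p \<in> partitions k m"
proof -
  have "\<Union>p = {..<k} <+> {..<l}" "\<Union>q = {..<l} <+> {..<m}"
    using assms by (auto simp: partitions_def partition_on_def)
  then have "\<Union>(part_stack q p) = map_sum id Inl ` ({..<k} <+> {..<l}) \<union> Inr ` ({..<l} <+> {..<m})"
    by (simp add: part_stack_def flip: image_Union)
  then have "map_sum id Inr -` \<Union>(part_stack q p) = {..<k} <+> {..<m}"
    by (force simp: Plus_def map_sum_def split: sum.splits)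
  moreover have "(-`) (map_sum id Inr) = outer_points" by (simp add: fun_eq_iff outer_points_def)
  ultimately show ?thesis
    using partition_on_vimage[OF partition_on_components, of "map_sum id Inr" "part_stack q p"]
    by (simp add: partitions_def part_comp_def)
qed

lemma subspace_Part: "complex_vector.subspace (Part k l)"
proof (rule complex_vector.subspaceI)
  show "f + g \<in> Part k l" if "f \<in> Part k l" "g \<in> Part k l" for f g
    using that keys_add[of f g] by (auto simp: Part_def)
  show "c *\<^sub>C f \<in> Part k l" if "f \<in> Part k l" for c f
    using that by (auto simp: Part_def in_keys_iff)
qed (simp add: Part_def)

lemma lin_ext_subspace:
  assumes "complex_vector.subspace V" "\<And>x. x \<in> Poly_Mapping.keys f \<Longrightarrow> h x \<in> V"
  shows "lin_ext h f \<in> V"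
  unfolding lin_ext_def using assms
  by (intro complex_vector.subspace_sum complex_vector.subspace_scale) auto

lemma single_Part: "p \<in> partitions k l \<Longrightarrow> Poly_Mapping.single p c \<in> Part k l"
  by (auto simp: Part_def)

lemma linear_category_Part: "linear_category \<delta> Part"
  unfolding linear_category_def
proof (intro conjI allI ballI)
  show "Part k l \<subseteq> Part k l" "complex_vector.subspace (Part k l)" for k l
    by (simp_all add: subspace_Part)
  show "lin_tensor k l f g \<in> Part (k + k') (l + l')" if "f \<in> Part k l" "g \<in> Part k' l'" for k l k' l' f g
    unfolding lin_tensor_def
    by (intro lin_ext_subspace subspace_Part single_Part part_tensor_partitions)
      (use that in \<open>auto simp: Part_def\<close>)
  show "lin_comp \<delta> g f \<in> Part k m" if "f \<in> Part k l" "g \<in> Part l m" for k l m f g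
    unfolding lin_comp_def
    by (intro lin_ext_subspace subspace_Part single_Part part_comp_partitions)
      (use that in \<open>auto simp: Part_def\<close>)
  show "lin_invol f \<in> Part l k" if "f \<in> Part k l" for k l f
    unfolding lin_invol_def
    by (intro complex_vector.subspace_sum subspace_Part single_Part part_invol_partitions)
      (use that in \<open>auto simp: Part_def\<close>)
  show "Poly_Mapping.single {{Inl 0, Inr 0}} 1 \<in> Part 1 1"
    by (rule single_Part) (auto simp: partitions_def partition_on_def)
  show "Poly_Mapping.single {{Inr 0, Inr 1}} 1 \<in> Part 0 2"
    by (rule single_Part) (auto simp: partitions_def partition_on_def)
qed

lemma linear_category_generated:
  assumes "\<And>k l f. (k, l, f) \<in> X \<Longrightarrow> f \<in> Part k l"
  shows "linear_category \<delta> (generated_category \<delta> X)"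
    and "(k, l, f) \<in> X \<Longrightarrow> f \<in> generated_category \<delta> X k l"
proof -
  have P: "\<forall>(k', l', f)\<in>X. f \<in> Part k' l'" using assms by auto
  have mem: "f \<in> generated_category \<delta> X k l \<longleftrightarrow>
      (\<forall>K. linear_category \<delta> K \<and> (\<forall>(k', l', f)\<in>X. f \<in> K k' l') \<longrightarrow> f \<in> K k l)" for f k l
    by (auto simp: generated_category_def)
  show "linear_category \<delta> (generated_category \<delta> X)"
    unfolding linear_category_def
  proof (intro conjI allI ballI)
    show "generated_category \<delta> X k l \<subseteq> Part k l" for k l
      using linear_category_Part P by (auto simp: mem)
    show "complex_vector.subspace (generated_category \<delta> X k l)" for k l
      unfolding generated_category_def
      by (rule complex_vector.subspace_Inter) (auto simp: linear_category_def)
    have closed: "f \<in> K k l \<Longrightarrow> g \<in> K k' l' \<Longrightarrow> lin_tensor k l f g \<in> K (k + k') (l + l')"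
      "f \<in> K k l \<Longrightarrow> g \<in> K l m \<Longrightarrow> lin_comp \<delta> g f \<in> K k m"
      "f \<in> K k l \<Longrightarrow> lin_invol f \<in> K l k"
      "Poly_Mapping.single {{Inl 0, Inr 0}} 1 \<in> K 1 1" "Poly_Mapping.single {{Inr 0, Inr 1}} 1 \<in> K 0 2"
      if "linear_category \<delta> K" for K f g k l k' l' m
      using that unfolding linear_category_def by blast+
    fix k l k' l' m f g
    assume f: "f \<in> generated_category \<delta> X k l"
    show "lin_invol f \<in> generated_category \<delta> X l k"
      using f closed(3) unfolding mem by blast
    show "lin_tensor k l f g \<in> generated_category \<delta> X (k + k') (l + l')"
      if "g \<in> generated_category \<delta> X k' l'"
      using f that closed(1) unfolding mem by blast
    show "lin_comp \<delta> g f \<in> generated_category \<delta> X k m"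
      if "g \<in> generated_category \<delta> X l m"
      using f that closed(2) unfolding mem by blast
  next
    show "Poly_Mapping.single {{Inl 0, Inr 0}} 1 \<in> generated_category \<delta> X 1 1"
      "Poly_Mapping.single {{Inr 0, Inr 1}} 1 \<in> generated_category \<delta> X 0 2"
      unfolding mem linear_category_def by blast+
  qed
  show "(k, l, f) \<in> X \<Longrightarrow> f \<in> generated_category \<delta> X k l"
    by (auto simp: mem)
qed

text \<open>
  The matrix \<open>T\<^sub>p\<close>: the upper points carry the column indices \<open>js\<close> and the lower points the row
  indices \<open>is\<close>.
\<close>

definition part_map :: "nat \<Rightarrow> nat \<Rightarrow> partition \<Rightarrow> 'n tensor_map" where
  "part_map k l p is js =
     (if length is = l \<and> length js = k \<and>
         (\<forall>b\<in>p. \<forall>x\<in>b. \<forall>y\<in>b. case_sum ((!) js) ((!) is) x = case_sum ((!) js) ((!) is) y)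
      then 1 else 0)"

definition lin_part_map :: "nat \<Rightarrow> nat \<Rightarrow> lin_partition \<Rightarrow> 'n tensor_map" where
  "lin_part_map k l f is js =
     (\<Sum>p\<in>Poly_Mapping.keys f. Poly_Mapping.lookup f p * part_map k l p is js)"


section \<open>The data of the theorem\<close>

text \<open>
  The index set \<open>{1, \<dots>, N}\<close> is a finite linearly ordered type \<open>'n\<close> with \<open>N = CARD('n)\<close>; the
  index \<open>N\<close> is its maximum.
\<close>

abbreviation last_index :: "'n::{finite, linorder}" where
  "last_index \<equiv> Max UNIV"

definition sigma_sign :: "'n::{finite, linorder} \<Rightarrow> complex" where
  "sigma_sign i = (if i = last_index then -1 else 1)"

definition sigma_matrix :: "'n::{finite, linorder} \<Rightarrow> 'n \<Rightarrow> complex" where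
  "sigma_matrix i j = (if i < j then sigma_sign i * sigma_sign j else 1)"

text \<open>The matrix \<open>U\<^bsub>(N,\<plusminus>)\<^esub>\<close>, with \<open>\<epsilon>\<close> the sign.\<close>

definition U_matrix :: "real \<Rightarrow> real ^ ('n::{finite, linorder}) ^ ('n::{finite, linorder})" where
  "U_matrix \<epsilon> = (\<chi> i j.
     let N = real CARD('n) in
     if i = last_index then 1 / sqrt N
     else if j = last_index then \<epsilon> / sqrt N
     else (if i = j then 1 else 0) - 1 / (N - 1) * (1 + \<epsilon> / sqrt N))"

definition p_cross :: partition where "p_cross = {{Inl 0, Inr 1}, {Inl 1, Inr 0}}"

definition p_r1 :: partition where "p_r1 = {{Inl 0, Inr 1}, {Inl 1}, {Inr 0}}"

definition p_r2 :: partition where "p_r2 = {{Inl 1, Inr 0}, {Inl 0}, {Inr 1}}"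

definition p_s :: partition where "p_s = {{Inl 0}, {Inl 1}, {Inr 0}, {Inr 1}}"

definition twisted_cross :: "complex \<Rightarrow> lin_partition" where
  "twisted_cross N =
     Poly_Mapping.single p_cross 1
     - (2 / N) *\<^sub>C (Poly_Mapping.single p_r1 1 + Poly_Mapping.single p_r2 1)
     + (4 / N\<^sup>2) *\<^sub>C Poly_Mapping.single p_s 1"

end

theory Submission
  imports Defs
begin

text \<open>
  Let \<open>u\<close> be the fundamental representation of the classical group.  Every product of generators of
  the twisted algebra is a sign times the classical product, so \<open>v\<^sup>\<otimes>\<^sup>k = W\<^sup>t u\<^sup>\<otimes>\<^sup>k W\<close>
  with \<open>W = D U\<^sup>\<otimes>\<^sup>k\<close> for a diagonal sign matrix \<open>D\<close>, and \<open>T \<mapsto> W T W\<^sup>t\<close> identifies the intertwiners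
  of \<open>v\<close> with those of \<open>u\<close>.  The generator is the flip composed with \<open>\<tau> \<otimes> \<tau>\<close>, where \<open>\<tau>\<close> is the reflection
  along the all-one vector; \<open>U\<close> maps that vector to a multiple of the last basis vector, which turns
  \<open>\<tau>\<close> into the diagonal matrix of the \<open>\<sigma>\<^sub>i\<close>, and the signs in \<open>D\<close> cancel this diagonal matrix: the generator becomes
  the plain flip, an intertwiner of \<open>u\<close>.  Conversely, the relations of \<open>Pol O\<^sub>N\<close> are exactly
  commutativity (the flip) and orthogonality (the pair partition), so by Tannaka--Krein duality, which here is the
  finite-dimensional double commutant theorem, nothing else intertwines \<open>u\<close>.  If the category were easy
  it would contain the four-singleton partition, which corresponds to the matrix unit at the last
  basis vector; this would force \<open>u\<^sub>N\<^sub>N u\<^sub>N\<^sub>j = 0\<close>, which fails at the point \<open>U\<close> of the orthogonal group.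
\<close>

section \<open>Matrices indexed by words\<close>

text \<open>Since \<open>W\<close> is real and orthogonal, conjugation by it respects composition,
  identities and adjoints, but it is not a tensor functor: on concatenated words \<open>W\<close> is
  the tensor product of its two parts only up to the bicharacter of the two words. These signs
  cancel once the maps involved are known to become intertwiners of the classical group, because
  such intertwiners respect the diagonal sign matrices. This fixes the order of the argument. The
  preimage \<open>M\<close> of the classical intertwiners is shown to be a linear category, hence it
  contains \<open>K\<close>; only then can the conjugated image \<open>C\<close> of \<open>K\<close>
  be seen to be closed under tensor products, so that duality applies to \<open>C\<close>, where the
  generator is the plain flip. Injectivity of the conjugation carries the result back to
  \<open>K\<close>.\<close>

lemma finite_words [simp]: "finite {ms :: 'n::finite list. length ms = k}"
  using finite_lists_length_eq[of "UNIV :: 'n set" k] by simp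

lemma sum_words_0: "(\<Sum>ms | length ms = 0. f ms) = f []"
proof -
  have "{ms :: 'a list. length ms = 0} = {[]}" by auto
  then show ?thesis by simp
qed

lemma sum_words_append:
  fixes f :: "'n::finite list \<Rightarrow> 'b::comm_monoid_add"
  shows "(\<Sum>ms | length ms = k + l. f ms) = (\<Sum>a | length a = k. \<Sum>b | length b = l. f (a @ b))"
proof -
  have "(\<Sum>ms | length ms = k + l. f ms) =
      (\<Sum>(a, b)\<in>{a. length a = k} \<times> {b. length b = l}. f (a @ b))"
    by (rule sum.reindex_bij_witness[where i = "\<lambda>(a, b). a @ b" and j = "\<lambda>ms. (take k ms, drop k ms)"])
      auto
  then show ?thesis by (simp add: sum.cartesian_product)
qed

lemma sum_words_Suc:
  fixes f :: "'n::finite list \<Rightarrow> 'b::comm_monoid_add"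
  shows "(\<Sum>ms | length ms = Suc k. f ms) = (\<Sum>i\<in>UNIV. \<Sum>ms | length ms = k. f (i # ms))"
proof -
  have "(\<Sum>ms | length ms = Suc k. f ms) = (\<Sum>(i, ms)\<in>UNIV \<times> {ms. length ms = k}. f (i # ms))"
    by (rule sum.reindex_bij_witness[where i = "\<lambda>(i, ms). i # ms" and j = "\<lambda>ms. (hd ms, tl ms)"])
      (auto simp: length_Suc_conv)
  then show ?thesis by (simp add: sum.cartesian_product)
qed

text \<open>The entries of \<open>X\<close> lie in any complex vector space, so the same operation
  composes scalar matrices and lets them act on matrices over \<open>'n polO\<close>. The length
  \<open>k\<close> is explicit because a matrix indexed by all lists does not determine it.\<close>

definition lmult ::
    "nat \<Rightarrow> 'n::finite tensor_map \<Rightarrow> ('n list \<Rightarrow> 'n list \<Rightarrow> 'b::complex_vector) \<Rightarrow> 'n list \<Rightarrow> 'n list \<Rightarrow> 'b" where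
  "lmult k S X is js = (\<Sum>ms | length ms = k. S is ms *\<^sub>C X ms js)"

definition rmult ::
    "nat \<Rightarrow> ('n list \<Rightarrow> 'n list \<Rightarrow> 'b::complex_vector) \<Rightarrow> 'n::finite tensor_map \<Rightarrow> 'n list \<Rightarrow> 'n list \<Rightarrow> 'b" where
  "rmult k X S is js = (\<Sum>ms | length ms = k. S ms js *\<^sub>C X is ms)"

lemma lmult_lmult: "lmult k S (lmult l T X) = lmult l (lmult k S T) X"
  unfolding fun_eq_iff lmult_def complex_vector.scale_sum_right complex_vector.scale_sum_left scaleC_scaleC
    scaleC_complex_def
  by (intro allI, rule sum.swap)

lemma rmult_rmult: "rmult l (rmult k X S) T = rmult k X (lmult l S T)"
  unfolding fun_eq_iff lmult_def rmult_def complex_vector.scale_sum_right complex_vector.scale_sum_left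
    scaleC_scaleC scaleC_complex_def
  by (intro allI, subst sum.swap, intro sum.cong refl) (simp only: mult.commute)

lemma lmult_rmult: "lmult k S (rmult l X T) = rmult l (lmult k S X) T"
  unfolding fun_eq_iff lmult_def rmult_def complex_vector.scale_sum_right scaleC_scaleC
  by (intro allI, subst sum.swap, intro sum.cong refl) (simp only: mult.commute)

lemma rmult_complex: "rmult k S T = lmult k S T"
  by (simp add: rmult_def lmult_def fun_eq_iff mult.commute)

definition word_id :: "nat \<Rightarrow> 'n tensor_map" where
  "word_id k is js = (if length is = k \<and> is = js then 1 else 0)"

definition adj :: "'n tensor_map \<Rightarrow> 'n tensor_map" where
  "adj T is js = cnj (T js is)"

lemma tensor_maps_lmult:
  assumes "S \<in> tensor_maps l m" "T \<in> tensor_maps k l"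
  shows "lmult l S T \<in> tensor_maps k m"
proof -
  have "length is = m \<and> length js = k" if "lmult l S T is js \<noteq> 0" for "is" js
  proof -
    have "\<exists>ms. S is ms * T ms js \<noteq> 0"
      using that unfolding lmult_def by (metis (mono_tags, lifting) scaleC_complex_def sum.neutral)
    then show ?thesis using assms by (auto simp: tensor_maps_def)
  qed
  then show ?thesis by (simp add: tensor_maps_def)
qed

lemma tensor_maps_adj: "T \<in> tensor_maps k l \<Longrightarrow> adj T \<in> tensor_maps l k"
  by (auto simp: tensor_maps_def adj_def)

lemma tensor_maps_word_id: "word_id k \<in> tensor_maps k k"
  by (auto simp: tensor_maps_def word_id_def split: if_splits)

lemma lmult_word_id:
  assumes "\<And>is js. X is js \<noteq> 0 \<Longrightarrow> length is = k"
  shows "lmult k (word_id k) X = X"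
proof (intro ext)
  fix "is" js
  have "lmult k (word_id k) X is js = (\<Sum>ms | length ms = k. if ms = is then X is js else 0)"
    unfolding lmult_def by (intro sum.cong) (auto simp: word_id_def scaleC_one)
  also have "\<dots> = X is js" using assms[of "is" js] by auto
  finally show "lmult k (word_id k) X is js = X is js" .
qed

lemma rmult_word_id:
  assumes "\<And>is js. X is js \<noteq> 0 \<Longrightarrow> length js = k"
  shows "rmult k X (word_id k) = X"
proof (intro ext)
  fix "is" js
  have "rmult k X (word_id k) is js = (\<Sum>ms | length ms = k. if ms = js then X is js else 0)"
    unfolding rmult_def by (intro sum.cong) (auto simp: word_id_def scaleC_one)
  also have "\<dots> = X is js" using assms[of "is" js] by auto
  finally show "rmult k X (word_id k) is js = X is js" .
qed

lemma adj_lmult: "adj (lmult l S T) = lmult l (adj T) (adj S)"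
  by (simp add: adj_def lmult_def fun_eq_iff mult.commute)

definition tens :: "nat \<Rightarrow> nat \<Rightarrow> 'n tensor_map \<Rightarrow> 'n tensor_map \<Rightarrow> 'n tensor_map" where
  "tens k l T S is js = T (take l is) (take k js) * S (drop l is) (drop k js)"

lemma tensor_maps_tens:
  assumes "T \<in> tensor_maps k l" "S \<in> tensor_maps k' l'"
  shows "tens k l T S \<in> tensor_maps (k + k') (l + l')"
proof -
  have "length is = l + l' \<and> length js = k + k'" if "tens k l T S is js \<noteq> 0" for "is" js
  proof -
    have "T (take l is) (take k js) \<noteq> 0" "S (drop l is) (drop k js) \<noteq> 0"
      using that by (auto simp: tens_def)
    then have "length (take l is) = l" "length (take k js) = k"
      "length (drop l is) = l'" "length (drop k js) = k'"
      using assms unfolding tensor_maps_def by blast+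
    then show ?thesis by (metis append_take_drop_id length_append)
  qed
  then show ?thesis by (simp add: tensor_maps_def)
qed

lemma tens_append:
  "length is = l \<Longrightarrow> length js = k \<Longrightarrow> tens k l T S (is @ is') (js @ js') = T is js * S is' js'"
  by (simp add: tens_def)

lemma tensor_maps_eqI:
  assumes "S \<in> tensor_maps k l" "T \<in> tensor_maps k l"
    "\<And>is js. length is = l \<Longrightarrow> length js = k \<Longrightarrow> S is js = T is js"
  shows "S = T"
proof (intro ext)
  fix "is" js
  show "S is js = T is js"
  proof (cases "length is = l \<and> length js = k")
    case False
    then have "S is js = 0" "T is js = 0"
      using assms(1,2) by (auto simp: tensor_maps_def)
    then show ?thesis by simp
  qed (use assms(3) in blast)
qed

lemma tensor_maps_add_eqI:
  assumes "S \<in> tensor_maps (k + k') (l + l')" "T \<in> tensor_maps (k + k') (l + l')"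
    "\<And>is js is' js'. length is = l \<Longrightarrow> length js = k \<Longrightarrow> length is' = l' \<Longrightarrow> length js' = k' \<Longrightarrow>
      S (is @ is') (js @ js') = T (is @ is') (js @ js')"
  shows "S = T"
proof (rule tensor_maps_eqI[OF assms(1,2)])
  fix "is" js :: "'a list"
  assume "length is = l + l'" "length js = k + k'"
  then show "S is js = T is js"
    using assms(3)[of "take l is" "take k js" "drop l is" "drop k js"] by simp
qed

subsection \<open>Tensor powers of a matrix\<close>

text \<open>The value 0 at words of different lengths makes this one matrix over all words, the
  direct sum of all tensor powers of \<open>h\<close>.\<close>

fun wprod :: "('n \<Rightarrow> 'n \<Rightarrow> 'b::comm_semiring_1) \<Rightarrow> 'n list \<Rightarrow> 'n list \<Rightarrow> 'b" where
  "wprod h [] [] = 1"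
| "wprod h (i # is) (j # js) = h i j * wprod h is js"
| "wprod h _ _ = 0"

lemma wprod_length: "wprod h is js \<noteq> 0 \<Longrightarrow> length is = length js"
  by (induction h "is" js rule: wprod.induct) (auto dest: mult_not_zero)

lemma wprod_append:
  "length is = length js \<Longrightarrow> wprod h (is @ is') (js @ js') = wprod h is js * wprod h is' js'"
  by (induction "is" js rule: list_induct2) (auto simp: mult.assoc)

lemma wprod_orthogonal:
  fixes h :: "'n::finite \<Rightarrow> 'n \<Rightarrow> 'b::comm_ring_1"
  assumes "orthogonal_entries h" "length is = length js"
  shows "(\<Sum>ms | length ms = length is. wprod h is ms * wprod h js ms) = (if is = js then 1 else 0)"
    and "(\<Sum>ms | length ms = length is. wprod h ms is * wprod h ms js) = (if is = js then 1 else 0)"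
proof -
  note o = assms(1)[unfolded orthogonal_entries_def]
  have fac: "(\<Sum>i\<in>UNIV. \<Sum>ms | length ms = k. (f i * g ms) * (f' i * g' ms)) =
     (\<Sum>i\<in>UNIV. f i * f' i) * (\<Sum>ms | length ms = k. g ms * g' ms)"
    for f f' :: "'n \<Rightarrow> 'b" and g g' and k
    unfolding sum_product by (intro sum.cong refl) (simp only: mult_ac)
  show "(\<Sum>ms | length ms = length is. wprod h is ms * wprod h js ms) = (if is = js then 1 else 0)"
    using assms(2)
  proof (induction "is" js rule: list_induct2)
    case (Cons i "is" j js)
    then show ?case
      unfolding length_Cons sum_words_Suc wprod.simps fac by (simp add: o)
  qed simp
  show "(\<Sum>ms | length ms = length is. wprod h ms is * wprod h ms js) = (if is = js then 1 else 0)"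
    using assms(2)
  proof (induction "is" js rule: list_induct2)
    case (Cons i "is" j js)
    then show ?case
      unfolding length_Cons sum_words_Suc wprod.simps fac by (simp add: o)
  qed simp
qed

section \<open>The functor from partitions to matrices\<close>

definition block_const :: "('a \<Rightarrow> 'b) \<Rightarrow> 'a set set \<Rightarrow> bool" where
  "block_const F B \<longleftrightarrow> (\<forall>b\<in>B. \<forall>x\<in>b. \<forall>y\<in>b. F x = F y)"

lemma part_map_block_const:
  "part_map k l p is js =
     (if length is = l \<and> length js = k \<and> block_const (case_sum ((!) js) ((!) is)) p then 1 else 0)"
  by (simp add: part_map_def block_const_def)

lemma block_const_Un: "block_const F (A \<union> B) \<longleftrightarrow> block_const F A \<and> block_const F B"
  by (auto simp: block_const_def)

lemma block_const_image: "block_const F ((`) f ` A) \<longleftrightarrow> block_const (F \<circ> f) A"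
  by (auto simp: block_const_def)

lemma block_const_cong: "(\<And>x. x \<in> \<Union>A \<Longrightarrow> F x = G x) \<Longrightarrow> block_const F A \<longleftrightarrow> block_const G A"
  unfolding block_const_def by (metis UnionI)

text \<open>A labelling that is constant on blocks is constant along chains of overlapping blocks.
  Hence the stacked diagram may be replaced by its components, which is what turns a matrix product
  into a count of labellings.\<close>

lemma block_const_components: "block_const F (components B) \<longleftrightarrow> block_const F B"
proof
  let ?r = "\<Union>b\<in>B. b \<times> b"
  assume F: "block_const F B"
  have *: "F x = F y" if "(x, y) \<in> ?r\<^sup>+" for x y
    using that
  proof (induction rule: trancl_induct)
    case (base y)
    then show ?case using F unfolding block_const_def by blast
  next
    case (step y z)
    then have "F y = F z" using F unfolding block_const_def by blast
    with step show ?case by simp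
  qed
  show "block_const F (components B)"
    unfolding block_const_def
  proof (intro ballI)
    fix c x y
    assume "c \<in> components B" and xy: "x \<in> c" "y \<in> c"
    then obtain z where "c = ?r\<^sup>+ `` {z}"
      unfolding components_def by (elim quotientE)
    then show "F x = F y" using xy *[of z x] *[of z y] by auto
  qed
next
  let ?r = "\<Union>b\<in>B. b \<times> b"
  assume F: "block_const F (components B)"
  have "F x = F y" if "b \<in> B" "x \<in> b" "y \<in> b" for b x y
  proof -
    have "(x, x) \<in> ?r" "(x, y) \<in> ?r" using that by blast+
    then have "x \<in> ?r\<^sup>+ `` {x}" "y \<in> ?r\<^sup>+ `` {x}" unfolding Image_singleton_iff by (blast intro: r_into_trancl)+
    moreover have "x \<in> \<Union>B" using that by blast
    then have "?r\<^sup>+ `` {x} \<in> components B"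
      unfolding components_def by (rule quotientI)
    ultimately show ?thesis using F unfolding block_const_def by blast
  qed
  then show "block_const F B" unfolding block_const_def by blast
qed

section \<open>Tensor product, involution and composition of partitions as matrix operations\<close>

lemma partitions_Union: "p \<in> partitions k l \<Longrightarrow> \<Union>p = {..<k} <+> {..<l}"
  unfolding partitions_def by (blast dest: partition_onD1[symmetric])

lemma tensor_maps_part_map: "part_map k l p \<in> tensor_maps k l"
  by (simp add: tensor_maps_def part_map_block_const)

lemma part_map_tensor:
  assumes "p \<in> partitions k l" "q \<in> partitions k' l'"
  shows "part_map (k + k') (l + l') (part_tensor k l p q) =
    tens k l (part_map k l p) (part_map k' l' q)"
proof (rule tensor_maps_add_eqI)
  fix "is" js is' js' :: "'a list"
  assume len: "length is = l" "length js = k" "length is' = l'" "length js' = k'"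
  let ?F = "case_sum ((!) (js @ js')) ((!) (is @ is'))"
  have "block_const ?F p \<longleftrightarrow> block_const (case_sum ((!) js) ((!) is)) p"
    by (rule block_const_cong) (auto simp: partitions_Union[OF assms(1)] nth_append len)
  moreover have "block_const (?F \<circ> map_sum ((+) k) ((+) l)) q \<longleftrightarrow>
      block_const (case_sum ((!) js') ((!) is')) q"
    by (rule block_const_cong) (auto simp: partitions_Union[OF assms(2)] nth_append len)
  ultimately show "part_map (k + k') (l + l') (part_tensor k l p q) (is @ is') (js @ js') =
      tens k l (part_map k l p) (part_map k' l' q) (is @ is') (js @ js')"
    by (simp add: part_map_block_const part_tensor_def block_const_Un block_const_image len tens_append)
qed (intro tensor_maps_part_map tensor_maps_tens)+

lemma part_map_invol: "part_map l k (part_invol p) is js = part_map k l p js is"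
proof -
  have "case_sum ((!) js) ((!) is) \<circ> case_sum Inr Inl = case_sum ((!) is) ((!) js)"
    by (simp add: fun_eq_iff split: sum.split)
  then show ?thesis
    by (auto simp: part_map_block_const part_invol_def block_const_image)
qed

text \<open>A compatible labelling amounts to one value per component. A component that meets the
  outer rows has its value forced by \<open>js\<close> and \<open>is\<close>; a component of middle
  points only has a free value, whence one factor \<open>CARD('n)\<close> per loop.\<close>

lemma card_labellings:
  fixes js "is" :: "'n::finite list"
  assumes p: "p \<in> partitions k l" and q: "q \<in> partitions l m"
    and bc: "block_const (case_sum ((!) js) ((!) is)) (part_comp q p)"
  shows "card {ms. length ms = l \<and>
      block_const (case_sum ((!) js) (case_sum ((!) ms) ((!) is))) (components (part_stack q p))} =
    CARD('n) ^ part_loops q p"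
proof -
  define C where "C = components (part_stack q p)"
  define lab where "lab = case_sum ((!) js) ((!) is)"
  define G where "G ms = case_sum ((!) js) (case_sum ((!) ms) ((!) is))" for ms
  define cl where "cl x = (THE c. c \<in> C \<and> x \<in> c)" for x
  \<comment> \<open>\<open>T c\<close> is the set of values admissible on the component
    \<open>c\<close>, so that \<open>PiE C T\<close> is the set of all choices of one value per
    component.\<close>
  define T where "T c = (if outer_points c = {} then UNIV else {lab (SOME y. y \<in> outer_points c)})" for c
  have X: "\<Union>(part_stack q p) = map_sum id Inl ` ({..<k} <+> {..<l}) \<union> Inr ` ({..<l} <+> {..<m})"
    unfolding partitions_Union[OF p, symmetric] partitions_Union[OF q, symmetric]
    by (auto simp: part_stack_def)
  have C: "partition_on (\<Union>(part_stack q p)) C"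
    unfolding C_def by (rule partition_on_components)
  have "finite (\<Union>(part_stack q p))" unfolding X by auto
  then have fin: "finite C" using C finite_elements by blast
  have ne: "(SOME x. x \<in> c) \<in> c" if "c \<in> C" for c
    using that partition_onD3[OF C] by (metis some_in_eq)
  have cl: "cl x = c" if "c \<in> C" "x \<in> c" for x c
    unfolding cl_def using that partition_onD2[OF C]
    by (intro the_equality) (auto simp: disjoint_def)
  have clC: "cl (Inr (Inl j)) \<in> C \<and> Inr (Inl j) \<in> cl (Inr (Inl j))" if "j < l" for j
  proof -
    have "Inr (Inl j) \<in> \<Union>(part_stack q p)" unfolding X using that by auto
    then obtain c where "c \<in> C" "Inr (Inl j) \<in> c" using partition_onD1[OF C] by auto
    then show ?thesis using cl by simp
  qed
  have Gout: "G ms (map_sum id Inr y) = lab y" for ms y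
    by (cases y) (auto simp: G_def lab_def)
  have labc: "lab y = lab y'" if "c \<in> C" "y \<in> outer_points c" "y' \<in> outer_points c" for c y y'
    using bc that unfolding block_const_def part_comp_def C_def[symmetric] lab_def[symmetric] by blast
  \<comment> \<open>The two directions of the bijection: a middle point takes the value chosen for
    its component, and a component takes the value at one of its points.\<close>
  let ?i = "\<lambda>h. map (\<lambda>j. h (cl (Inr (Inl j)))) [0..<l]"
  let ?j = "\<lambda>ms. restrict (\<lambda>c. G ms (SOME x. x \<in> c)) C"
  have Gi: "G (?i h) x = h c" if h: "h \<in> PiE C T" and c: "c \<in> C" "x \<in> c" for h c x
  proof -
    have "x \<in> \<Union>(part_stack q p)" using c partition_onD1[OF C] by auto
    then consider (mid) j where "x = Inr (Inl j)" "j < l" | (out) y where "x = map_sum id Inr y"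
      unfolding X by (elim UnE imageE PlusE) (auto, metis map_sum.simps(1) id_apply, metis map_sum.simps(2))
    then show ?thesis
    proof cases
      case mid
      then have "cl (Inr (Inl j)) = c" using cl c by blast
      then show ?thesis using mid by (simp add: G_def)
    next
      case out
      then have y: "y \<in> outer_points c" using c by (simp add: outer_points_def)
      then have "(SOME y. y \<in> outer_points c) \<in> outer_points c" by (rule someI)
      moreover have "h c = lab (SOME y. y \<in> outer_points c)"
        using h c y by (auto simp: T_def PiE_iff split: if_splits)
      ultimately show ?thesis using labc[OF c(1) y] Gout out by simp
    qed
  qed
  have "bij_betw ?j {ms. length ms = l \<and> block_const (G ms) C} (PiE C T)"
  proof (rule bij_betw_byWitness[where f' = ?i])
    show "\<forall>ms\<in>{ms. length ms = l \<and> block_const (G ms) C}. ?i (?j ms) = ms"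
    proof
      fix ms assume ms: "ms \<in> {ms. length ms = l \<and> block_const (G ms) C}"
      show "?i (?j ms) = ms"
      proof (rule nth_equalityI)
        fix j assume "j < length (?i (?j ms))"
        then have j: "j < l" by simp
        let ?c = "cl (Inr (Inl j))"
        have "G ms (SOME x. x \<in> ?c) = G ms (Inr (Inl j))"
          using ms clC[OF j] ne[of ?c] unfolding block_const_def by blast
        then show "?i (?j ms) ! j = ms ! j"
          using j clC[OF j] by (simp add: G_def)
      qed (use ms in simp)
    qed
    show "\<forall>h\<in>PiE C T. ?j (?i h) = h"
    proof
      fix h assume h: "h \<in> PiE C T"
      show "?j (?i h) = h"
      proof
        fix c
        show "?j (?i h) c = h c"
          using Gi[OF h _ ne] h by (cases "c \<in> C") (auto simp: PiE_iff extensional_def)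
      qed
    qed
    show "?j ` {ms. length ms = l \<and> block_const (G ms) C} \<subseteq> PiE C T"
    proof (intro image_subsetI PiE_I)
      fix ms c assume ms: "ms \<in> {ms. length ms = l \<and> block_const (G ms) C}" and c: "c \<in> C"
      show "?j ms c \<in> T c"
      proof (cases "outer_points c = {}")
        case False
        then have "(SOME y. y \<in> outer_points c) \<in> outer_points c" by (simp add: some_in_eq)
        then have "map_sum id Inr (SOME y. y \<in> outer_points c) \<in> c" by (simp add: outer_points_def)
        then have "G ms (SOME x. x \<in> c) = G ms (map_sum id Inr (SOME y. y \<in> outer_points c))"
          using ms c ne[OF c] unfolding block_const_def by blast
        then show ?thesis using False c by (simp add: T_def Gout)
      qed (simp add: T_def)
    qed simp
    show "?i ` PiE C T \<subseteq> {ms. length ms = l \<and> block_const (G ms) C}"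
      unfolding block_const_def using Gi by force
  qed
  then have "card {ms. length ms = l \<and> block_const (G ms) C} = card (PiE C T)"
    by (rule bij_betw_same_card)
  also have "\<dots> = (\<Prod>c\<in>C. card (T c))" by (rule card_PiE[OF fin])
  also have "\<dots> = (\<Prod>c\<in>C. if outer_points c = {} then CARD('n) else 1)"
    by (rule prod.cong) (auto simp: T_def)
  also have "\<dots> = CARD('n) ^ card {c \<in> C. outer_points c = {}}"
    by (simp add: fin flip: prod.inter_filter)
  finally show ?thesis by (simp add: C_def G_def part_loops_def)
qed

text \<open>The product sums over the labels of the middle row, and a summand is 1 exactly when the
  labels of all three rows are constant on the components of the stacked diagram. The entry is
  therefore the number counted in \<open>card_labellings\<close>, or 0 if the outer labels already
  conflict.\<close>

lemma part_map_comp: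
  assumes p: "p \<in> partitions k l" and q: "q \<in> partitions l m"
  shows "lmult l (part_map l m q) (part_map k l p) is js =
    of_nat CARD('n::finite) ^ part_loops q p * part_map k m (part_comp q p) is (js :: 'n list)"
proof (cases "length is = m \<and> length js = k")
  case True
  define G where "G ms = case_sum ((!) js) (case_sum ((!) ms) ((!) is))" for ms
  have "G ms \<circ> map_sum id Inl = case_sum ((!) js) ((!) ms)" "G ms \<circ> Inr = case_sum ((!) ms) ((!) is)" for ms
    by (auto simp: G_def fun_eq_iff split: sum.split)
  then have G: "block_const (G ms) (components (part_stack q p)) \<longleftrightarrow>
      block_const (case_sum ((!) js) ((!) ms)) p \<and> block_const (case_sum ((!) ms) ((!) is)) q" for ms
    by (simp add: block_const_components part_stack_def block_const_Un block_const_image)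
  have "lmult l (part_map l m q) (part_map k l p) is js =
      (\<Sum>ms | length ms = l. if block_const (G ms) (components (part_stack q p)) then 1 else 0)"
    unfolding lmult_def by (rule sum.cong) (auto simp: part_map_block_const True G)
  also have "\<dots> = of_nat (card {ms. length ms = l \<and> block_const (G ms) (components (part_stack q p))})"
    by (simp add: Collect_conj_eq flip: sum.inter_filter)
  also have "\<dots> = of_nat CARD('n) ^ part_loops q p * part_map k m (part_comp q p) is js"
  proof (cases "block_const (case_sum ((!) js) ((!) is)) (part_comp q p)")
    case b: True
    show ?thesis
      using card_labellings[OF p q b] by (simp add: G_def part_map_block_const True b)
  next
    case False
    have "\<not> block_const (G ms) (components (part_stack q p))" for ms
    proof
      assume *: "block_const (G ms) (components (part_stack q p))"
      have "G ms (map_sum id Inr y) = case_sum ((!) js) ((!) is) y" for y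
        by (cases y) (auto simp: G_def)
      with * have "block_const (case_sum ((!) js) ((!) is)) (part_comp q p)"
        unfolding block_const_def part_comp_def outer_points_def by (auto; metis)
      with False show False ..
    qed
    then show ?thesis using False by (simp add: part_map_block_const)
  qed
  finally show ?thesis .
next
  case False
  then have "part_map k m (part_comp q p) is js = 0"
    by (auto simp: part_map_def)
  moreover have "lmult l (part_map l m q) (part_map k l p) is js = 0"
    using False tensor_maps_lmult[OF tensor_maps_part_map[of l m q] tensor_maps_part_map[of k l p]]
    by (auto simp: tensor_maps_def)
  ultimately show ?thesis by simp
qed

section \<open>Linear combinations of partitions\<close>

lemma lin_part_map_lin_ext: "lin_part_map k l f is js = lin_ext (\<lambda>p. part_map k l p is js) f"
  by (simp add: lin_part_map_def lin_ext_def)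

lemma tensor_maps_lin_part_map: "lin_part_map k l f \<in> tensor_maps k l"
proof -
  have "lin_part_map k l f is js = 0" if "\<not> (length is = l \<and> length js = k)" for "is" js
    using that by (auto simp: lin_part_map_def part_map_def intro!: sum.neutral)
  then show ?thesis by (auto simp: tensor_maps_def)
qed

lemma lin_part_map_add: "lin_part_map k l (f + g) is js = lin_part_map k l f is js + lin_part_map k l g is js"
  by (simp add: lin_part_map_lin_ext lin_ext_add)

lemma lin_part_map_diff: "lin_part_map k l (f - g) is js = lin_part_map k l f is js - lin_part_map k l g is js"
  by (simp add: lin_part_map_lin_ext lin_ext_diff)

lemma lin_part_map_scaleC: "lin_part_map k l (c *\<^sub>C f) is js = c * lin_part_map k l f is js"
  by (simp add: lin_part_map_lin_ext lin_ext_scaleC)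

lemma lin_part_map_zero [simp]: "lin_part_map k l 0 = (\<lambda>is js. 0)"
  by (simp add: lin_part_map_def fun_eq_iff)

lemma lin_part_map_single: "lin_part_map k l (Poly_Mapping.single p c) is js = c * part_map k l p is js"
  by (simp add: lin_part_map_lin_ext)

lemma lin_part_map_sum: "lin_part_map k l (\<Sum>i\<in>I. f i) is js = (\<Sum>i\<in>I. lin_part_map k l (f i) is js)"
  by (simp add: lin_part_map_lin_ext lin_ext_sum)

lemma lin_part_map_tensor:
  assumes "f \<in> Part k l" "g \<in> Part k' l'"
  shows "lin_part_map (k + k') (l + l') (lin_tensor k l f g) =
    tens k l (lin_part_map k l f) (lin_part_map k' l' g)"
proof (intro ext)
  fix "is" js :: "'a list"
  have *: "part_map (k + k') (l + l') (part_tensor k l p q) is js =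
      part_map k l p (take l is) (take k js) * part_map k' l' q (drop l is) (drop k js)"
    if "p \<in> Poly_Mapping.keys f" "q \<in> Poly_Mapping.keys g" for p q
  proof -
    have "p \<in> partitions k l" "q \<in> partitions k' l'" using that assms by (auto simp: Part_def)
    from fun_cong[OF fun_cong[OF part_map_tensor[OF this]], of "is" js] show ?thesis
      by (simp add: tens_def)
  qed
  have "lin_part_map (k + k') (l + l') (lin_tensor k l f g) is js =
     (\<Sum>p\<in>Poly_Mapping.keys f. Poly_Mapping.lookup f p * (\<Sum>q\<in>Poly_Mapping.keys g. Poly_Mapping.lookup g q *
       (part_map k l p (take l is) (take k js) * part_map k' l' q (drop l is) (drop k js))))"
    unfolding lin_tensor_def lin_ext_def
    by (simp add: lin_part_map_sum lin_part_map_scaleC lin_part_map_single *)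
  also have "\<dots> = tens k l (lin_part_map k l f) (lin_part_map k' l' g) is js"
    unfolding tens_def lin_part_map_def sum_product unfolding sum_distrib_left
    by (intro sum.cong refl) (simp only: mult_ac)
  finally show "lin_part_map (k + k') (l + l') (lin_tensor k l f g) is js =
    tens k l (lin_part_map k l f) (lin_part_map k' l' g) is js" .
qed

lemma lin_part_map_comp:
  assumes "f \<in> Part k l" "g \<in> Part l m"
  shows "lin_part_map k m (lin_comp (of_nat CARD('n::finite)) g f) =
    (lmult l (lin_part_map l m g) (lin_part_map k l f) :: 'n tensor_map)"
proof (intro ext)
  fix "is" js :: "'n list"
  have *: "of_nat CARD('n) ^ part_loops q p * part_map k m (part_comp q p) is js =
      (\<Sum>ms | length ms = l. part_map l m q is ms * part_map k l p ms js)"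
    if "p \<in> Poly_Mapping.keys f" "q \<in> Poly_Mapping.keys g" for p q
  proof -
    have "p \<in> partitions k l" "q \<in> partitions l m" using that assms by (auto simp: Part_def)
    from part_map_comp[OF this, of "is" js] show ?thesis by (simp add: lmult_def)
  qed
  have "lin_part_map k m (lin_comp (of_nat CARD('n)) g f) is js =
     (\<Sum>q\<in>Poly_Mapping.keys g. Poly_Mapping.lookup g q * (\<Sum>p\<in>Poly_Mapping.keys f.
       Poly_Mapping.lookup f p * (\<Sum>ms | length ms = l. part_map l m q is ms * part_map k l p ms js)))"
    unfolding lin_comp_def lin_ext_def
    by (simp add: lin_part_map_sum lin_part_map_scaleC lin_part_map_single *)
  also have "\<dots> = (\<Sum>q\<in>Poly_Mapping.keys g. \<Sum>ms | length ms = l. \<Sum>p\<in>Poly_Mapping.keys f.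
       (Poly_Mapping.lookup g q * part_map l m q is ms) * (Poly_Mapping.lookup f p * part_map k l p ms js))"
    unfolding sum_distrib_left
    by (rule sum.cong[OF refl], subst sum.swap, intro sum.cong refl) (simp only: mult_ac)
  also have "\<dots> = (\<Sum>ms | length ms = l. \<Sum>q\<in>Poly_Mapping.keys g. \<Sum>p\<in>Poly_Mapping.keys f.
       (Poly_Mapping.lookup g q * part_map l m q is ms) * (Poly_Mapping.lookup f p * part_map k l p ms js))"
    by (rule sum.swap)
  also have "\<dots> = lmult l (lin_part_map l m g) (lin_part_map k l f) is js"
    unfolding lmult_def lin_part_map_def sum_product scaleC_complex_def ..
  finally show "lin_part_map k m (lin_comp (of_nat CARD('n)) g f) is js =
    lmult l (lin_part_map l m g) (lin_part_map k l f) is js" .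
qed

lemma lin_part_map_invol: "lin_part_map l k (lin_invol f) = adj (lin_part_map k l f)"
proof (intro ext)
  fix "is" js :: "'a list"
  have "cnj (part_map k l p js is) = part_map k l p js is" for p
    by (simp add: part_map_def)
  then show "lin_part_map l k (lin_invol f) is js = adj (lin_part_map k l f) is js"
    by (simp add: lin_invol_def lin_part_map_sum lin_part_map_single part_map_invol adj_def)
      (simp add: lin_part_map_def)
qed

section \<open>The double commutant theorem\<close>

lemma function_space_sum:
  fixes V :: "('x \<Rightarrow> complex) set"
  assumes "(\<lambda>x. 0) \<in> V" "\<And>f g. f \<in> V \<Longrightarrow> g \<in> V \<Longrightarrow> (\<lambda>x. f x + g x) \<in> V"
    "\<And>i. i \<in> A \<Longrightarrow> f i \<in> V"
  shows "(\<lambda>x. \<Sum>i\<in>A. f i x) \<in> V"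
  using assms(3) by (induction A rule: infinite_finite_induct) (auto simp: assms(1,2))

text \<open>The kernel \<open>p\<close> is the matrix of the orthogonal projection onto
  \<open>V\<close>. Induction on the support: the functions in \<open>V\<close> that vanish at
  \<open>a\<close> have codimension at most one, so their projection has to be corrected by at most
  one rank-one projection.\<close>

lemma reproducing_kernel:
  fixes V :: "('x \<Rightarrow> complex) set"
  assumes "finite X" "(\<lambda>x. 0) \<in> V" "\<And>f g. f \<in> V \<Longrightarrow> g \<in> V \<Longrightarrow> (\<lambda>x. f x + g x) \<in> V"
    "\<And>c f. f \<in> V \<Longrightarrow> (\<lambda>x. c * f x) \<in> V" "\<And>f x. f \<in> V \<Longrightarrow> x \<notin> X \<Longrightarrow> f x = 0"
  shows "\<exists>p. (\<forall>y. (\<lambda>x. p x y) \<in> V) \<and> (\<forall>x y. cnj (p x y) = p y x) \<and>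
    (\<forall>f\<in>V. \<forall>x. (\<Sum>y\<in>X. p x y * f y) = f x)"
  using assms
proof (induction X arbitrary: V rule: finite_induct)
  case empty
  then show ?case by (intro exI[of _ "\<lambda>x y. 0"]) (auto simp: fun_eq_iff)
next
  case (insert a X V)
  note zero = insert.prems(1) and add = insert.prems(2) and scale = insert.prems(3)
    and supp = insert.prems(4)
  let ?V' = "{f \<in> V. f a = 0}"
  have "\<exists>p. (\<forall>y. (\<lambda>x. p x y) \<in> ?V') \<and> (\<forall>x y. cnj (p x y) = p y x) \<and>
    (\<forall>f\<in>?V'. \<forall>x. (\<Sum>y\<in>X. p x y * f y) = f x)"
  proof (rule insert.IH)
    show "f x = 0" if "f \<in> ?V'" "x \<notin> X" for f x
      using that supp[of f x] by (cases "x = a") auto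
  qed (use zero add scale in auto)
  then obtain p where "\<forall>y. (\<lambda>x. p x y) \<in> ?V'" "\<forall>x y. cnj (p x y) = p y x"
    "\<forall>f\<in>?V'. \<forall>x. (\<Sum>y\<in>X. p x y * f y) = f x"
    by (elim exE conjE) (rule that)
  then have p: "\<And>y. (\<lambda>x. p x y) \<in> V" "\<And>y. p a y = 0" "\<And>x y. cnj (p x y) = p y x"
    "\<And>f x. f \<in> V \<Longrightarrow> f a = 0 \<Longrightarrow> (\<Sum>y\<in>X. p x y * f y) = f x"
    by simp_all
  have pa: "p x a = 0" for x using p(2)[of x] p(3)[of a x] by simp
  show ?case
  proof (cases "\<forall>f\<in>V. f a = 0")
    case True
    then show ?thesis
      using p insert.hyps by (intro exI[of _ p]) auto
  next
    case False
    then obtain f where f: "f \<in> V" "f a \<noteq> 0" by blast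
    \<comment> \<open>The component of \<open>f\<close> orthogonal to the functions of
      \<open>V\<close> that vanish at \<open>a\<close>; it spans the missing direction.\<close>
    define g where "g x = f x - (\<Sum>y\<in>X. p x y * f y)" for x
    have pf: "(\<lambda>x. \<Sum>y\<in>X. f y * p x y) \<in> V"
      by (rule function_space_sum) (use zero add scale p(1) in auto)
    have "(\<lambda>x. f x + (- 1) * (\<Sum>y\<in>X. f y * p x y)) \<in> V"
      by (intro add scale f pf)
    then have gV: "g \<in> V" by (simp add: g_def[abs_def] mult.commute)
    have ga: "g a \<noteq> 0" using f by (simp add: g_def p(2))
    have orth: "(\<Sum>x\<in>X. cnj (h x) * g x) = 0" if h: "h \<in> V" "h a = 0" for h
    proof -
      have "(\<Sum>x\<in>X. cnj (h x) * (\<Sum>y\<in>X. p x y * f y)) = (\<Sum>y\<in>X. \<Sum>x\<in>X. cnj (h x) * (p x y * f y))"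
        unfolding sum_distrib_left by (rule sum.swap)
      also have "\<dots> = (\<Sum>y\<in>X. cnj (\<Sum>x\<in>X. p y x * h x) * f y)"
        unfolding cnj_sum sum_distrib_right by (intro sum.cong refl) (simp only: complex_cnj_mult p(3) mult_ac)
      also have "\<dots> = (\<Sum>y\<in>X. cnj (h y) * f y)" by (simp add: p(4)[OF h])
      finally show ?thesis by (simp add: g_def right_diff_distrib sum_subtractf)
    qed
    have gp: "(\<Sum>y\<in>X. p x y * g y) = 0" for x
      using orth[OF p(1) p(2), of x] by (simp add: p(3))
    define n where "n = (\<Sum>x\<in>insert a X. cnj (g x) * g x)"
    have "n = of_real (\<Sum>x\<in>insert a X. (cmod (g x))\<^sup>2)"
      unfolding n_def of_real_sum
      by (intro sum.cong refl) (simp only: complex_norm_square mult.commute)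
    moreover have "(\<Sum>x\<in>insert a X. (cmod (g x))\<^sup>2) > 0"
      using insert.hyps ga by (intro sum_pos2[of _ a]) auto
    ultimately have n: "n \<noteq> 0" "cnj n = n" by (simp_all del: of_real_sum)
    let ?p = "\<lambda>x y. p x y + g x * cnj (g y) / n"
    show ?thesis
    proof (intro exI[of _ ?p] conjI allI ballI)
      fix y
      have "(\<lambda>x. p x y + (cnj (g y) / n) * g x) \<in> V"
        by (intro add scale p(1) gV)
      then show "(\<lambda>x. ?p x y) \<in> V" by (simp add: mult.commute)
    next
      fix x y
      show "cnj (?p x y) = ?p y x" by (simp add: n(2) p(3) mult.commute)
    next
      fix h x
      assume h: "h \<in> V"
      \<comment> \<open>Subtracting this multiple of \<open>g\<close> makes \<open>h\<close> vanish
        at \<open>a\<close>, so that the kernel \<open>p\<close> reproduces the rest.\<close>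
      define c where "c = h a / g a"
      define h' where "h' x = h x - c * g x" for x
      have "(\<lambda>x. h x + (- c) * g x) \<in> V" by (intro add scale h gV)
      then have h': "h' \<in> V" "h' a = 0" using ga by (simp_all add: h'_def[abs_def] c_def)
      have hh: "h y = h' y + c * g y" for y by (simp add: h'_def)
      have 1: "(\<Sum>y\<in>insert a X. p x y * h y) = h' x"
      proof -
        have "(\<Sum>y\<in>insert a X. p x y * h y) = (\<Sum>y\<in>X. p x y * h' y + c * (p x y * g y))"
          unfolding sum.insert[OF insert.hyps(1,2)] pa mult_zero_left add_0 unfolding hh
          by (intro sum.cong refl) (simp only: distrib_left mult_ac)
        also have "\<dots> = h' x"
          unfolding sum.distrib sum_distrib_left[symmetric] p(4)[OF h'] gp by simp
        finally show ?thesis .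
      qed
      have 2: "(\<Sum>y\<in>insert a X. cnj (g y) * h y) = c * n"
      proof -
        have "(\<Sum>y\<in>insert a X. cnj (g y) * h' y) = cnj (\<Sum>y\<in>X. cnj (h' y) * g y)"
          using insert.hyps h' by (simp add: mult.commute)
        then have "(\<Sum>y\<in>insert a X. cnj (g y) * h' y) = 0" using orth[OF h'] by simp
        then show ?thesis
          unfolding hh distrib_left sum.distrib n_def sum_distrib_left by (simp only: mult_ac add_0)
      qed
      have "(\<Sum>y\<in>insert a X. ?p x y * h y) =
          (\<Sum>y\<in>insert a X. p x y * h y) + g x / n * (\<Sum>y\<in>insert a X. cnj (g y) * h y)"
        unfolding sum_distrib_left sum.distrib[symmetric]
        by (intro sum.cong refl) (simp only: distrib_left distrib_right times_divide_eq_left times_divide_eq_right mult_ac)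
      moreover have "g x / n * (c * n) = c * g x" using n(1) by simp
      ultimately show "(\<Sum>y\<in>insert a X. ?p x y * h y) = h x"
        unfolding 1 2 hh[of x] by simp
    qed
  qed
qed

text \<open>
  Von Neumann's argument: \<open>B\<close> acts by left multiplication on the space of all matrices, of which
  it is itself an invariant subspace.  The orthogonal projection onto it consists of blocks that
  commute with \<open>B\<close>, and maps the identity, hence also \<open>T\<close>, into \<open>B\<close>.
\<close>

theorem double_commutant:
  fixes B :: "('a \<Rightarrow> 'a \<Rightarrow> complex) set"
  assumes fin: "finite I"
    and supp: "\<And>b i j. b \<in> B \<Longrightarrow> b i j \<noteq> 0 \<Longrightarrow> i \<in> I \<and> j \<in> I"
    and zero: "(\<lambda>i j. 0) \<in> B"
    and add: "\<And>b c. b \<in> B \<Longrightarrow> c \<in> B \<Longrightarrow> (\<lambda>i j. b i j + c i j) \<in> B"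
    and scale: "\<And>z b. b \<in> B \<Longrightarrow> (\<lambda>i j. z * b i j) \<in> B"
    and mult: "\<And>b c. b \<in> B \<Longrightarrow> c \<in> B \<Longrightarrow> (\<lambda>i j. \<Sum>k\<in>I. b i k * c k j) \<in> B"
    and adj: "\<And>b. b \<in> B \<Longrightarrow> (\<lambda>i j. cnj (b j i)) \<in> B"
    and one: "(\<lambda>i j. if i = j \<and> i \<in> I then 1 else 0) \<in> B"
    and T: "\<And>i j. T i j \<noteq> 0 \<Longrightarrow> i \<in> I \<and> j \<in> I"
    and comm: "\<And>S. (\<And>i j. S i j \<noteq> 0 \<Longrightarrow> i \<in> I \<and> j \<in> I) \<Longrightarrow>
      (\<And>b i j. b \<in> B \<Longrightarrow> (\<Sum>k\<in>I. S i k * b k j) = (\<Sum>k\<in>I. b i k * S k j)) \<Longrightarrow>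
      (\<And>i j. (\<Sum>k\<in>I. S i k * T k j) = (\<Sum>k\<in>I. T i k * S k j))"
  shows "T \<in> B"
proof -
  let ?V = "case_prod ` B"
  have V: "f \<in> ?V \<longleftrightarrow> (\<lambda>i j. f (i, j)) \<in> B" for f
    by (auto simp: image_iff intro!: bexI[of _ "\<lambda>i j. f (i, j)"])
  have "\<exists>p. (\<forall>y. (\<lambda>x. p x y) \<in> ?V) \<and> (\<forall>x y. cnj (p x y) = p y x) \<and>
    (\<forall>f\<in>?V. \<forall>x. (\<Sum>y\<in>I \<times> I. p x y * f y) = f x)"
  proof (rule reproducing_kernel)
    show "f x = 0" if "f \<in> ?V" "x \<notin> I \<times> I" for f x
      using that supp unfolding V by (cases x) force
  qed (unfold V, use fin zero add scale in \<open>auto\<close>)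
  then obtain p where "\<forall>y. (\<lambda>x. p x y) \<in> ?V" "\<forall>x y. cnj (p x y) = p y x"
    "\<forall>f\<in>?V. \<forall>x. (\<Sum>y\<in>I \<times> I. p x y * f y) = f x"
    by (elim exE conjE) (rule that)
  then have pV: "\<And>y. (\<lambda>x. p x y) \<in> ?V" and p2: "\<And>x y. cnj (p x y) = p y x"
    and repr0: "\<And>f x. f \<in> ?V \<Longrightarrow> (\<Sum>y\<in>I \<times> I. p x y * f y) = f x"
    by blast+
  have p1: "(\<lambda>i j. p (i, j) y) \<in> B" for y using pV[of y, unfolded V] .
  note p = p1 p2
  have repr: "b i j = (\<Sum>(k, l)\<in>I \<times> I. cnj (p (k, l) (i, j)) * b k l)" if "b \<in> B" for b i j
    using repr0[of "case_prod b" "(i, j)"] that by (simp add: case_prod_beta p(2))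
  have psupp: "p (i, j) (k, l) = 0" if "\<not> (i \<in> I \<and> j \<in> I \<and> k \<in> I \<and> l \<in> I)" for i j k l
    using that supp[OF p1[of "(k, l)"], of i j] supp[OF p1[of "(i, j)"], of k l] p(2)[of "(i, j)" "(k, l)"]
    by (metis complex_cnj_zero_iff)
  \<comment> \<open>\<open>B\<close> is invariant under left multiplication by \<open>b\<close> and
    by its adjoint, so the projection commutes with left multiplication by \<open>b\<close>. In
    entries, each block with \<open>j\<close> and \<open>l\<close> fixed commutes with
    \<open>b\<close>. Both sides are expanded by the reproducing property.\<close>
  have pcomm: "(\<Sum>k\<in>I. p (i, j) (k, l) * b k m) = (\<Sum>k\<in>I. b i k * p (k, j) (m, l))"
    if b: "b \<in> B" for b i j l m
  proof -
    let ?bx = "\<lambda>m l. \<Sum>k\<in>I. cnj (b k m) * p (k, l) (i, j)"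
    let ?by = "\<lambda>i j. \<Sum>k\<in>I. b i k * p (k, j) (m, l)"
    have bx: "?bx \<in> B" using mult[OF adj[OF b] p(1)[of "(i, j)"]] .
    have by': "?by \<in> B" using mult[OF b p(1)[of "(m, l)"]] .
    have "?by i j = (\<Sum>i'\<in>I. \<Sum>j'\<in>I. \<Sum>k\<in>I. cnj (p (i', j') (i, j)) * (b i' k * p (k, j') (m, l)))"
      by (subst repr[OF by']) (unfold sum.cartesian_product[symmetric] sum_distrib_left, rule refl)
    also have "\<dots> = (\<Sum>i'\<in>I. \<Sum>k\<in>I. \<Sum>j'\<in>I. cnj (p (i', j') (i, j)) * (b i' k * p (k, j') (m, l)))"
      by (rule sum.cong[OF refl], rule sum.swap)
    also have "\<dots> = (\<Sum>k\<in>I. \<Sum>i'\<in>I. \<Sum>j'\<in>I. cnj (p (i', j') (i, j)) * (b i' k * p (k, j') (m, l)))"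
      by (rule sum.swap)
    also have "\<dots> = (\<Sum>k\<in>I. \<Sum>j'\<in>I. \<Sum>i'\<in>I. cnj (p (i', j') (i, j)) * (b i' k * p (k, j') (m, l)))"
      by (rule sum.cong[OF refl], rule sum.swap)
    also have "\<dots> = cnj (\<Sum>(k, j')\<in>I \<times> I. cnj (p (k, j') (m, l)) * ?bx k j')"
      unfolding sum.cartesian_product[symmetric] cnj_sum complex_cnj_mult complex_cnj_cnj sum_distrib_left p(2)
      by (intro sum.cong refl) (simp only: mult_ac)
    also have "\<dots> = cnj (?bx m l)" by (subst repr[OF bx]) simp
    also have "\<dots> = (\<Sum>k\<in>I. p (i, j) (k, l) * b k m)"
      by (simp add: p(2) mult.commute)
    finally show ?thesis ..
  qed
  \<comment> \<open>With \<open>P\<close> the projection, this is \<open>T = T P(1) = P(T)\<close>: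
    the identity lies in \<open>B\<close>, so \<open>P\<close> fixes it, and \<open>T\<close>
    commutes with the blocks of \<open>P\<close> because they commute with \<open>B\<close>.\<close>
  have "T i j = (\<Sum>y\<in>I \<times> I. case_prod T y * p (i, j) y)" for i j
  proof (cases "j \<in> I")
    case False
    then have "p (i, j) y = 0" for y using psupp by (cases y) simp
    moreover have "T i j = 0" using T[of i j] False by blast
    ultimately show ?thesis by simp
  next
    case True
    have d: "(\<Sum>(k, l)\<in>I \<times> I. f k l * (if k = l \<and> k \<in> I then 1 else 0)) = (\<Sum>l\<in>I. f l l)"
      for f :: "'a \<Rightarrow> 'a \<Rightarrow> complex"
    proof -
      have "(\<Sum>l\<in>I. f k l * (if k = l \<and> k \<in> I then 1 else 0)) = (\<Sum>l\<in>I. if l = k then f k k else 0)"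
        if "k \<in> I" for k
        using that by (intro sum.cong) auto
      then show ?thesis
        unfolding sum.cartesian_product[symmetric] using fin by (intro sum.cong refl) simp
    qed
    have "T i j = (\<Sum>k\<in>I. T i k * (if k = j \<and> k \<in> I then 1 else 0))"
    proof -
      have "(\<Sum>k\<in>I. T i k * (if k = j \<and> k \<in> I then 1 else 0)) = (\<Sum>k\<in>I. if k = j then T i j else 0)"
        using True by (intro sum.cong) auto
      then show ?thesis using True fin by simp
    qed
    also have "\<dots> = (\<Sum>k\<in>I. T i k * (\<Sum>l\<in>I. p (k, j) (l, l)))"
      by (subst repr[OF one]) (simp only: d p(2))
    also have "\<dots> = (\<Sum>l\<in>I. \<Sum>k\<in>I. T i k * p (k, j) (l, l))"
      unfolding sum_distrib_left by (rule sum.swap)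
    also have "\<dots> = (\<Sum>l\<in>I. \<Sum>k\<in>I. p (i, j) (k, l) * T k l)"
    proof (rule sum.cong[OF refl])
      fix l
      show "(\<Sum>k\<in>I. T i k * p (k, j) (l, l)) = (\<Sum>k\<in>I. p (i, j) (k, l) * T k l)"
        by (rule comm[of "\<lambda>i k. p (i, j) (k, l)", symmetric]) (use psupp pcomm in blast)+
    qed
    also have "\<dots> = (\<Sum>y\<in>I \<times> I. case_prod T y * p (i, j) y)"
      by (subst sum.swap, unfold sum.cartesian_product) (simp add: case_prod_beta mult.commute)
    finally show ?thesis .
  qed
  then have "case_prod T = (\<lambda>x. \<Sum>y\<in>I \<times> I. case_prod T y * p x y)"
    by (auto simp: fun_eq_iff)
  moreover have "(\<lambda>x. \<Sum>y\<in>I \<times> I. case_prod T y * p x y) \<in> ?V"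
    by (rule function_space_sum) (unfold V, use zero add scale p in auto)
  ultimately have "case_prod T \<in> ?V" by simp
  then show ?thesis unfolding V by simp
qed

section \<open>Tannaka--Krein duality for Pol O_N\<close>

lemma sum_words_le:
  fixes f :: "'n::finite list \<Rightarrow> 'b::comm_monoid_add"
  shows "(\<Sum>ms | length ms \<le> n. f ms) = (\<Sum>m\<le>n. \<Sum>ms | length ms = m. f ms)"
proof (induction n)
  case (Suc n)
  have "{ms :: 'n list. length ms \<le> Suc n} = {ms. length ms \<le> n} \<union> {ms. length ms = Suc n}" by auto
  moreover have "finite {ms :: 'n list. length ms \<le> n}"
    using finite_lists_length_le[of "UNIV :: 'n set" n] by simp
  ultimately show ?case using Suc by (simp add: sum.union_disjoint disjoint_iff)
qed simp

lemma finite_words_le: "finite {ms :: 'n::finite list. length ms \<le> n}"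
  using finite_lists_length_le[of "UNIV :: 'n set" n] by simp

text \<open>The double commutant theorem is applied to matrices over all words of length at most
  \<open>n\<close> at once; this cuts out the component between two fixed degrees.\<close>

definition blk :: "nat \<Rightarrow> nat \<Rightarrow> 'n tensor_map \<Rightarrow> 'n tensor_map" where
  "blk k l T is js = (if length is = l \<and> length js = k then T is js else 0)"

text \<open>No tensor product is required here: the double commutant argument uses only composition,
  adjoints and identities.\<close>

locale concrete_category =
  fixes C :: "nat \<Rightarrow> nat \<Rightarrow> 'n::finite tensor_map set"
  assumes maps: "C k l \<subseteq> tensor_maps k l"
    and zero: "(\<lambda>is js. 0) \<in> C k l"
    and add: "S \<in> C k l \<Longrightarrow> T \<in> C k l \<Longrightarrow> (\<lambda>is js. S is js + T is js) \<in> C k l"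
    and scale: "T \<in> C k l \<Longrightarrow> (\<lambda>is js. c * T is js) \<in> C k l"
    and comp: "S \<in> C l m \<Longrightarrow> T \<in> C k l \<Longrightarrow> lmult l S T \<in> C k m"
    and adj: "T \<in> C k l \<Longrightarrow> adj T \<in> C l k"
    and ident: "word_id k \<in> C k k"
begin

lemma sum_closed: "(\<And>i. i \<in> A \<Longrightarrow> f i \<in> C k l) \<Longrightarrow> (\<lambda>is js. \<Sum>i\<in>A. f i is js) \<in> C k l"
  by (induction A rule: infinite_finite_induct) (auto simp: zero add)

lemma eq_zero: "T \<in> C k l \<Longrightarrow> \<not> (length is = l \<and> length js = k) \<Longrightarrow> T is js = 0"
  using maps unfolding tensor_maps_def by blast

text \<open>Only the diagonal blocks of \<open>S\<close> in degrees up to \<open>n\<close> enter,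
  and the condition says that they form a natural endomorphism of the truncated sequence of tensor
  powers.\<close>

definition commuting :: "nat \<Rightarrow> 'n tensor_map \<Rightarrow> bool" where
  "commuting n S \<longleftrightarrow> (\<forall>k l c is js. k \<le> n \<longrightarrow> l \<le> n \<longrightarrow> c \<in> C k l \<longrightarrow>
     length is = l \<longrightarrow> length js = k \<longrightarrow> lmult l S c is js = lmult k c S is js)"

text \<open>The spaces \<open>C k l\<close> with \<open>k\<close> and \<open>l\<close> at most
  \<open>n\<close> assemble into a finite-dimensional algebra of matrices, closed under adjoints and
  containing the identity. Its commutant consists of block diagonal matrices satisfying
  \<open>commuting n\<close>, so the hypothesis puts \<open>T\<close> into the double
  commutant.\<close>

lemma mem_if_commutes:
  assumes T: "T \<in> tensor_maps k l" and n: "k \<le> n" "l \<le> n"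
    and comm: "\<And>S is js. commuting n S \<Longrightarrow> length is = l \<Longrightarrow> length js = k \<Longrightarrow>
      lmult l S T is js = lmult k T S is js"
  shows "T \<in> C k l"
proof -
  define I where "I = {ms :: 'n list. length ms \<le> n}"
  define B where "B = {M. (\<forall>is js. M is js \<noteq> 0 \<longrightarrow> is \<in> I \<and> js \<in> I) \<and>
    (\<forall>k l. k \<le> n \<longrightarrow> l \<le> n \<longrightarrow> blk k l M \<in> C k l)}"
  have BI: "M \<in> B" if "\<And>i j. M i j \<noteq> 0 \<Longrightarrow> i \<in> I \<and> j \<in> I"
    "\<And>k l. k \<le> n \<Longrightarrow> l \<le> n \<Longrightarrow> blk k l M \<in> C k l" for M
    using that unfolding B_def by blast
  have BD: "M i j \<noteq> 0 \<Longrightarrow> i \<in> I \<and> j \<in> I" "k \<le> n \<Longrightarrow> l \<le> n \<Longrightarrow> blk k l M \<in> C k l"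
    if "M \<in> B" for M i j k l
    using that unfolding B_def by blast+
  have split: "(\<Sum>ms\<in>I. f ms) = (\<Sum>m\<le>n. \<Sum>ms | length ms = m. f ms)" for f :: "'n list \<Rightarrow> complex"
    unfolding I_def by (rule sum_words_le)
  have restrict: "(\<Sum>ms\<in>I. f ms) = (\<Sum>ms | length ms = m. f ms)"
    if "m \<le> n" "\<And>ms. length ms \<noteq> m \<Longrightarrow> f ms = 0" for f :: "'n list \<Rightarrow> complex" and m
    using that by (intro sum.mono_neutral_right) (auto simp: I_def finite_words_le)
  have CB: "c \<in> B" if c: "c \<in> C k' l'" "k' \<le> n" "l' \<le> n" for c k' l'
  proof -
    have "blk k l c = (if k = k' \<and> l = l' then c else (\<lambda>is js. 0))" for k l
      using eq_zero[OF c(1)] by (auto simp: blk_def fun_eq_iff)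
    then have "blk k l c \<in> C k l" for k l using c zero by simp
    then show ?thesis
      using that eq_zero[OF c(1)] unfolding B_def I_def by fastforce
  qed
  have "T \<in> B"
  proof (rule double_commutant)
    show "finite I" unfolding I_def by (rule finite_words_le)
    show "i \<in> I \<and> j \<in> I" if "b \<in> B" "b i j \<noteq> 0" for b i j using that unfolding B_def by blast
    have "blk k l (\<lambda>is js. 0) = (\<lambda>is js :: 'n list. 0)" for k l by (simp add: blk_def fun_eq_iff)
    then show "(\<lambda>i j. 0) \<in> B" by (simp add: B_def zero)
    show "(\<lambda>i j. b i j + c i j) \<in> B" if "b \<in> B" "c \<in> B" for b c
    proof -
      have "blk k l (\<lambda>i j. b i j + c i j) = (\<lambda>i j. blk k l b i j + blk k l c i j)" for k l
        by (simp add: blk_def fun_eq_iff)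
      moreover have "i \<in> I \<and> j \<in> I" if "b i j + c i j \<noteq> 0" for i j
        using that BD(1)[OF \<open>b \<in> B\<close>, of i j] BD(1)[OF \<open>c \<in> B\<close>, of i j] by (cases "b i j = 0") auto
      ultimately show ?thesis by (intro BI) (simp_all only: add BD(2) that)
    qed
    show "(\<lambda>i j. z * b i j) \<in> B" if "b \<in> B" for z b
    proof -
      have "blk k l (\<lambda>i j. z * b i j) = (\<lambda>i j. z * blk k l b i j)" for k l
        by (simp add: blk_def fun_eq_iff)
      moreover have "i \<in> I \<and> j \<in> I" if "z * b i j \<noteq> 0" for i j
        using that BD(1)[OF \<open>b \<in> B\<close>, of i j] by auto
      ultimately show ?thesis by (intro BI) (simp_all only: scale BD(2) that)
    qed
    show "(\<lambda>i j. \<Sum>k\<in>I. b i k * c k j) \<in> B" if b: "b \<in> B" and c: "c \<in> B" for b c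
    proof -
      have e: "blk k l (\<lambda>i j. \<Sum>k\<in>I. b i k * c k j) =
          (\<lambda>i j. \<Sum>m\<le>n. lmult m (blk m l b) (blk k m c) i j)" for k l
        unfolding fun_eq_iff blk_def split lmult_def by (auto intro!: sum.cong)
      have cl: "(\<lambda>i j. \<Sum>m\<le>n. lmult m (blk m l b) (blk k m c) i j) \<in> C k l"
        if "k \<le> n" "l \<le> n" for k l
        by (rule sum_closed, rule comp) (use that BD(2)[OF b] BD(2)[OF c] in auto)
      have s: "i \<in> I \<and> j \<in> I" if nz: "(\<Sum>k\<in>I. b i k * c k j) \<noteq> 0" for i j
      proof -
        obtain k where "b i k * c k j \<noteq> 0" using nz by (auto elim: sum.not_neutral_contains_not_neutral)
        then have "b i k \<noteq> 0" "c k j \<noteq> 0" by auto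
        then show ?thesis using BD(1)[OF b] BD(1)[OF c] by blast
      qed
      show ?thesis
        by (rule BI, erule s, unfold e, rule cl)
    qed
    show "(\<lambda>i j. cnj (b j i)) \<in> B" if b: "b \<in> B" for b
    proof -
      have "blk k l (\<lambda>i j. cnj (b j i)) = adj (blk l k b)" for k l
        by (simp add: blk_def adj_def fun_eq_iff)
      moreover have "i \<in> I \<and> j \<in> I" if "cnj (b j i) \<noteq> 0" for i j
        using that BD(1)[OF b, of j i] by auto
      ultimately show ?thesis by (intro BI) (simp_all only: adj BD(2)[OF b])
    qed
    have "blk k l (\<lambda>i j. if i = j \<and> i \<in> I then 1 else 0) = (if k = l then word_id k else (\<lambda>is js. 0))"
      if "k \<le> n" for k l
      using that by (auto simp: blk_def word_id_def fun_eq_iff I_def)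
    then show "(\<lambda>i j. if i = j \<and> i \<in> I then 1 else 0) \<in> B"
      by (intro BI) (auto simp: ident zero split: if_splits)
    show "i \<in> I \<and> j \<in> I" if "T i j \<noteq> 0" for i j
      using that T n by (auto simp: tensor_maps_def I_def)
    fix S :: "'n tensor_map" and i j
    assume S: "\<And>i j. S i j \<noteq> 0 \<Longrightarrow> i \<in> I \<and> j \<in> I"
      and SB: "\<And>b i j. b \<in> B \<Longrightarrow> (\<Sum>k\<in>I. S i k * b k j) = (\<Sum>k\<in>I. b i k * S k j)"
    have comm_blk: "(\<Sum>k\<in>I. S i k * c k j) = (\<Sum>k\<in>I. c i k * S k j)"
      if "c \<in> C k' l'" "k' \<le> n" "l' \<le> n" for c k' l' i j
      using SB[OF CB[OF that]] .
    have lmS: "(\<Sum>k\<in>I. S i k * c k j) = lmult l' S c i j" "(\<Sum>k\<in>I. c i k * S k j) = lmult k' c S i j"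
      if "c \<in> tensor_maps k' l'" "k' \<le> n" "l' \<le> n" for c k' l' i j
      unfolding lmult_def scaleC_complex_def
    proof -
      have c: "c is js = 0" if "length is \<noteq> l' \<or> length js \<noteq> k'" for "is" js
        using that \<open>c \<in> tensor_maps k' l'\<close> by (auto simp: tensor_maps_def)
      show "(\<Sum>k\<in>I. S i k * c k j) = (\<Sum>ms | length ms = l'. S i ms * c ms j)"
        "(\<Sum>k\<in>I. c i k * S k j) = (\<Sum>ms | length ms = k'. c i ms * S ms j)"
        by (rule restrict; simp add: c that)+
    qed
    \<comment> \<open>The identity of the single degree \<open>length i\<close> lies in the algebra;
      commuting with it kills the blocks between different degrees.\<close>
    have diag: "S i j = 0" if "length i \<noteq> length j" for i j
    proof (cases "i \<in> I")
      case True
      then have le: "length i \<le> n" by (simp add: I_def)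
      have "lmult (length i) (word_id (length i)) S i j = (\<Sum>ms | length ms = length i. if ms = i then S i j else 0)"
        unfolding lmult_def by (intro sum.cong) (auto simp: word_id_def)
      moreover have "lmult (length i) S (word_id (length i)) i j = 0"
        unfolding lmult_def using that by (intro sum.neutral) (auto simp: word_id_def)
      ultimately show ?thesis
        using comm_blk[OF ident le le, of i j] lmS[OF tensor_maps_word_id le le, of i j] by simp
    qed (use S in blast)
    have "commuting n S"
      unfolding commuting_def
    proof (intro allI impI)
      fix k l c "is" js
      assume c: "c \<in> C k l" "k \<le> n" "l \<le> n"
      then have "c \<in> tensor_maps k l" using maps by blast
      from lmS[OF this c(2,3)] comm_blk[OF c] show "lmult l S c is js = lmult k c S is js" by simp
    qed
    then have *: "lmult l S T i j = lmult k T S i j" if "length i = l" "length j = k"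
      using comm that by blast
    have "lmult l S T i j = lmult k T S i j"
    proof (cases "length i = l \<and> length j = k")
      case False
      have 1: "S i ms * T ms j = 0" if "length ms = l" for ms
        using False that diag[of i ms] T by (auto simp: tensor_maps_def)
      have 2: "T i ms * S ms j = 0" if "length ms = k" for ms
        using False that diag[of ms j] T by (auto simp: tensor_maps_def)
      have "lmult l S T i j = 0" "lmult k T S i j = 0"
        unfolding lmult_def scaleC_complex_def using 1 2 by (intro sum.neutral; blast)+
      then show ?thesis by simp
    qed (use * in blast)
    then show "(\<Sum>k\<in>I. S i k * T k j) = (\<Sum>k\<in>I. T i k * S k j)"
      by (simp add: lmS[OF T n])
  qed
  then have "blk k l T \<in> C k l" using n by (simp add: B_def)
  moreover have "blk k l T = T" using T by (auto simp: blk_def tensor_maps_def fun_eq_iff)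
  ultimately show ?thesis by simp
qed

end

definition flip :: "'n tensor_map" where
  "flip is js = (if \<exists>i j. is = [i, j] \<and> js = [j, i] then 1 else 0)"

definition cup :: "'n tensor_map" where
  "cup is js = (if \<exists>i. is = [i, i] \<and> js = [] then 1 else 0)"

definition classical_Mor :: "nat \<Rightarrow> nat \<Rightarrow> 'n::finite tensor_map set" where
  "classical_Mor k l = {T \<in> tensor_maps k l. lmult k T (wprod polO_gen) = rmult l (wprod polO_gen) T}"

lemma length_add_2E:
  assumes "length ms = a + (2 + b)"
  obtains x i j y where "ms = x @ [i, j] @ y" "length x = a" "length y = b"
proof -
  have "length (drop a ms) = Suc (Suc b)" using assms by simp
  then obtain i j y where "drop a ms = i # j # y" "length y = b" unfolding length_Suc_conv by blast
  moreover from this(1) have "ms = take a ms @ [i, j] @ y" by (metis append_Cons append_Nil append_take_drop_id)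
  moreover have "length (take a ms) = a" using assms by simp
  ultimately show thesis using that by blast
qed

text \<open>Adjacent transpositions generate all rearrangements. The bound on the length is carried
  along because \<open>commuting n S\<close> provides the swaps only for words of length at most
  \<open>n\<close>.\<close>

lemma adjacent_swap_invariant:
  assumes swap: "\<And>xs a b ys. length xs + 2 + length ys \<le> n \<Longrightarrow> f (xs @ a # b # ys) = f (xs @ b # a # ys)"
    and "mset us = mset vs" "length us \<le> n"
  shows "f us = f vs"
proof -
  have move: "f (p @ a # v1 @ v2) = f (p @ v1 @ a # v2)" if "length p + Suc (length v1 + length v2) \<le> n"
    for p a v1 v2
    using that
  proof (induction v1 arbitrary: p)
    case (Cons b v1)
    have "f (p @ a # b # v1 @ v2) = f (p @ b # a # v1 @ v2)"
      using Cons.prems by (intro swap) simp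
    also have "\<dots> = f ((p @ [b]) @ a # v1 @ v2)" by simp
    also have "\<dots> = f ((p @ [b]) @ v1 @ a # v2)" using Cons.prems by (intro Cons.IH) simp
    finally show ?case by simp
  qed simp
  have "f (p @ us) = f (p @ vs)" if "mset us = mset vs" "length p + length us \<le> n" for p
    using that
  proof (induction us arbitrary: p vs)
    case (Cons a us)
    then have "a \<in> set vs" by (metis list.set_intros(1) set_mset_mset)
    then obtain v1 v2 where vs: "vs = v1 @ a # v2" by (meson split_list)
    then have ms: "mset us = mset (v1 @ v2)" using Cons.prems by simp
    then have "length us = length v1 + length v2" by (metis length_append size_mset)
    have "f (p @ a # us) = f ((p @ [a]) @ us)" by simp
    also have "\<dots> = f ((p @ [a]) @ v1 @ v2)"
      using ms Cons.prems by (intro Cons.IH) simp_all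
    also have "\<dots> = f (p @ a # v1 @ v2)" by simp
    also have "\<dots> = f (p @ v1 @ a # v2)"
      using \<open>length us = _\<close> Cons.prems by (intro move) simp
    finally show ?case by (simp add: vs)
  qed simp
  from this[of "[]"] show ?thesis using assms(2,3) by simp
qed

section \<open>Monomials as words in the variables\<close>

definition mon :: "'g list \<Rightarrow> 'g \<Rightarrow>\<^sub>0 nat" where
  "mon ws = (\<Sum>g\<leftarrow>ws. Poly_Mapping.single g 1)"

lemma mon_simps [simp]: "mon [] = 0" "mon (g # ws) = Poly_Mapping.single g 1 + mon ws"
  by (simp_all add: mon_def)

lemma lookup_mon: "Poly_Mapping.lookup (mon ws) g = count (mset ws) g"
  by (induction ws) (auto simp: lookup_add lookup_single)

lemma mset_mon: "mon us = mon vs \<Longrightarrow> mset us = mset vs"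
  by (rule multiset_eqI) (metis lookup_mon)

lemma ex_mon: "\<exists>ws. mon ws = m"
proof (induction m rule: poly_mapping_induct_single)
  case zero
  show ?case by (intro exI[of _ "[]"]) simp
next
  case (sgl g e)
  have "mon (replicate e g) = Poly_Mapping.single g e"
    by (induction e) (simp_all flip: single_add)
  then show ?case ..
next
  case (add m m')
  then obtain us vs where "mon us = m" "mon vs = m'" by blast
  then have "mon (us @ vs) = m + m'" by (simp add: mon_def)
  then show ?case ..
qed

text \<open>An arbitrary ordering of the factors of a monomial; the choice does not affect functions
  that are invariant under adjacent swaps.\<close>

definition mword :: "('g \<Rightarrow>\<^sub>0 nat) \<Rightarrow> 'g list" where
  "mword m = (SOME ws. mon ws = m)"

lemma mon_mword: "mon (mword m) = m"
  unfolding mword_def by (rule someI_ex[OF ex_mon])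

lemma mset_mword: "mset (mword (mon ws)) = mset ws"
  by (rule mset_mon) (rule mon_mword)

lemma length_mword: "length (mword (mon ws)) = length ws"
  by (metis mset_mword size_mset)

lemma wprod_cvar:
  "length is = length js \<Longrightarrow> wprod (\<lambda>i j. cvar (i, j)) is js = Poly_Mapping.single (mon (zip is js)) 1"
  by (induction "is" js rule: list_induct2) (simp_all add: cvar_def mult_single flip: single_one)

lemma abs_polO_sum: "abs_polO (\<Sum>i\<in>A. f i) = (\<Sum>i\<in>A. abs_polO (f i))"
  by (induction A rule: infinite_finite_induct)
    (simp_all add: zero_polO_def flip: plus_polO.abs_eq)

lemma abs_polO_wprod:
  "abs_polO (wprod (\<lambda>i j. cvar (i, j)) is js) = wprod polO_gen is js"
  by (induction "polO_gen :: 'a \<Rightarrow> 'a \<Rightarrow> 'a polO" "is" js rule: wprod.induct)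
    (simp_all add: polO_gen.abs_eq one_polO_def zero_polO_def flip: times_polO.abs_eq)

text \<open>Flips are needed at every position, whereas cups are needed only in front: the flips
  allow the two letters of a relation to be moved there.\<close>

locale brauer_category = concrete_category C for C :: "nat \<Rightarrow> nat \<Rightarrow> 'n::finite tensor_map set" +
  assumes flips: "tens a a (word_id a) (tens 2 2 flip (word_id b)) \<in> C (a + (2 + b)) (a + (2 + b))"
    and cups: "tens 0 2 cup (word_id b) \<in> C b (2 + b)"
begin

text \<open>Composition with the permutation matrix \<open>?F\<close> on either side merely relabels
  one index, so commutation becomes an equality of two single entries of \<open>S\<close>. This is
  what commutativity of the polynomial variables demands.\<close>

lemma commuting_flip:
  assumes S: "commuting n S" and n: "a + (2 + b) \<le> n"
    and len: "length x = a" "length x' = a" "length y = b" "length y' = b"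
  shows "S (x @ [i, j] @ y) (x' @ [i', j'] @ y') = S (x @ [j, i] @ y) (x' @ [j', i'] @ y')"
proof -
  let ?F = "tens a a (word_id a) (tens 2 2 flip (word_id b))"
  have F: "?F (u @ [p, q] @ v) (u' @ [p', q'] @ v') = (if u = u' \<and> p = q' \<and> q = p' \<and> v = v' then 1 else 0)"
    if "length u = a" "length u' = a" "length v = b" "length v' = b" for u u' v v' p q p' q'
    using that by (simp add: tens_append tens_append[of "[p, q]" 2 "[p', q']" 2, simplified] word_id_def flip_def)
  let ?is = "x @ [i, j] @ y" and ?js = "x' @ [j', i'] @ y'"
  have "lmult (a + (2 + b)) S ?F ?is ?js =
      (\<Sum>ms | length ms = a + (2 + b). if ms = x' @ [i', j'] @ y' then S ?is ms else 0)"
    unfolding lmult_def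
  proof (rule sum.cong[OF refl])
    fix ms assume "ms \<in> {ms :: 'n list. length ms = a + (2 + b)}"
    then obtain u p q v where "ms = u @ [p, q] @ v" "length u = a" "length v = b"
      using length_add_2E by blast
    then show "S ?is ms *\<^sub>C ?F ms ?js = (if ms = x' @ [i', j'] @ y' then S ?is ms else 0)"
      using len by (auto simp: F[simplified])
  qed
  moreover have "lmult (a + (2 + b)) ?F S ?is ?js =
      (\<Sum>ms | length ms = a + (2 + b). if ms = x @ [j, i] @ y then S ms ?js else 0)"
    unfolding lmult_def
  proof (rule sum.cong[OF refl])
    fix ms assume "ms \<in> {ms :: 'n list. length ms = a + (2 + b)}"
    then obtain u p q v where "ms = u @ [p, q] @ v" "length u = a" "length v = b"
      using length_add_2E by blast
    then show "?F ?is ms *\<^sub>C S ms ?js = (if ms = x @ [j, i] @ y then S ms ?js else 0)"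
      using len by (auto simp: F[simplified])
  qed
  moreover have "lmult (a + (2 + b)) S ?F ?is ?js = lmult (a + (2 + b)) ?F S ?is ?js"
    using S n flips[of a b] len unfolding commuting_def by simp
  ultimately show ?thesis using len by simp
qed

text \<open>Commutation with the cup gives the first formula, matching the orthogonality of rows;
  commutation with its adjoint gives the second, matching the orthogonality of columns.\<close>

lemma commuting_cup:
  assumes S: "commuting n S" and n: "2 + b \<le> n" and len: "length y = b" "length y' = b"
  shows "(\<Sum>c\<in>UNIV. S (i # j # y) (c # c # y')) = (if i = j then S y y' else 0)"
    and "(\<Sum>c\<in>UNIV. S (c # c # y) (i # j # y')) = (if i = j then S y y' else 0)"
proof -
  let ?F = "tens 0 2 cup (word_id b) :: 'n tensor_map"
  have F: "?F (p # q # u) v = (if p = q \<and> u = v then 1 else 0)" if "length u = b" for p q u v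
    using that by (auto simp: tens_def cup_def word_id_def)
  have 1: "(\<Sum>ms | length ms = 2 + b. f ms * ?F ms v) = (\<Sum>c\<in>UNIV. f (c # c # v))"
    if "length v = b" for f v
  proof -
    have "(\<Sum>ms | length ms = 2 + b. f ms * ?F ms v) =
        (\<Sum>p\<in>UNIV. \<Sum>q\<in>UNIV. \<Sum>u | length u = b. f (p # q # u) * ?F (p # q # u) v)"
      by (simp add: sum_words_Suc numeral_2_eq_2)
    also have "\<dots> = (\<Sum>p\<in>UNIV. \<Sum>q\<in>UNIV. if q = p then f (p # p # v) else 0)"
    proof (intro sum.cong refl)
      fix p q
      have "(\<Sum>u | length u = b. f (p # q # u) * ?F (p # q # u) v) =
          (\<Sum>u | length u = b. if u = v then (if q = p then f (p # p # v) else 0) else 0)"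
        by (intro sum.cong) (auto simp: F)
      then show "(\<Sum>u | length u = b. f (p # q # u) * ?F (p # q # u) v) = (if q = p then f (p # p # v) else 0)"
        using that by simp
    qed
    finally show ?thesis by simp
  qed
  have 2: "(\<Sum>ms | length ms = b. f ms * ?F (i # j # v) ms) = (if i = j then f v else 0)"
    if "length v = b" for f v
  proof -
    have "(\<Sum>ms | length ms = b. f ms * ?F (i # j # v) ms) =
        (\<Sum>ms | length ms = b. if ms = v then (if i = j then f v else 0) else 0)"
      by (intro sum.cong) (auto simp: F that)
    then show ?thesis using that by simp
  qed
  have cF: "cnj (?F u v) = ?F u v" for u v
    by (simp add: tens_def cup_def word_id_def)
  have "lmult (2 + b) S ?F (i # j # y) y' = lmult b ?F S (i # j # y) y'"
    using S n cups[of b] len unfolding commuting_def by simp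
  then have "(\<Sum>ms | length ms = 2 + b. S (i # j # y) ms * ?F ms y') =
      (\<Sum>ms | length ms = b. S ms y' * ?F (i # j # y) ms)"
    by (simp add: lmult_def mult.commute)
  then show "(\<Sum>c\<in>UNIV. S (i # j # y) (c # c # y')) = (if i = j then S y y' else 0)"
    unfolding 1[OF len(2)] 2[OF len(1)] .
  have "lmult b S (adj ?F) y (i # j # y') = lmult (2 + b) (adj ?F) S y (i # j # y')"
    using S n adj[OF cups[of b]] len unfolding commuting_def by simp
  then have "(\<Sum>ms | length ms = b. S y ms * ?F (i # j # y') ms) =
      (\<Sum>ms | length ms = 2 + b. S ms (i # j # y') * ?F ms y)"
    by (simp add: lmult_def adj_def cF mult.commute)
  then show "(\<Sum>c\<in>UNIV. S (c # c # y) (i # j # y')) = (if i = j then S y y' else 0)"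
    unfolding 1[OF len(1)] 2[OF len(2)] ..
qed

text \<open>If \<open>S\<close> commutes with the category up to degree \<open>n\<close>, then \<open>u\<^bsub>is,js\<^esub> \<mapsto> S is js\<close> is a well-defined functional
  on commutative polynomials of degree at most \<open>n\<close> and kills the orthogonality relations.  As the degree
  needed to witness membership in the ideal is not bounded a priori, \<open>n\<close> is chosen last.\<close>

definition functional :: "'n tensor_map \<Rightarrow> ('n \<times> 'n) cpoly \<Rightarrow> complex" where
  "functional S = lin_ext (\<lambda>m. S (map fst (mword m)) (map snd (mword m)))"

text \<open>Independence of the ordering chosen by \<open>mword\<close>, in degrees up to
  \<open>n\<close>.\<close>

lemma functional_single:
  assumes "commuting n S" "length ws \<le> n"
  shows "functional S (Poly_Mapping.single (mon ws) c) = c * S (map fst ws) (map snd ws)"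
proof -
  let ?f = "\<lambda>ws. S (map fst ws) (map snd ws)"
  have "?f (mword (mon ws)) = ?f ws"
  proof (rule adjacent_swap_invariant[of n])
    fix xs ys :: "('n \<times> 'n) list" and a b :: "'n \<times> 'n"
    assume "length xs + 2 + length ys \<le> n"
    then show "?f (xs @ a # b # ys) = ?f (xs @ b # a # ys)"
      using commuting_flip[OF assms(1), of "length xs" "length ys" "map fst xs" "map snd xs" "map fst ys" "map snd ys"]
      by simp
  qed (simp_all add: mset_mword length_mword assms)
  then show ?thesis by (simp add: functional_def)
qed

text \<open>The two variables of the relation can be written in front of the monomial, where
  \<open>commuting_cup\<close> applies. They raise the degree by two, hence the bound on
  \<open>length ws + 2\<close>.\<close>

lemma functional_relation:
  assumes S: "commuting n S" and n: "length ws + 2 \<le> n" and r: "r \<in> orthogonality_relations"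
  shows "functional S (Poly_Mapping.single (mon ws) c * r) = 0"
proof -
  have cv: "Poly_Mapping.single (mon ws) c * (cvar g * cvar h) = Poly_Mapping.single (mon (g # h # ws)) c"
    for g h :: "'n \<times> 'n"
    by (simp add: cvar_def mult_single add_ac)
  have fs: "functional S (Poly_Mapping.single (mon ws) c * ((\<Sum>k\<in>UNIV. cvar (g k) * cvar (h k)) - (if P then 1 else 0))) =
      c * ((\<Sum>k\<in>UNIV. S (fst (g k) # fst (h k) # map fst ws) (snd (g k) # snd (h k) # map snd ws)) -
        (if P then S (map fst ws) (map snd ws) else 0))" for g h :: "'n \<Rightarrow> 'n \<times> 'n" and P
  proof -
    have "functional S (Poly_Mapping.single (mon ws) c * ((\<Sum>k\<in>UNIV. cvar (g k) * cvar (h k)) - (if P then 1 else 0))) =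
        (\<Sum>k\<in>UNIV. functional S (Poly_Mapping.single (mon (g k # h k # ws)) c)) -
          (if P then functional S (Poly_Mapping.single (mon ws) c) else 0)"
      unfolding right_diff_distrib sum_distrib_left cv
      by (simp add: functional_def lin_ext_diff lin_ext_sum del: mon_simps)
    then show ?thesis
      using n by (simp add: functional_single[OF S] right_diff_distrib sum_distrib_left del: mon_simps)
  qed
  have "2 + length ws \<le> n" using n by simp
  note cup = commuting_cup[OF S this, of "map fst ws" "map snd ws", simplified]
  from r show ?thesis
    unfolding orthogonality_relations_def
    by (elim UnE CollectE exE conjE; simp only: fs fst_conv snd_conv cup) simp_all
qed

text \<open>The bound \<open>d\<close> comes from the degrees of the multipliers in one
  representation of \<open>f\<close> by relations, so it is uniform in \<open>S\<close> and
  \<open>n\<close>.\<close>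

lemma functional_ideal:
  assumes "f \<in> ideal.span orthogonality_relations"
  shows "\<exists>d. \<forall>n S. d \<le> n \<longrightarrow> commuting n S \<longrightarrow> functional S f = 0"
  using assms
proof (induction rule: ideal.span_induct_alt)
  case base
  show ?case by (simp add: functional_def)
next
  case (step c x y)
  from step.IH obtain d where d: "\<And>n S. d \<le> n \<Longrightarrow> commuting n S \<Longrightarrow> functional S y = 0" by blast
  define d' where "d' = Max (insert d ((\<lambda>m. length (mword m) + 2) ` Poly_Mapping.keys c))"
  have dd: "d \<le> d'" "\<And>m. m \<in> Poly_Mapping.keys c \<Longrightarrow> length (mword m) + 2 \<le> d'"
    unfolding d'_def by (auto intro: Max_ge)
  have "functional S (c * x + y) = 0" if n: "d' \<le> n" and S: "commuting n S" for n S
  proof -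
    have "c * x = (\<Sum>m\<in>Poly_Mapping.keys c. Poly_Mapping.single (mon (mword m)) (Poly_Mapping.lookup c m) * x)"
      unfolding mon_mword by (subst poly_mapping_eq_sum) (simp add: sum_distrib_right)
    then have "functional S (c * x) = (\<Sum>m\<in>Poly_Mapping.keys c.
        functional S (Poly_Mapping.single (mon (mword m)) (Poly_Mapping.lookup c m) * x))"
      by (simp add: functional_def lin_ext_sum)
    also have "\<dots> = 0"
      using dd(2) n step.hyps by (intro sum.neutral ballI functional_relation[OF S]) (auto intro: order_trans)
    finally show ?thesis
      using d[of n S] S dd(1) n by (simp add: functional_def lin_ext_add)
  qed
  then show ?case by blast
qed

text \<open>Intertwining means that certain polynomials \<open>g is js\<close> lie in the ideal. The
  functional of a commuting \<open>S\<close> annihilates them, and the resulting equations say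
  precisely that \<open>S\<close> commutes with \<open>T\<close>.\<close>

theorem classical_Mor_subset: "classical_Mor k l \<subseteq> C k l"
proof
  fix T :: "'n tensor_map" assume "T \<in> classical_Mor k l"
  then have T: "T \<in> tensor_maps k l"
    and eq: "\<And>is js. lmult k T (wprod polO_gen) is js = rmult l (wprod polO_gen) T is js"
    by (simp_all add: classical_Mor_def)
  let ?x = "wprod (\<lambda>i j. cvar (i, j)) :: 'n list \<Rightarrow> 'n list \<Rightarrow> ('n \<times> 'n) cpoly"
  define g where "g is js = lmult k T ?x is js - rmult l ?x T is js" for "is" js
  have "abs_polO (g is js) = 0" for "is" js
    using eq[of "is" js] by (simp add: g_def lmult_def rmult_def abs_polO_sum abs_polO_wprod
        flip: minus_polO.abs_eq scaleC_polO.abs_eq)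
  then have "polO_eq (g is js) 0" for "is" js
    by (simp add: zero_polO_def polO.abs_eq_iff)
  then have "g is js \<in> ideal.span orthogonality_relations" for "is" js
    by (simp add: polO_eq_def)
  then have "\<exists>d. \<forall>n S. d \<le> n \<longrightarrow> commuting n S \<longrightarrow> functional S (g is js) = 0" for "is" js
    by (rule functional_ideal)
  then obtain d where d: "\<And>is js n S. d is js \<le> n \<Longrightarrow> commuting n S \<Longrightarrow> functional S (g is js) = 0"
    by metis
  define D where "D = (\<lambda>(is, js). d is js) ` ({ms. length ms = l} \<times> {ms. length ms = k})"
  \<comment> \<open>Only finitely many entries of \<open>T\<close> matter, so one \<open>n\<close>
    exceeds all of their bounds as well as the degrees \<open>k\<close> and
    \<open>l\<close>.\<close>
  define n where "n = Max (insert k (insert l D))"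
  have "finite (insert k (insert l D))" unfolding D_def by simp
  then have n: "k \<le> n" "l \<le> n" "\<And>e. e \<in> D \<Longrightarrow> e \<le> n"
    unfolding n_def by (simp_all only: Max_ge insertI1 insertI2)
  show "T \<in> C k l"
  proof (rule mem_if_commutes[OF T n(1,2)])
    fix S and "is" js :: "'n list"
    assume S: "commuting n S" and len: "length is = l" "length js = k"
    have "d is js \<in> D" using len unfolding D_def by force
    then have 0: "functional S (g is js) = 0" using d S n(3) by blast
    have fx: "functional S (?x us vs) = S us vs" if "length us = m" "length vs = m" "m \<le> n" for us vs m
      using that functional_single[OF S, of "zip us vs" 1] by (simp add: wprod_cvar)
    have "functional S (lmult k T ?x is js) = lmult k T S is js"
      unfolding lmult_def functional_def lin_ext_sum lin_ext_scaleC
      by (intro sum.cong refl) (simp add: fx[OF _ len(2) n(1), unfolded functional_def])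
    moreover have "functional S (rmult l ?x T is js) = lmult l S T is js"
      unfolding rmult_complex[symmetric] rmult_def functional_def lin_ext_sum lin_ext_scaleC
      by (intro sum.cong refl) (simp add: fx[OF len(1) _ n(2), unfolded functional_def])
    ultimately show "lmult l S T is js = lmult k T S is js"
      using 0 by (simp add: g_def functional_def lin_ext_diff)
  qed
qed

end

section \<open>Tensor powers of the fundamental representation of the twist\<close>

lemmas comult_hom = polO_universal_property[OF orthogonal_entries_comult, folded comult_def]
lemmas torus_hom_simps = polO_universal_property[OF orthogonal_entries_torus, folded torus_hom_def]

lemma comult_wprod:
  assumes "length is = length js"
  shows "comult (wprod polO_gen is js) =
    (\<Sum>ms | length ms = length is. wprod polO_gen is ms \<otimes>\<^sub>t wprod polO_gen ms js)"
  using assms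
proof (induction "is" js rule: list_induct2)
  case Nil
  then show ?case by (simp add: comult_hom flip: one_tensor_def)
next
  case (Cons i "is" j js)
  show ?case
    unfolding length_Cons sum_words_Suc wprod.simps comult_hom Cons.IH sum_product mult_pure_tensor ..
qed

section \<open>Sweedler sums of multilinear expressions\<close>

definition trilinear ::
    "('a::complex_vector \<Rightarrow> 'b::complex_vector \<Rightarrow> 'c::complex_vector \<Rightarrow> 'd::complex_vector) \<Rightarrow> bool" where
  "trilinear f \<longleftrightarrow>
     (\<forall>x x' y z. f (x + x') y z = f x y z + f x' y z) \<and> (\<forall>c x y z. f (c *\<^sub>C x) y z = c *\<^sub>C f x y z) \<and>
     (\<forall>x y y' z. f x (y + y') z = f x y z + f x y' z) \<and> (\<forall>c x y z. f x (c *\<^sub>C y) z = c *\<^sub>C f x y z) \<and>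
     (\<forall>x y z z'. f x y (z + z') = f x y z + f x y z') \<and> (\<forall>c x y z. f x y (c *\<^sub>C z) = c *\<^sub>C f x y z)"

lemma tensor_sum_fun_add:
  "tensor_sum (\<lambda>a b. f a b + g a b) t = tensor_sum f t + tensor_sum g t"
  by (simp add: tensor_sum_def case_prod_beta sum.distrib)

lemma tensor_sum_fun_scaleC:
  "tensor_sum (\<lambda>a b. c *\<^sub>C f a b) t = c *\<^sub>C tensor_sum f t"
  by (simp add: tensor_sum_def case_prod_beta complex_vector.scale_sum_right)

lemma sweedler3_fun_add: "sweedler3 x (\<lambda>a b c. f a b c + g a b c) = sweedler3 x f + sweedler3 x g"
  by (simp add: sweedler3_def sweedler2_def tensor_sum_fun_add)

lemma sweedler3_fun_scaleC: "sweedler3 x (\<lambda>a b c. z *\<^sub>C f a b c) = z *\<^sub>C sweedler3 x f"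
  by (simp add: sweedler3_def sweedler2_def tensor_sum_fun_scaleC)

context
  fixes f :: "'n::finite polO \<Rightarrow> 'n polO \<Rightarrow> 'n polO \<Rightarrow> 'd::complex_vector"
  assumes f: "trilinear f"
begin

private lemma inner: "balanced (f a)"
  using f unfolding trilinear_def balanced_def by metis

private lemma inner_scale: "tensor_sum (f a) (c *\<^sub>C t) = c *\<^sub>C tensor_sum (f a) t"
  using f unfolding trilinear_def by (intro tensor_sum_scaleC inner) metis

private lemma outer: "balanced (\<lambda>a y. sweedler2 y (f a))"
  unfolding balanced_def sweedler2_def
proof (intro conjI allI)
  fix a a' b b' :: "'n polO" and c
  have "f (a + a') = (\<lambda>y z. f a y z + f a' y z)" "f (c *\<^sub>C a) = (\<lambda>y z. c *\<^sub>C f a y z)"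
    using f by (simp_all add: trilinear_def fun_eq_iff)
  then show "tensor_sum (f (a + a')) (comult b) = tensor_sum (f a) (comult b) + tensor_sum (f a') (comult b)"
    and "tensor_sum (f (c *\<^sub>C a)) (comult b) = tensor_sum (f a) (comult (c *\<^sub>C b))"
    by (simp_all add: tensor_sum_fun_add tensor_sum_fun_scaleC comult_hom inner_scale)
  show "tensor_sum (f a) (comult (b + b')) = tensor_sum (f a) (comult b) + tensor_sum (f a) (comult b')"
    by (simp add: comult_hom tensor_sum_add[OF inner])
qed

lemma sweedler3_add: "sweedler3 (x + y) f = sweedler3 x f + sweedler3 y f"
  unfolding sweedler3_def sweedler2_def[of "x + y"] sweedler2_def[of x] sweedler2_def[of y]
  by (simp add: comult_hom tensor_sum_add[OF outer])

lemma sweedler3_scaleC: "sweedler3 (c *\<^sub>C x) f = c *\<^sub>C sweedler3 x f"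
proof -
  have "sweedler2 y (f (c *\<^sub>C a)) = c *\<^sub>C sweedler2 y (f a)" for c a y
  proof -
    have "f (c *\<^sub>C a) = (\<lambda>y z. c *\<^sub>C f a y z)"
      using f by (simp add: trilinear_def fun_eq_iff)
    then show ?thesis by (simp add: sweedler2_def tensor_sum_fun_scaleC)
  qed
  then show ?thesis
    unfolding sweedler3_def sweedler2_def[of "c *\<^sub>C x"] sweedler2_def[of x] comult_hom
    by (rule tensor_sum_scaleC[OF outer])
qed

text \<open>A Sweedler sum is defined through a chosen representative of the coproduct; trilinearity
  lets any presentation by pure tensors be used instead.\<close>

lemma sweedler3_eq:
  assumes "comult x = (\<Sum>m\<in>A. a m \<otimes>\<^sub>t b m)" "\<And>m. m \<in> A \<Longrightarrow> comult (b m) = (\<Sum>n\<in>A'. c m n \<otimes>\<^sub>t d m n)"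
  shows "sweedler3 x f = (\<Sum>m\<in>A. \<Sum>n\<in>A'. f (a m) (c m n) (d m n))"
proof -
  have "sweedler3 x f = (\<Sum>m\<in>A. sweedler2 (b m) (f (a m)))"
    unfolding sweedler3_def sweedler2_def[of x] assms(1) tensor_sum_sum[OF outer] tensor_sum_pure[OF outer] ..
  also have "\<dots> = (\<Sum>m\<in>A. \<Sum>n\<in>A'. f (a m) (c m n) (d m n))"
    by (rule sum.cong[OF refl]) (simp add: sweedler2_def assms(2) tensor_sum_sum[OF inner] tensor_sum_pure[OF inner])
  finally show ?thesis .
qed

end

lemma torus_form_linear:
  "torus_form \<beta> (x + x') y = torus_form \<beta> x y + torus_form \<beta> x' y"
  "torus_form \<beta> (c *\<^sub>C x) y = c * torus_form \<beta> x y"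
  "torus_form \<beta> x (y + y') = torus_form \<beta> x y + torus_form \<beta> x y'"
  "torus_form \<beta> x (c *\<^sub>C y) = c * torus_form \<beta> x y"
proof -
  show "torus_form \<beta> x (c *\<^sub>C y) = c * torus_form \<beta> x y"
    unfolding torus_form_def torus_hom_simps lin_ext_scaleC lin_ext_fun_scaleC by simp
qed (simp_all add: torus_form_def torus_hom_simps lin_ext_add lin_ext_scaleC lin_ext_fun_add)

lemma twist_term_linear:
  fixes A :: "'n::finite polO \<Rightarrow> 'n polO \<Rightarrow> complex" and s
    and x2 x2' y2 y2' :: "'n polO"
  defines "A \<equiv> twist_cocycle s" and "B \<equiv> twist_cocycle_inv s"
  shows "(A (x1 + x1') y1 * B x3 y3) *\<^sub>C (x2 * y2) = (A x1 y1 * B x3 y3) *\<^sub>C (x2 * y2) + (A x1' y1 * B x3 y3) *\<^sub>C (x2 * y2)"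
    "(A x1 (y1 + y1') * B x3 y3) *\<^sub>C (x2 * y2) = (A x1 y1 * B x3 y3) *\<^sub>C (x2 * y2) + (A x1 y1' * B x3 y3) *\<^sub>C (x2 * y2)"
    "(A x1 y1 * B x3 y3) *\<^sub>C ((x2 + x2') * y2) = (A x1 y1 * B x3 y3) *\<^sub>C (x2 * y2) + (A x1 y1 * B x3 y3) *\<^sub>C (x2' * y2)"
    "(A x1 y1 * B x3 y3) *\<^sub>C (x2 * (y2 + y2')) = (A x1 y1 * B x3 y3) *\<^sub>C (x2 * y2) + (A x1 y1 * B x3 y3) *\<^sub>C (x2 * y2')"
    "(A x1 y1 * B (x3 + x3') y3) *\<^sub>C (x2 * y2) = (A x1 y1 * B x3 y3) *\<^sub>C (x2 * y2) + (A x1 y1 * B x3' y3) *\<^sub>C (x2 * y2)"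
    "(A x1 y1 * B x3 (y3 + y3')) *\<^sub>C (x2 * y2) = (A x1 y1 * B x3 y3) *\<^sub>C (x2 * y2) + (A x1 y1 * B x3 y3') *\<^sub>C (x2 * y2)"
    "(A (c *\<^sub>C x1) y1 * B x3 y3) *\<^sub>C (x2 * y2) = c *\<^sub>C (A x1 y1 * B x3 y3) *\<^sub>C (x2 * y2)"
    "(A x1 (c *\<^sub>C y1) * B x3 y3) *\<^sub>C (x2 * y2) = c *\<^sub>C (A x1 y1 * B x3 y3) *\<^sub>C (x2 * y2)"
    "(A x1 y1 * B x3 y3) *\<^sub>C ((c *\<^sub>C x2) * y2) = c *\<^sub>C (A x1 y1 * B x3 y3) *\<^sub>C (x2 * y2)"
    "(A x1 y1 * B x3 y3) *\<^sub>C (x2 * (c *\<^sub>C y2)) = c *\<^sub>C (A x1 y1 * B x3 y3) *\<^sub>C (x2 * y2)"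
    "(A x1 y1 * B (c *\<^sub>C x3) y3) *\<^sub>C (x2 * y2) = c *\<^sub>C (A x1 y1 * B x3 y3) *\<^sub>C (x2 * y2)"
    "(A x1 y1 * B x3 (c *\<^sub>C y3)) *\<^sub>C (x2 * y2) = c *\<^sub>C (A x1 y1 * B x3 y3) *\<^sub>C (x2 * y2)"
proof -
  have lin: "A (x + x') y = A x y + A x' y" "A (c *\<^sub>C x) y = c * A x y" "A x (y + y') = A x y + A x y'"
    "A x (c *\<^sub>C y) = c * A x y" "B (x + x') y = B x y + B x' y" "B (c *\<^sub>C x) y = c * B x y"
    "B x (y + y') = B x y + B x y'" "B x (c *\<^sub>C y) = c * B x y" for x x' y y' c
    unfolding A_def B_def twist_cocycle_def twist_cocycle_inv_def by (rule torus_form_linear)+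
  note simps = lin distrib_left distrib_right scaleC_add_left scaleC_add_right mult_scaleC_left
    mult_scaleC_right scaleC_scaleC
  show "(A (x1 + x1') y1 * B x3 y3) *\<^sub>C (x2 * y2) = (A x1 y1 * B x3 y3) *\<^sub>C (x2 * y2) + (A x1' y1 * B x3 y3) *\<^sub>C (x2 * y2)"
    by (simp only: simps)
  show "(A x1 (y1 + y1') * B x3 y3) *\<^sub>C (x2 * y2) = (A x1 y1 * B x3 y3) *\<^sub>C (x2 * y2) + (A x1 y1' * B x3 y3) *\<^sub>C (x2 * y2)"
    by (simp only: simps)
  show "(A x1 y1 * B x3 y3) *\<^sub>C ((x2 + x2') * y2) = (A x1 y1 * B x3 y3) *\<^sub>C (x2 * y2) + (A x1 y1 * B x3 y3) *\<^sub>C (x2' * y2)"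
    by (simp only: simps)
  show "(A x1 y1 * B x3 y3) *\<^sub>C (x2 * (y2 + y2')) = (A x1 y1 * B x3 y3) *\<^sub>C (x2 * y2) + (A x1 y1 * B x3 y3) *\<^sub>C (x2 * y2')"
    by (simp only: simps)
  show "(A x1 y1 * B (x3 + x3') y3) *\<^sub>C (x2 * y2) = (A x1 y1 * B x3 y3) *\<^sub>C (x2 * y2) + (A x1 y1 * B x3' y3) *\<^sub>C (x2 * y2)"
    by (simp only: simps)
  show "(A x1 y1 * B x3 (y3 + y3')) *\<^sub>C (x2 * y2) = (A x1 y1 * B x3 y3) *\<^sub>C (x2 * y2) + (A x1 y1 * B x3 y3') *\<^sub>C (x2 * y2)"
    by (simp only: simps)
  show "(A (c *\<^sub>C x1) y1 * B x3 y3) *\<^sub>C (x2 * y2) = c *\<^sub>C (A x1 y1 * B x3 y3) *\<^sub>C (x2 * y2)"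
    by (simp only: simps mult_ac)
  show "(A x1 (c *\<^sub>C y1) * B x3 y3) *\<^sub>C (x2 * y2) = c *\<^sub>C (A x1 y1 * B x3 y3) *\<^sub>C (x2 * y2)"
    by (simp only: simps mult_ac)
  show "(A x1 y1 * B x3 y3) *\<^sub>C ((c *\<^sub>C x2) * y2) = c *\<^sub>C (A x1 y1 * B x3 y3) *\<^sub>C (x2 * y2)"
    by (simp only: simps mult_ac)
  show "(A x1 y1 * B x3 y3) *\<^sub>C (x2 * (c *\<^sub>C y2)) = c *\<^sub>C (A x1 y1 * B x3 y3) *\<^sub>C (x2 * y2)"
    by (simp only: simps mult_ac)
  show "(A x1 y1 * B (c *\<^sub>C x3) y3) *\<^sub>C (x2 * y2) = c *\<^sub>C (A x1 y1 * B x3 y3) *\<^sub>C (x2 * y2)"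
    by (simp only: simps mult_ac)
  show "(A x1 y1 * B x3 (c *\<^sub>C y3)) *\<^sub>C (x2 * y2) = c *\<^sub>C (A x1 y1 * B x3 y3) *\<^sub>C (x2 * y2)"
    by (simp only: simps mult_ac)
qed

lemma trilinear_twist:
  fixes s :: "'n::finite \<Rightarrow> 'n \<Rightarrow> complex" and x2 :: "'n polO"
  shows "trilinear (\<lambda>y1 y2 y3. (twist_cocycle s x1 y1 * twist_cocycle_inv s x3 y3) *\<^sub>C (x2 * y2))"
  unfolding trilinear_def twist_term_linear by simp

lemma trilinear_twist_outer:
  fixes s :: "'n::finite \<Rightarrow> 'n \<Rightarrow> complex"
  shows "trilinear (\<lambda>x1 (x2 :: 'n polO) x3. sweedler3 y (\<lambda>y1 y2 y3. (twist_cocycle s x1 y1 * twist_cocycle_inv s x3 y3) *\<^sub>C (x2 * y2)))"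
  unfolding trilinear_def twist_term_linear sweedler3_fun_add sweedler3_fun_scaleC by simp

lemma twisted_mult_linear:
  "twisted_mult s (x + x') y = twisted_mult s x y + twisted_mult s x' y"
  "twisted_mult s (c *\<^sub>C x) y = c *\<^sub>C twisted_mult s x y"
  "twisted_mult s x (y + y') = twisted_mult s x y + twisted_mult s x y'"
  "twisted_mult s x (c *\<^sub>C y) = c *\<^sub>C twisted_mult s x y"
  unfolding twisted_mult_def
  unfolding sweedler3_add[OF trilinear_twist] sweedler3_scaleC[OF trilinear_twist]
    sweedler3_add[OF trilinear_twist_outer] sweedler3_scaleC[OF trilinear_twist_outer]
    sweedler3_fun_add sweedler3_fun_scaleC
  by (rule refl)+

lemma twisted_mult_sum:
  "twisted_mult s (\<Sum>i\<in>A. f i) y = (\<Sum>i\<in>A. twisted_mult s (f i) y)"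
  "twisted_mult s x (\<Sum>i\<in>A. f i) = (\<Sum>i\<in>A. twisted_mult s x (f i))"
proof -
  have 0: "twisted_mult s 0 y = 0" "twisted_mult s x 0 = 0" for x y
    using twisted_mult_linear(2)[of s 0 0 y] twisted_mult_linear(4)[of s x 0 0] by simp_all
  show "twisted_mult s (\<Sum>i\<in>A. f i) y = (\<Sum>i\<in>A. twisted_mult s (f i) y)"
    "twisted_mult s x (\<Sum>i\<in>A. f i) = (\<Sum>i\<in>A. twisted_mult s x (f i))"
    by (induction A rule: infinite_finite_induct) (simp_all add: 0 twisted_mult_linear)
qed

section \<open>Signs of the cocycle on words\<close>

locale sign_matrix =
  fixes s :: "'n::finite \<Rightarrow> 'n \<Rightarrow> complex"
  assumes sign: "s i j \<in> {1, -1}"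
begin

fun row_sign :: "'n \<Rightarrow> 'n list \<Rightarrow> complex" where
  "row_sign i [] = 1"
| "row_sign i (j # js) = s i j * row_sign i js"

text \<open>The bicharacter evaluated at the products of the group generators named by the two
  words; \<open>row_sign\<close> is the case of a single first letter.\<close>

fun pair_sign :: "'n list \<Rightarrow> 'n list \<Rightarrow> complex" where
  "pair_sign [] js = 1"
| "pair_sign (i # is) js = row_sign i js * pair_sign is js"

text \<open>The diagonal sign matrix \<open>D\<close> of the overview: the product of
  \<open>s\<close> over all pairs of positions in increasing order, accumulated when generators are
  multiplied bracketed to the right, as in \<open>qg_fund_power\<close>.\<close>

fun word_sign :: "'n list \<Rightarrow> complex" where
  "word_sign [] = 1"
| "word_sign (i # is) = row_sign i is * word_sign is"

lemma sign_square: "s i j * s i j = 1"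
  using sign[of i j] by auto

lemma row_sign_square: "row_sign i js * row_sign i js = 1"
proof (induction js)
  case (Cons j js)
  have "row_sign i (j # js) * row_sign i (j # js) = (s i j * s i j) * (row_sign i js * row_sign i js)"
    by (simp only: row_sign.simps mult_ac)
  then show ?case unfolding sign_square Cons.IH by simp
qed simp

lemma pair_sign_square: "pair_sign is js * pair_sign is js = 1"
proof (induction "is")
  case (Cons i "is")
  have "pair_sign (i # is) js * pair_sign (i # is) js =
      (row_sign i js * row_sign i js) * (pair_sign is js * pair_sign is js)"
    by (simp only: pair_sign.simps mult_ac)
  then show ?case unfolding row_sign_square Cons.IH by simp
qed simp

lemma row_sign_append: "row_sign i (js @ js') = row_sign i js * row_sign i js'"
  by (induction js) (simp_all only: append.simps row_sign.simps mult_1 mult.assoc)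

lemma pair_sign_append:
  "pair_sign (is @ is') js = pair_sign is js * pair_sign is' js"
  "pair_sign is (js @ js') = pair_sign is js * pair_sign is js'"
proof -
  show "pair_sign (is @ is') js = pair_sign is js * pair_sign is' js"
    by (induction "is") (simp_all only: append.simps pair_sign.simps mult_1 mult.assoc)
  show "pair_sign is (js @ js') = pair_sign is js * pair_sign is js'"
  proof (induction "is")
    case (Cons i "is")
    show ?case
      unfolding pair_sign.simps Cons.IH row_sign_append by (simp only: mult_ac)
  qed simp
qed

text \<open>On words the bicharacter is the coboundary of \<open>word_sign\<close>. This is the
  source of the signs that obstruct compatibility with tensor products.\<close>

lemma word_sign_append: "word_sign (is @ js) = word_sign is * word_sign js * pair_sign is js"
proof (induction "is")
  case (Cons i "is")
  show ?case
    unfolding append_Cons word_sign.simps Cons.IH row_sign_append pair_sign.simps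
    by (simp only: mult_ac)
qed simp

lemma word_sign_square: "word_sign is * word_sign is = 1"
proof (induction "is")
  case (Cons i "is")
  have "word_sign (i # is) * word_sign (i # is) = (row_sign i is * row_sign i is) * (word_sign is * word_sign is)"
    by (simp only: word_sign.simps mult_ac)
  then show ?case unfolding row_sign_square Cons.IH by simp
qed simp

lemma torus_hom_wprod:
  assumes "length is = length js"
  shows "torus_hom (wprod polO_gen is js) =
    (if is = js then Poly_Mapping.single (\<Sum>i\<leftarrow>is. axis i 1) 1 else 0)"
  using assms
  by (induction "is" js rule: list_induct2) (auto simp: torus_hom_simps mult_single simp flip: single_one)

lemma bicharacter_words: "bicharacter_of s (axis i 1) (\<Sum>j\<leftarrow>js. axis j 1) = row_sign i js"
proof -
  note b = bicharacter_of[of s, OF sign]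
  have add: "bicharacter_of s g (h + h') = bicharacter_of s g h * bicharacter_of s g h'"
    and nz: "bicharacter_of s g h \<noteq> 0" for g h h'
    using b(1) unfolding bicharacter_def by blast+
  have "bicharacter_of s g 0 = 1" for g
    using add[of g 0 0] nz[of g 0] by simp
  then show ?thesis
    by (induction js) (simp_all add: add b(2))
qed

text \<open>The cocycle factors through the diagonal subgroup, where off-diagonal generators vanish.
  Its values on words are signs, so the inverse cocycle takes the same values.\<close>

lemma twist_cocycle_words:
  assumes "length is = length js"
  shows "twist_cocycle s (polO_gen i j) (wprod polO_gen is js) =
      (if i = j \<and> is = js then row_sign i is else 0)"
    and "twist_cocycle_inv s (polO_gen i j) (wprod polO_gen is js) =
      (if i = j \<and> is = js then row_sign i is else 0)"
proof -
  show "twist_cocycle s (polO_gen i j) (wprod polO_gen is js) =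
      (if i = j \<and> is = js then row_sign i is else 0)"
    using assms by (simp add: twist_cocycle_def torus_form_def torus_hom_simps torus_hom_wprod bicharacter_words)
  have "inverse (row_sign i js) = row_sign i js" for i js
    using row_sign_square by (rule inverse_unique)
  then show "twist_cocycle_inv s (polO_gen i j) (wprod polO_gen is js) =
      (if i = j \<and> is = js then row_sign i is else 0)"
    using assms by (simp add: twist_cocycle_inv_def torus_form_def torus_hom_simps torus_hom_wprod bicharacter_words)
qed

text \<open>In the double Sweedler sum the cocycle on the first legs pins the row indices of the
  middle legs to \<open>i # is\<close>, and the inverse cocycle on the third legs pins their column
  indices to \<open>j # js\<close>. A single term survives.\<close>

lemma twisted_mult_words:
  assumes "length is = length js"
  shows "twisted_mult s (polO_gen i j) (wprod polO_gen is js) =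
    (row_sign i is * row_sign j js) *\<^sub>C wprod polO_gen (i # is) (j # js)"
proof -
  let ?u = "wprod polO_gen :: 'n list \<Rightarrow> 'n list \<Rightarrow> 'n polO"
  let ?g = "polO_gen :: 'n \<Rightarrow> 'n \<Rightarrow> 'n polO"
  let ?W = "{ms :: 'n list. length ms = length is}"
  have 1: "sweedler3 (?u is js) f = (\<Sum>ms\<in>?W. \<Sum>ns\<in>?W. f (?u is ms) (?u ms ns) (?u ns js))"
    if "trilinear f" for f :: "'n polO \<Rightarrow> 'n polO \<Rightarrow> 'n polO \<Rightarrow> 'n polO"
  proof (rule sweedler3_eq[OF that])
    show "comult (?u ms js) = (\<Sum>ns\<in>?W. ?u ms ns \<otimes>\<^sub>t ?u ns js)" if "ms \<in> ?W" for ms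
      using that assms comult_wprod[of ms js] by simp
  qed (rule comult_wprod[OF assms])
  have 2: "sweedler3 (?g i j) f = (\<Sum>a\<in>UNIV. \<Sum>b\<in>UNIV. f (?g i a) (?g a b) (?g b j))"
    if "trilinear f" for f :: "'n polO \<Rightarrow> 'n polO \<Rightarrow> 'n polO \<Rightarrow> 'n polO"
    by (rule sweedler3_eq[OF that]) (rule comult_hom)+
  have "(twist_cocycle s (?g i a) (?u is ms) * twist_cocycle_inv s (?g b j) (?u ns js)) *\<^sub>C (?g a b * ?u ms ns) =
      (if ms = is then if ns = js then if a = i then if b = j then
        (row_sign i is * row_sign j js) *\<^sub>C (?g i j * ?u is js) else 0 else 0 else 0 else 0)"
    if "ms \<in> ?W" "ns \<in> ?W" for a b ms ns
    using that assms by (auto simp: twist_cocycle_words)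
  then have "twisted_mult s (?g i j) (?u is js) =
      (\<Sum>a\<in>UNIV. \<Sum>b\<in>UNIV. \<Sum>ms\<in>?W. \<Sum>ns\<in>?W.
        (if ms = is then if ns = js then if a = i then if b = j then
        (row_sign i is * row_sign j js) *\<^sub>C (?g i j * ?u is js) else 0 else 0 else 0 else 0))"
    unfolding twisted_mult_def 2[OF trilinear_twist_outer] unfolding 1[OF trilinear_twist]
    by (intro sum.cong refl) blast
  also have "\<dots> = (\<Sum>a\<in>UNIV. \<Sum>b\<in>UNIV. \<Sum>ms\<in>?W. if ms = is then if a = i then if b = j then
        (row_sign i is * row_sign j js) *\<^sub>C (?g i j * ?u is js) else 0 else 0 else 0)"
    using assms by (intro sum.cong refl) simp
  also have "\<dots> = (\<Sum>a\<in>UNIV. \<Sum>b\<in>UNIV. if b = j then if a = i then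
        (row_sign i is * row_sign j js) *\<^sub>C (?g i j * ?u is js) else 0 else 0)"
    by (intro sum.cong refl) simp
  also have "\<dots> = (row_sign i is * row_sign j js) *\<^sub>C (?g i j * ?u is js)"
    by simp
  finally show ?thesis by simp
qed

text \<open>The matrix \<open>W\<close> of the overview, for all word lengths at once.\<close>

definition twist_matrix :: "('n \<Rightarrow> 'n \<Rightarrow> complex) \<Rightarrow> 'n tensor_map" where
  "twist_matrix U is js = word_sign is * wprod U is js"

text \<open>Prepending a letter multiplies by one row sign for the row word and one for the column
  word (\<open>twisted_mult_words\<close>), which are exactly the increments of
  \<open>word_sign\<close> in the two copies of \<open>twist_matrix\<close>.\<close>

lemma qg_fund_power_conj:
  assumes "length is = length js"
  shows "qg_fund_power (qg_conj U (twisted_O s)) is js =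
    lmult (length is) (\<lambda>is ms. twist_matrix (\<lambda>i j. complex_of_real (U $ i $ j)) ms is)
      (rmult (length is) (wprod polO_gen) (twist_matrix (\<lambda>i j. complex_of_real (U $ i $ j)))) is js"
  using assms
proof (induction "is" js rule: list_induct2)
  case Nil
  show ?case by (simp add: qg_fund_power_def qg_conj_def twisted_O_def lmult_def rmult_def twist_matrix_def scaleC_one)
next
  case (Cons i "is" j js)
  let ?U = "\<lambda>i j. complex_of_real (U $ i $ j)"
  let ?W = "{ms :: 'n list. length ms = length is}"
  have "qg_fund_power (qg_conj U (twisted_O s)) (i # is) (j # js) =
      twisted_mult s (\<Sum>k\<in>UNIV. \<Sum>l\<in>UNIV. (?U k i * ?U l j) *\<^sub>C polO_gen k l)
        (qg_fund_power (qg_conj U (twisted_O s)) is js)"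
    by (simp add: qg_fund_power_def qg_conj_def twisted_O_def transpose_def)
  also have "\<dots> = (\<Sum>k\<in>UNIV. \<Sum>l\<in>UNIV. \<Sum>ms\<in>?W. \<Sum>ns\<in>?W.
      ((?U k i * ?U l j) * (twist_matrix ?U ms is * twist_matrix ?U ns js)) *\<^sub>C
        twisted_mult s (polO_gen k l) (wprod polO_gen ms ns))"
    unfolding Cons.IH lmult_def rmult_def twisted_mult_sum(1) twisted_mult_linear(2)
    unfolding twisted_mult_sum(2) twisted_mult_linear(4) complex_vector.scale_sum_right scaleC_scaleC
    by (simp only: mult_ac)
  also have "\<dots> = (\<Sum>k\<in>UNIV. \<Sum>l\<in>UNIV. \<Sum>ms\<in>?W. \<Sum>ns\<in>?W.
      (twist_matrix ?U (k # ms) (i # is) * twist_matrix ?U (l # ns) (j # js)) *\<^sub>C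
        wprod polO_gen (k # ms) (l # ns))"
  proof (intro sum.cong refl)
    fix k l ms ns assume "ms \<in> ?W" "ns \<in> ?W"
    then have "length ms = length ns" by simp
    from twisted_mult_words[OF this]
    show "((?U k i * ?U l j) * (twist_matrix ?U ms is * twist_matrix ?U ns js)) *\<^sub>C
        twisted_mult s (polO_gen k l) (wprod polO_gen ms ns) =
      (twist_matrix ?U (k # ms) (i # is) * twist_matrix ?U (l # ns) (j # js)) *\<^sub>C
        wprod polO_gen (k # ms) (l # ns)"
      unfolding twist_matrix_def word_sign.simps wprod.simps(2)[of ?U]
      by (simp only: scaleC_scaleC mult_ac)
  qed
  also have "\<dots> = (\<Sum>k\<in>UNIV. \<Sum>ms\<in>?W. \<Sum>l\<in>UNIV. \<Sum>ns\<in>?W.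
      (twist_matrix ?U (k # ms) (i # is) * twist_matrix ?U (l # ns) (j # js)) *\<^sub>C
        wprod polO_gen (k # ms) (l # ns))"
    by (rule sum.cong[OF refl], rule sum.swap)
  also have "\<dots> = lmult (length (i # is)) (\<lambda>is ms. twist_matrix ?U ms is)
      (rmult (length (i # is)) (wprod polO_gen) (twist_matrix ?U)) (i # is) (j # js)"
    unfolding lmult_def rmult_def length_Cons sum_words_Suc complex_vector.scale_sum_right scaleC_scaleC ..
  finally show ?case .
qed

end

section \<open>Intertwiners of the classical group\<close>

lemma polO_hom_sum:
  assumes "orthogonal_entries h"
  shows "polO_hom h (\<Sum>i\<in>A. f i) = (\<Sum>i\<in>A. polO_hom h (f i))"
proof -
  have "polO_hom h 0 = 0"
    using polO_universal_property(5)[OF assms, of 0 0] by simp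
  then show ?thesis
    by (induction A rule: infinite_finite_induct) (simp_all add: polO_universal_property[OF assms])
qed

lemma polO_hom_wprod:
  assumes "orthogonal_entries h"
  shows "polO_hom h (wprod polO_gen is js) = wprod h is js"
proof -
  have "polO_hom h 0 = 0"
    using polO_universal_property(5)[OF assms, of 0 0] by simp
  then show ?thesis
  proof (induction "is" arbitrary: js)
    case Nil
    then show ?case by (cases js) (simp_all add: polO_universal_property[OF assms])
  next
    case (Cons i "is")
    then show ?case by (cases js) (simp_all add: polO_universal_property[OF assms])
  qed
qed

text \<open>The universal property specialises the intertwining relation to any orthogonal matrix;
  it is used below at points of the group.\<close>

lemma classical_Mor_hom:
  fixes h :: "'n::finite \<Rightarrow> 'n \<Rightarrow> 'b::complex_comm_algebra"
  assumes "T \<in> classical_Mor k l" "orthogonal_entries h"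
  shows "lmult k T (wprod h) = rmult l (wprod h) T"
proof (intro ext)
  fix "is" js
  have "polO_hom h (lmult k T (wprod polO_gen) is js) = polO_hom h (rmult l (wprod polO_gen) T is js)"
    using assms(1) by (simp add: classical_Mor_def)
  then show "lmult k T (wprod h) is js = rmult l (wprod h) T is js"
    by (simp add: lmult_def rmult_def polO_hom_sum[OF assms(2)] polO_universal_property(5)[OF assms(2)]
        polO_hom_wprod[OF assms(2)])
qed

lemma wprod_diagonal:
  "wprod (\<lambda>i j. if i = j then e i else 0) is js = (if is = js then \<Prod>i\<leftarrow>is. e i else 0)"
proof (induction "is" arbitrary: js)
  case Nil
  then show ?case by (cases js) auto
next
  case (Cons i "is")
  then show ?case by (cases js) auto
qed

text \<open>Evaluates at the diagonal orthogonal matrix with entries \<open>e\<close>.\<close>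

lemma classical_Mor_sign:
  fixes e :: "'n::finite \<Rightarrow> complex"
  assumes T: "T \<in> classical_Mor k l" and e: "\<And>i. e i * e i = 1" and nz: "T is js \<noteq> 0"
  shows "(\<Prod>i\<leftarrow>is. e i) = (\<Prod>j\<leftarrow>js. e j)"
proof -
  let ?h = "\<lambda>i j. if i = j then e i else 0"
  have "(\<Sum>k\<in>UNIV. ?h i k * ?h j k) = (\<Sum>k\<in>UNIV. if k = i then (if i = j then 1 else 0) else 0)"
    "(\<Sum>k\<in>UNIV. ?h k i * ?h k j) = (\<Sum>k\<in>UNIV. if k = i then (if i = j then 1 else 0) else 0)" for i j
    by (intro sum.cong refl; simp add: e)+
  then have h: "orthogonal_entries ?h" by (simp add: orthogonal_entries_def)
  have len: "length is = l" "length js = k"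
    using T nz by (auto simp: classical_Mor_def tensor_maps_def)
  have "lmult k T (wprod ?h) is js = (\<Sum>ms | length ms = k. if ms = js then T is js * (\<Prod>j\<leftarrow>js. e j) else 0)"
    unfolding lmult_def by (intro sum.cong) (auto simp: wprod_diagonal)
  moreover have "rmult l (wprod ?h) T is js = (\<Sum>ms | length ms = l. if ms = is then T is js * (\<Prod>i\<leftarrow>is. e i) else 0)"
    unfolding rmult_def by (intro sum.cong) (auto simp: wprod_diagonal)
  ultimately show ?thesis
    using classical_Mor_hom[OF T h] len nz by simp
qed

section \<open>Closure of the classical intertwiners under the category operations\<close>

lemma classical_Mor_add:
  assumes "S \<in> classical_Mor k l" "T \<in> classical_Mor k l"
  shows "(\<lambda>is js. S is js + T is js) \<in> classical_Mor k l"
proof -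
  have "lmult k (\<lambda>is js. S is js + T is js) X = (\<lambda>is js. lmult k S X is js + lmult k T X is js)"
    "rmult l X (\<lambda>is js. S is js + T is js) = (\<lambda>is js. rmult l X S is js + rmult l X T is js)"
    for X :: "'a list \<Rightarrow> 'a list \<Rightarrow> 'a polO"
    by (simp_all add: lmult_def rmult_def fun_eq_iff scaleC_add_left sum.distrib)
  moreover have "(\<lambda>is js. S is js + T is js) \<in> tensor_maps k l"
    using assms by (auto simp: classical_Mor_def tensor_maps_def) (metis add.right_neutral)+
  ultimately show ?thesis using assms by (simp add: classical_Mor_def)
qed

lemma classical_Mor_scale:
  assumes "T \<in> classical_Mor k l"
  shows "(\<lambda>is js. c * T is js) \<in> classical_Mor k l"
proof -
  have "lmult k (\<lambda>is js. c * T is js) X = (\<lambda>is js. c *\<^sub>C lmult k T X is js)"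
    "rmult l X (\<lambda>is js. c * T is js) = (\<lambda>is js. c *\<^sub>C rmult l X T is js)"
    for X :: "'a list \<Rightarrow> 'a list \<Rightarrow> 'a polO"
    by (simp_all add: lmult_def rmult_def fun_eq_iff complex_vector.scale_sum_right scaleC_scaleC)
  moreover have "(\<lambda>is js. c * T is js) \<in> tensor_maps k l"
    using assms by (auto simp: classical_Mor_def tensor_maps_def)
  ultimately show ?thesis using assms by (simp add: classical_Mor_def)
qed

lemma classical_Mor_zero: "(\<lambda>is js. 0) \<in> classical_Mor k l"
  by (simp add: classical_Mor_def tensor_maps_def lmult_def rmult_def fun_eq_iff)

lemma classical_Mor_comp:
  assumes S: "S \<in> classical_Mor l m" and T: "T \<in> classical_Mor k l"
  shows "lmult l S T \<in> classical_Mor k m"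
proof -
  let ?u = "wprod polO_gen"
  have "lmult k (lmult l S T) ?u = lmult l S (lmult k T ?u)" by (rule lmult_lmult[symmetric])
  also have "\<dots> = rmult l (lmult l S ?u) T" using T by (simp add: classical_Mor_def lmult_rmult)
  also have "\<dots> = rmult m ?u (lmult l S T)" using S by (simp add: classical_Mor_def rmult_rmult)
  finally show ?thesis
    using assms tensor_maps_lmult by (auto simp: classical_Mor_def)
qed

lemma polO_star_simps:
  fixes x y :: "'n::finite polO"
  shows "polO_star (x + y) = polO_star x + polO_star y"
  "polO_star (x * y) = polO_star x * polO_star y"
  "polO_star (c *\<^sub>C x) = cnj c *\<^sub>C polO_star x"
  "polO_star (polO_gen i j :: 'n polO) = polO_gen i j"
  "polO_star (1 :: 'n polO) = 1"
proof -
  have *: "f = g \<Longrightarrow> polO_eq f g" for f g :: "('n \<times> 'n) cpoly"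
    by (simp add: polO_eq_def ideal.span_zero)
  have lk: "Poly_Mapping.lookup (Poly_Mapping.map cnj f) k = cnj (Poly_Mapping.lookup f k)"
    for f :: "('n \<times> 'n) cpoly" and k
    by (simp add: Poly_Mapping.map.rep_eq when_def)
  show "polO_star (x + y) = polO_star x + polO_star y"
    by transfer (rule *, rule map_cnj_add)
  show "polO_star (x * y) = polO_star x * polO_star y"
    by transfer (rule *, rule map_cnj_mult)
  show "polO_star (c *\<^sub>C x) = cnj c *\<^sub>C polO_star x"
    by transfer (rule *, rule poly_mapping_eqI, simp add: lk)
  show "polO_star (polO_gen i j) = polO_gen i j"
    by transfer (rule *, rule poly_mapping_eqI, simp add: lk cvar_def lookup_single when_def)
  show "polO_star 1 = (1 :: 'n polO)"
    by transfer (rule *, rule poly_mapping_eqI, simp add: lk lookup_one when_def)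
qed

lemma polO_star_zero: "polO_star 0 = 0"
  using polO_star_simps(3)[of 0 0] by simp

lemma polO_star_sum: "polO_star (\<Sum>i\<in>A. f i) = (\<Sum>i\<in>A. polO_star (f i))"
  by (induction A rule: infinite_finite_induct) (simp_all add: polO_star_simps polO_star_zero)

lemma polO_star_wprod: "polO_star (wprod polO_gen is js) = wprod polO_gen is js"
proof (induction "is" arbitrary: js)
  case Nil
  then show ?case by (cases js) (simp_all add: polO_star_simps polO_star_zero)
next
  case (Cons i "is")
  then show ?case by (cases js) (simp_all add: polO_star_simps polO_star_zero)
qed

text \<open>Since \<open>u\<close> is orthogonal, \<open>T u\<^sup>k = u\<^sup>l T\<close> transposes to \<open>T\<^sup>t u\<^sup>l = u\<^sup>k T\<^sup>t\<close>; the involution fixes \<open>u\<close>.\<close>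

lemma classical_Mor_adj:
  assumes T: "T \<in> classical_Mor k l"
  shows "adj T \<in> classical_Mor l k"
proof -
  let ?u = "wprod polO_gen :: 'a list \<Rightarrow> 'a list \<Rightarrow> 'a polO"
  have tm: "T \<in> tensor_maps k l" and eq: "\<And>is js. lmult k T ?u is js = rmult l ?u T is js"
    using T by (simp_all add: classical_Mor_def)
  note orth = wprod_orthogonal[OF orthogonal_entries_gen]
  have main: "(\<Sum>a | length a = l. T a is *\<^sub>C ?u a js) = (\<Sum>b | length b = k. T js b *\<^sub>C ?u is b)"
    if len: "length is = k" "length js = l" for "is" js
  proof -
    \<comment> \<open>One expression is evaluated in two ways: orthogonality of rows removes the sum
      over \<open>b\<close>; alternatively, after \<open>eq\<close> replaces \<open>T u\<close> by
      \<open>u T\<close>, orthogonality of columns removes the sum over \<open>a\<close>.\<close>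
    have "(\<Sum>b | length b = k. ?u is b * (\<Sum>a | length a = l. ?u a js * lmult k T ?u a b)) =
        (\<Sum>b | length b = k. \<Sum>a | length a = l. \<Sum>c | length c = k. T a c *\<^sub>C (?u a js * (?u c b * ?u is b)))"
      unfolding lmult_def sum_distrib_left mult_scaleC_right
      by (intro sum.cong refl) (simp only: mult_ac)
    also have "\<dots> = (\<Sum>a | length a = l. \<Sum>c | length c = k. \<Sum>b | length b = k. T a c *\<^sub>C (?u a js * (?u c b * ?u is b)))"
      by (subst sum.swap, rule sum.cong[OF refl], rule sum.swap)
    also have "\<dots> = (\<Sum>a | length a = l. \<Sum>c | length c = k. if c = is then T a is *\<^sub>C ?u a js else 0)"
    proof (intro sum.cong refl)
      fix a c :: "'a list" assume "c \<in> {c. length c = k}"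
      then have "(\<Sum>b | length b = k. ?u c b * ?u is b) = (if c = is then 1 else 0)"
        using orth(1)[of c "is"] len by simp
      then show "(\<Sum>b | length b = k. T a c *\<^sub>C (?u a js * (?u c b * ?u is b))) =
          (if c = is then T a is *\<^sub>C ?u a js else 0)"
        unfolding complex_vector.scale_sum_right[symmetric] sum_distrib_left[symmetric]
        by simp
    qed
    also have "\<dots> = (\<Sum>a | length a = l. T a is *\<^sub>C ?u a js)"
      using len by (intro sum.cong refl) simp
    finally have 1: "(\<Sum>b | length b = k. ?u is b * (\<Sum>a | length a = l. ?u a js * lmult k T ?u a b)) =
        (\<Sum>a | length a = l. T a is *\<^sub>C ?u a js)" .
    have 2: "(\<Sum>a | length a = l. ?u a js * lmult k T ?u a b) = T js b *\<^sub>C 1" for b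
    proof -
      have "(\<Sum>a | length a = l. ?u a js * lmult k T ?u a b) =
          (\<Sum>a | length a = l. \<Sum>d | length d = l. T d b *\<^sub>C (?u a js * ?u a d))"
        unfolding eq rmult_def sum_distrib_left mult_scaleC_right ..
      also have "\<dots> = (\<Sum>d | length d = l. \<Sum>a | length a = l. T d b *\<^sub>C (?u a js * ?u a d))"
        by (rule sum.swap)
      also have "\<dots> = (\<Sum>d | length d = l. if d = js then T js b *\<^sub>C 1 else 0)"
      proof (intro sum.cong refl)
        fix d :: "'a list" assume "d \<in> {d. length d = l}"
        then have "(\<Sum>a | length a = l. ?u a js * ?u a d) = (if js = d then 1 else 0)"
          using orth(2)[of js d] len by simp
        then show "(\<Sum>a | length a = l. T d b *\<^sub>C (?u a js * ?u a d)) = (if d = js then T js b *\<^sub>C 1 else 0)"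
          unfolding complex_vector.scale_sum_right[symmetric] by simp
      qed
      also have "\<dots> = T js b *\<^sub>C 1" using len by simp
      finally show ?thesis .
    qed
    show ?thesis using 1 unfolding 2 by (simp add: mult_scaleC_right)
  qed
  have "lmult l (adj T) ?u is js = rmult k ?u (adj T) is js" for "is" js
  proof (cases "length is = k \<and> length js = l")
    case True
    have "polO_star (\<Sum>a | length a = l. T a is *\<^sub>C ?u a js) = polO_star (\<Sum>b | length b = k. T js b *\<^sub>C ?u is b)"
      using main True by simp
    then show ?thesis
      by (simp add: polO_star_sum polO_star_simps polO_star_wprod lmult_def rmult_def adj_def)
  next
    case False
    have "adj T is a *\<^sub>C ?u a js = 0" if "length a = l" for a
      using False that tm wprod_length[of polO_gen a js] by (auto simp: adj_def tensor_maps_def)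
    moreover have "adj T b js *\<^sub>C ?u is b = 0" if "length b = k" for b
      using False that tm wprod_length[of polO_gen "is" b] by (auto simp: adj_def tensor_maps_def)
    ultimately have "lmult l (adj T) ?u is js = 0" "rmult k ?u (adj T) is js = 0"
      unfolding lmult_def rmult_def by (intro sum.neutral; blast)+
    then show ?thesis by simp
  qed
  then show ?thesis
    using tensor_maps_adj[OF tm] by (simp add: classical_Mor_def fun_eq_iff)
qed

lemma classical_Mor_word_id: "word_id k \<in> classical_Mor k k"
proof -
  let ?u = "wprod polO_gen :: 'a list \<Rightarrow> 'a list \<Rightarrow> 'a polO"
  have "lmult k (word_id k) ?u is js = rmult k ?u (word_id k) is js" for "is" js
  proof -
    have "lmult k (word_id k) ?u is js = (\<Sum>ms | length ms = k. if ms = is then ?u is js else 0)"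
      unfolding lmult_def by (intro sum.cong) (auto simp: word_id_def scaleC_one)
    moreover have "rmult k ?u (word_id k) is js = (\<Sum>ms | length ms = k. if ms = js then ?u is js else 0)"
      unfolding rmult_def by (intro sum.cong) (auto simp: word_id_def scaleC_one)
    moreover have "?u is js = 0 \<or> length is = length js" using wprod_length by blast
    ultimately show ?thesis by auto
  qed
  then show ?thesis by (simp add: classical_Mor_def tensor_maps_word_id fun_eq_iff)
qed

lemma classical_Mor_tens:
  assumes S: "S \<in> classical_Mor k l" and T: "T \<in> classical_Mor k' l'"
  shows "tens k l S T \<in> classical_Mor (k + k') (l + l')"
proof -
  let ?u = "wprod polO_gen :: 'a list \<Rightarrow> 'a list \<Rightarrow> 'a polO"
  have tm: "tens k l S T \<in> tensor_maps (k + k') (l + l')"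
    using S T by (auto simp: classical_Mor_def intro: tensor_maps_tens)
  have "lmult (k + k') (tens k l S T) ?u is js = rmult (l + l') ?u (tens k l S T) is js" for "is" js
  proof (cases "length is = l + l' \<and> length js = k + k'")
    case True
    define i1 i2 j1 j2 where "i1 = take l is" "i2 = drop l is" "j1 = take k js" "j2 = drop k js"
    have split: "is = i1 @ i2" "js = j1 @ j2" "length i1 = l" "length i2 = l'" "length j1 = k" "length j2 = k'"
      using True by (simp_all add: i1_i2_j1_j2_def)
    have "lmult (k + k') (tens k l S T) ?u is js = lmult k S ?u i1 j1 * lmult k' T ?u i2 j2"
      unfolding lmult_def sum_words_append sum_product split(1,2)
      by (intro sum.cong refl)
        (simp add: tens_append split wprod_append mult_scaleC_left mult_scaleC_right scaleC_scaleC mult.commute)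
    also have "\<dots> = rmult l ?u S i1 j1 * rmult l' ?u T i2 j2"
      using S T by (simp add: classical_Mor_def)
    also have "\<dots> = rmult (l + l') ?u (tens k l S T) is js"
      unfolding rmult_def sum_words_append sum_product split(1,2)
      by (intro sum.cong refl)
        (simp add: tens_append split wprod_append mult_scaleC_left mult_scaleC_right scaleC_scaleC mult.commute)
    finally show ?thesis .
  next
    case False
    have "tens k l S T is a *\<^sub>C ?u a js = 0" if "length a = k + k'" for a
      using False that tm wprod_length[of polO_gen a js] by (auto simp: tensor_maps_def)
    moreover have "tens k l S T b js *\<^sub>C ?u is b = 0" if "length b = l + l'" for b
      using False that tm wprod_length[of polO_gen "is" b] by (auto simp: tensor_maps_def)
    ultimately have "lmult (k + k') (tens k l S T) ?u is js = 0" "rmult (l + l') ?u (tens k l S T) is js = 0"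
      unfolding lmult_def rmult_def by (intro sum.neutral; blast)+
    then show ?thesis by simp
  qed
  then show ?thesis using tm by (simp add: classical_Mor_def fun_eq_iff)
qed

lemma sum_words_2:
  fixes f :: "'n::finite list \<Rightarrow> 'b::comm_monoid_add"
  shows "(\<Sum>ms | length ms = 2. f ms) = (\<Sum>i\<in>UNIV. \<Sum>j\<in>UNIV. f [i, j])"
  unfolding numeral_2_eq_2 sum_words_Suc by simp

lemma classical_Mor_cup: "cup \<in> classical_Mor 0 2"
proof -
  let ?u = "wprod polO_gen :: 'a list \<Rightarrow> 'a list \<Rightarrow> 'a polO"
  have tm: "cup \<in> tensor_maps 0 2"
    by (auto simp: tensor_maps_def cup_def)
  note o = orthogonal_entries_gen[unfolded orthogonal_entries_def]
  have "lmult 0 cup ?u is js = rmult 2 ?u cup is js" for "is" js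
  proof -
    have l: "lmult 0 cup ?u is js = cup is [] *\<^sub>C ?u [] js"
      by (simp add: lmult_def)
    have r: "rmult 2 ?u cup is js = (\<Sum>i\<in>UNIV. cup [i, i] js *\<^sub>C ?u is [i, i])"
    proof -
      have "(\<Sum>j\<in>UNIV. cup [i, j] js *\<^sub>C ?u is [i, j]) =
          (\<Sum>j\<in>UNIV. if j = i then cup [i, i] js *\<^sub>C ?u is [i, i] else 0)" for i
        by (intro sum.cong) (auto simp: cup_def)
      then show ?thesis by (simp add: rmult_def sum_words_2)
    qed
    show ?thesis
    proof (cases "js = [] \<and> length is = 2")
      case True
      then obtain a b where "is = [a, b]" by (auto simp: length_Suc_conv numeral_2_eq_2)
      then show ?thesis using True unfolding l r by (auto simp: o cup_def scaleC_one)
    next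
      case False
      have "?u [] js = 0 \<or> cup is [] = 0"
        using False wprod_length[of polO_gen "[]" js] by (auto simp: cup_def)
      moreover have "cup [i, i] js = 0 \<or> ?u is [i, i] = 0" for i
      proof (cases "js = []")
        case True
        with False have "length is \<noteq> length [i, i]" by simp
        then show ?thesis using wprod_length by blast
      qed (simp add: cup_def)
      ultimately show ?thesis unfolding l r
        by (metis (no_types, lifting) complex_vector.scale_eq_0_iff sum.neutral)
    qed
  qed
  then show ?thesis using tm by (simp add: classical_Mor_def fun_eq_iff)
qed

lemma classical_Mor_flip: "flip \<in> classical_Mor 2 2"
proof -
  let ?u = "wprod polO_gen :: 'a list \<Rightarrow> 'a list \<Rightarrow> 'a polO"
  have tm: "flip \<in> tensor_maps 2 2"
    by (auto simp: tensor_maps_def flip_def)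
  have "lmult 2 flip ?u is js = rmult 2 ?u flip is js" for "is" js
  proof (cases "length is = 2 \<and> length js = 2")
    case True
    then obtain a b c d where ij: "is = [a, b]" "js = [c, d]" by (auto simp: length_Suc_conv numeral_2_eq_2)
    have "lmult 2 flip ?u is js = (\<Sum>ms | length ms = 2. if ms = [b, a] then ?u [b, a] js else 0)"
      unfolding lmult_def by (intro sum.cong) (auto simp: flip_def ij scaleC_one)
    moreover have "rmult 2 ?u flip is js = (\<Sum>ms | length ms = 2. if ms = [d, c] then ?u is [d, c] else 0)"
      unfolding rmult_def by (intro sum.cong) (auto simp: flip_def ij scaleC_one)
    ultimately show ?thesis by (simp add: ij mult.commute)
  next
    case False
    have "flip is a *\<^sub>C ?u a js = 0" if "length a = 2" for a
      using False that tm wprod_length[of polO_gen a js] by (auto simp: tensor_maps_def)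
    moreover have "flip b js *\<^sub>C ?u is b = 0" if "length b = 2" for b
      using False that tm wprod_length[of polO_gen "is" b] by (auto simp: tensor_maps_def)
    ultimately have "lmult 2 flip ?u is js = 0" "rmult 2 ?u flip is js = 0"
      unfolding lmult_def rmult_def by (intro sum.neutral; blast)+
    then show ?thesis by simp
  qed
  then show ?thesis using tm by (simp add: classical_Mor_def fun_eq_iff)
qed

section \<open>The twisted and conjugated intertwiners\<close>

context sign_matrix begin

lemma pair_sign_prod: "pair_sign is js = (\<Prod>i\<leftarrow>is. row_sign i js)"
  by (induction "is") simp_all

lemma pair_sign_prod_right: "pair_sign is js = (\<Prod>j\<leftarrow>js. pair_sign is [j])"
proof (induction js)
  case Nil
  show ?case by (induction "is") simp_all
next
  case (Cons j js)
  then show ?case using pair_sign_append(2)[of "is" "[j]" js] by simp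
qed

text \<open>With one word fixed, the sign contributed by a letter of the other word is a function to
  signs, that is, a diagonal orthogonal matrix. Intertwiners of the classical group respect every
  such matrix.\<close>

lemma pair_sign_classical_Mor:
  assumes "T \<in> classical_Mor k l" "T is js \<noteq> 0"
  shows "pair_sign is ms = pair_sign js ms" "pair_sign ms is = pair_sign ms js"
proof -
  show "pair_sign is ms = pair_sign js ms"
    unfolding pair_sign_prod by (rule classical_Mor_sign[OF assms(1) row_sign_square assms(2)])
  show "pair_sign ms is = pair_sign ms js"
    unfolding pair_sign_prod_right[of ms "is"] pair_sign_prod_right[of ms js]
    by (rule classical_Mor_sign[OF assms(1) pair_sign_square assms(2)])
qed

end

section \<open>Conjugation by the signed tensor powers of the orthogonal matrix\<close>

locale conj_twist = sign_matrix s for s :: "'n::finite \<Rightarrow> 'n \<Rightarrow> complex" +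
  fixes U :: "'n \<Rightarrow> 'n \<Rightarrow> complex"
  assumes orth: "orthogonal_entries U" and real: "cnj (U i j) = U i j"
begin

abbreviation W :: "'n tensor_map" where "W \<equiv> twist_matrix U"

definition Wt :: "'n tensor_map" where "Wt is js = W js is"

lemma W_eq_0: "length is \<noteq> length js \<Longrightarrow> W is js = 0" "length is \<noteq> length js \<Longrightarrow> Wt is js = 0"
  using wprod_length[of U "is" js] wprod_length[of U js "is"] by (auto simp: twist_matrix_def Wt_def)

lemma Wt_W: "lmult k Wt W = word_id k"
proof (intro ext)
  fix "is" js
  show "lmult k Wt W is js = word_id k is js"
  proof (cases "length is = k \<and> length js = k")
    case True
    have "Wt is ms * W ms js = wprod U ms is * wprod U ms js" for ms
    proof -
      have "Wt is ms * W ms js = (word_sign ms * word_sign ms) * (wprod U ms is * wprod U ms js)"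
        unfolding Wt_def twist_matrix_def by (simp only: mult_ac)
      then show ?thesis unfolding word_sign_square by simp
    qed
    then show ?thesis
      using True wprod_orthogonal(2)[OF orth, of "is" js] by (simp add: lmult_def word_id_def)
  next
    case False
    then have "Wt is ms * W ms js = 0" if "length ms = k" for ms using W_eq_0 that by auto
    then have "lmult k Wt W is js = 0" unfolding lmult_def scaleC_complex_def by (intro sum.neutral) blast
    then show ?thesis using False by (auto simp: word_id_def)
  qed
qed

lemma W_Wt: "lmult k W Wt = word_id k"
proof (intro ext)
  fix "is" js
  show "lmult k W Wt is js = word_id k is js"
  proof (cases "length is = k \<and> length js = k")
    case True
    have "lmult k W Wt is js = (word_sign is * word_sign js) * (\<Sum>ms | length ms = length is. wprod U is ms * wprod U js ms)"
      unfolding lmult_def scaleC_complex_def Wt_def twist_matrix_def sum_distrib_left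
      by (rule sum.cong) (use True in \<open>simp, simp only: mult_ac\<close>)
    then show ?thesis
      using True wprod_orthogonal(1)[OF orth, of "is" js] by (simp add: word_id_def word_sign_square)
  next
    case False
    then have "W is ms * Wt ms js = 0" if "length ms = k" for ms using W_eq_0 that by auto
    then have "lmult k W Wt is js = 0" unfolding lmult_def scaleC_complex_def by (intro sum.neutral) blast
    then show ?thesis using False by (auto simp: word_id_def)
  qed
qed

definition conj_map :: "nat \<Rightarrow> nat \<Rightarrow> 'n tensor_map \<Rightarrow> 'n tensor_map" where
  "conj_map k l T = lmult l W (lmult k T Wt)"

lemma row_support:
  assumes "T \<in> tensor_maps k l" "lmult k T X is js \<noteq> 0"
  shows "length is = l"
proof -
  obtain ms where "T is ms *\<^sub>C X ms js \<noteq> 0"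
    using assms(2) unfolding lmult_def by (metis (mono_tags, lifting) sum.neutral)
  then have "T is ms \<noteq> 0" by auto
  then show ?thesis using assms(1) by (simp add: tensor_maps_def)
qed

lemma tensor_maps_conj_map:
  assumes "T \<in> tensor_maps k l"
  shows "conj_map k l T \<in> tensor_maps k l"
proof -
  have "length is = l \<and> length js = k" if nz: "conj_map k l T is js \<noteq> 0" for "is" js
  proof -
    obtain ms where "length ms = l" "W is ms * lmult k T Wt ms js \<noteq> 0"
      using nz unfolding conj_map_def lmult_def[of l] scaleC_complex_def
      by (auto elim: sum.not_neutral_contains_not_neutral)
    then have 1: "length is = l" "lmult k T Wt ms js \<noteq> 0" using W_eq_0(1)[of "is" ms] by auto
    then obtain ns where "length ns = k" "T ms ns * Wt ns js \<noteq> 0"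
      unfolding lmult_def scaleC_complex_def by (auto elim: sum.not_neutral_contains_not_neutral)
    then have "Wt ns js \<noteq> 0" by simp
    then have "length ns = length js" using W_eq_0(2) by blast
    with \<open>length ns = k\<close> 1 show ?thesis by simp
  qed
  then show ?thesis by (simp add: tensor_maps_def)
qed

lemma lmult_Wt_W: "(\<And>is js. X is js \<noteq> 0 \<Longrightarrow> length is = k) \<Longrightarrow> lmult k Wt (lmult k W X) = X"
  by (simp add: lmult_lmult Wt_W lmult_word_id)

lemma conj_map_comp:
  assumes "T \<in> tensor_maps k l"
  shows "conj_map k m (lmult l S T) = lmult l (conj_map l m S) (conj_map k l T)"
proof -
  have "lmult l (conj_map l m S) (conj_map k l T) = lmult m W (lmult l S (lmult l Wt (lmult l W (lmult k T Wt))))"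
    by (simp add: conj_map_def lmult_lmult)
  also have "lmult l Wt (lmult l W (lmult k T Wt)) = lmult k T Wt"
    using row_support[OF assms] by (rule lmult_Wt_W)
  finally show ?thesis by (simp add: conj_map_def lmult_lmult)
qed

lemma conj_map_word_id: "conj_map k k (word_id k) = word_id k"
proof -
  have "lmult k (word_id k) Wt ms js = Wt ms js" if "length ms = k" for ms js
  proof -
    have "lmult k (word_id k) Wt ms js = (\<Sum>ns | length ns = k. if ns = ms then Wt ms js else 0)"
      unfolding lmult_def by (intro sum.cong) (auto simp: word_id_def)
    then show ?thesis using that by simp
  qed
  then have "lmult k W (lmult k (word_id k) Wt) = lmult k W Wt"
    by (simp add: lmult_def[of k W] fun_eq_iff)
  then show ?thesis by (simp add: conj_map_def W_Wt)
qed

lemma conj_map_adj: "conj_map l k (adj T) = adj (conj_map k l T)"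
proof -
  have "cnj (word_sign is) = word_sign is" for "is"
  proof -
    have "word_sign is = 1 \<or> word_sign is = -1"
      using word_sign_square[of "is"] by (metis power2_eq_square power2_eq_1_iff)
    then show ?thesis by auto
  qed
  moreover have "cnj (wprod U is js) = wprod U is js" for "is" js
  proof (induction "is" arbitrary: js)
    case Nil
    then show ?case by (cases js) auto
  next
    case (Cons i "is")
    then show ?case by (cases js) (auto simp: real)
  qed
  ultimately have "adj W = Wt" "adj Wt = W"
    by (simp_all add: adj_def Wt_def twist_matrix_def fun_eq_iff)
  then show ?thesis by (simp add: conj_map_def adj_lmult lmult_lmult)
qed

lemma conj_map_add: "conj_map k l (\<lambda>is js. S is js + T is js) = (\<lambda>is js. conj_map k l S is js + conj_map k l T is js)"
  by (simp add: conj_map_def lmult_def fun_eq_iff distrib_left distrib_right sum.distrib)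

lemma conj_map_scale: "conj_map k l (\<lambda>is js. c * T is js) = (\<lambda>is js. c * conj_map k l T is js)"
  unfolding conj_map_def lmult_def fun_eq_iff scaleC_complex_def sum_distrib_left
  by (intro allI) (simp only: mult_ac)

lemma conj_map_zero: "conj_map k l (\<lambda>is js. 0) = (\<lambda>is js. 0)"
  using conj_map_scale[of k l 0 "\<lambda>is js. 0"] by simp

lemma conj_map_inj:
  assumes "S \<in> tensor_maps k l" "T \<in> tensor_maps k l" "conj_map k l S = conj_map k l T"
  shows "S = T"
proof -
  have "lmult k (lmult l Wt (conj_map k l T)) W = T" if T: "T \<in> tensor_maps k l" for T
  proof -
    have "lmult l Wt (conj_map k l T) = lmult k T Wt"
      unfolding conj_map_def using row_support[OF T] by (rule lmult_Wt_W)
    then have "lmult k (lmult l Wt (conj_map k l T)) W = rmult k T (word_id k)"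
      by (simp add: lmult_lmult[symmetric] Wt_W rmult_complex)
    also have "\<dots> = T" using T by (intro rmult_word_id) (auto simp: tensor_maps_def)
    finally show ?thesis .
  qed
  then show ?thesis using assms by metis
qed

lemma W_append:
  "length is = length js \<Longrightarrow> W (is @ is') (js @ js') = pair_sign is is' * (W is js * W is' js')"
  unfolding twist_matrix_def word_sign_append wprod_append by (simp only: mult_ac)

text \<open>The signs come from \<open>W_append\<close> applied on the left and on the right; they
  depend only on the outer words and leave the sums.\<close>

lemma conj_map_tens:
  assumes len: "length is = l" "length js = k"
  shows "conj_map (k + k') (l + l') (tens k l T S) (is @ is') (js @ js') =
    pair_sign is is' * pair_sign js js' * (conj_map k l T is js * conj_map k' l' S is' js')"
proof -
  have 1: "lmult (k + k') (tens k l T S) Wt (a @ a') (js @ js') =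
      pair_sign js js' * (lmult k T Wt a js * lmult k' S Wt a' js')" if "length a = l" for a a'
    unfolding lmult_def scaleC_complex_def sum_words_append sum_product unfolding sum_distrib_left
  proof (intro sum.cong refl)
    fix m m' :: "'n list" assume "m \<in> {m. length m = k}" "m' \<in> {m'. length m' = k'}"
    then have "tens k l T S (a @ a') (m @ m') = T a m * S a' m'"
      "Wt (m @ m') (js @ js') = pair_sign js js' * (Wt m js * Wt m' js')"
      using that len by (simp_all add: tens_append Wt_def W_append)
    then show "tens k l T S (a @ a') (m @ m') * Wt (m @ m') (js @ js') =
        pair_sign js js' * (T a m * Wt m js * (S a' m' * Wt m' js'))"
      by (simp only: mult_ac)
  qed
  show ?thesis
    unfolding conj_map_def lmult_def[of l W] lmult_def[of l' W] lmult_def[of "l + l'"] scaleC_complex_def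
      sum_words_append sum_product
    unfolding sum_distrib_left
  proof (intro sum.cong refl)
    fix a a' :: "'n list" assume "a \<in> {a. length a = l}" "a' \<in> {a'. length a' = l'}"
    then have "W (is @ is') (a @ a') = pair_sign is is' * (W is a * W is' a')"
      "lmult (k + k') (tens k l T S) Wt (a @ a') (js @ js') =
        pair_sign js js' * (lmult k T Wt a js * lmult k' S Wt a' js')"
      using len by (simp_all add: 1 W_append)
    then show "W (is @ is') (a @ a') * lmult (k + k') (tens k l T S) Wt (a @ a') (js @ js') =
        pair_sign is is' * pair_sign js js' * (W is a * lmult k T Wt a js * (W is' a' * lmult k' S Wt a' js'))"
      by (simp only: mult_ac)
  qed
qed

text \<open>\<open>conj_map\<close> is multiplicative up to signs, which cancel because intertwiners of the classical group
  respect the grading by the diagonal subgroup.\<close>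

lemma conj_map_tens_classical:
  assumes T: "T \<in> tensor_maps k l" "conj_map k l T \<in> classical_Mor k l"
    and S: "S \<in> tensor_maps k' l'" "conj_map k' l' S \<in> classical_Mor k' l'"
  shows "conj_map (k + k') (l + l') (tens k l T S) = tens k l (conj_map k l T) (conj_map k' l' S)"
proof (rule tensor_maps_add_eqI)
  show "conj_map (k + k') (l + l') (tens k l T S) \<in> tensor_maps (k + k') (l + l')"
    by (intro tensor_maps_conj_map tensor_maps_tens T S)
  show "tens k l (conj_map k l T) (conj_map k' l' S) \<in> tensor_maps (k + k') (l + l')"
    by (intro tensor_maps_conj_map tensor_maps_tens T S)
  fix "is" js is' js' :: "'n list"
  assume len: "length is = l" "length js = k"
  have "pair_sign is is' * pair_sign js js' = 1"
    if "conj_map k l T is js \<noteq> 0" "conj_map k' l' S is' js' \<noteq> 0"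
    using pair_sign_classical_Mor(1)[OF T(2) that(1), of is'] pair_sign_classical_Mor(2)[OF S(2) that(2), of js]
      pair_sign_square[of js js'] by simp
  then show "conj_map (k + k') (l + l') (tens k l T S) (is @ is') (js @ js') =
      tens k l (conj_map k l T) (conj_map k' l' S) (is @ is') (js @ js')"
    using len by (cases "conj_map k l T is js = 0 \<or> conj_map k' l' S is' js' = 0")
      (auto simp: conj_map_tens tens_append)
qed

end

lemma wprod_eq_0: "length is \<noteq> length js \<Longrightarrow> wprod h is js = 0"
  using wprod_length by blast

text \<open>Stated for a general family \<open>x\<close> in order to serve both directions of
  \<open>qg_Mor_conj\<close>, once with \<open>Wt\<close> and \<open>W\<close> and once with their
  roles exchanged.\<close>

lemma intertwiner_transport:
  assumes A: "lmult k T A = lmult l A Y" and B: "lmult k Y B = lmult l B T"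
    and Y: "lmult k Y (x k) = rmult l (x l) Y"
  shows "lmult k T (lmult k A (rmult k (x k) B)) = rmult l (lmult l A (rmult l (x l) B)) T"
proof -
  have "lmult k T (lmult k A (rmult k (x k) B)) = lmult l A (rmult k (lmult k Y (x k)) B)"
    unfolding lmult_lmult A unfolding lmult_lmult[symmetric] lmult_rmult ..
  also have "\<dots> = rmult l (lmult l A (rmult l (x l) B)) T"
    unfolding Y rmult_rmult B unfolding rmult_rmult[symmetric] lmult_rmult ..
  finally show ?thesis .
qed

context conj_twist begin

lemma qg_Mor_conj:
  assumes U: "\<And>i j. U i j = complex_of_real (Um $ i $ j)"
  shows "qg_Mor (qg_conj Um (twisted_O s)) k l =
    {T \<in> tensor_maps k l. conj_map k l T \<in> classical_Mor k l}"
proof -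
  \<comment> \<open>Restricting \<open>wprod polO_gen\<close> to words of length \<open>k\<close>
    makes \<open>word_id k\<close> act on it as an identity, so that \<open>W\<close> can be
    cancelled against \<open>Wt\<close>.\<close>
  define u where "u k is js = (if length is = k \<and> length js = k then wprod polO_gen is js else 0)"
    for k and "is" js :: "'n list"
  define V where "V k = lmult k Wt (rmult k (u k) W)" for k
  have lmult_u: "lmult k S (wprod polO_gen) = lmult k S (u k)" for k and S :: "'n tensor_map"
  proof -
    have "wprod polO_gen ms js = u k ms js" if "length ms = k" for ms js
      using that by (simp add: u_def wprod_eq_0)
    then show ?thesis by (simp add: lmult_def fun_eq_iff)
  qed
  have rmult_u: "rmult k (wprod polO_gen) S = rmult k (u k) S" for k and S :: "'n tensor_map"
  proof -
    have "wprod polO_gen is ms = u k is ms" if "length ms = k" for "is" ms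
      using that by (simp add: u_def wprod_eq_0)
    then show ?thesis by (simp add: rmult_def fun_eq_iff)
  qed
  have V0: "V k is js = 0" if "length is \<noteq> k \<or> length js \<noteq> k" for k "is" js
  proof -
    have "Wt is ms *\<^sub>C (W ns js *\<^sub>C u k ms ns) = 0" if "length ms = k" "length ns = k" for ms ns
      using that \<open>length is \<noteq> k \<or> length js \<noteq> k\<close> W_eq_0(1)[of ns js] W_eq_0(2)[of "is" ms] by auto
    then show ?thesis
      unfolding V_def lmult_def rmult_def complex_vector.scale_sum_right by (intro sum.neutral ballI) simp
  qed
  have "(\<lambda>i j. complex_of_real (Um $ i $ j)) = U" "(\<lambda>is ms. W ms is) = Wt"
    using U by (simp_all add: fun_eq_iff Wt_def)
  then have fund: "qg_fund_power (qg_conj Um (twisted_O s)) is js = V k is js"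
    if "length is = k" "length js = k" for k "is" js
    using that qg_fund_power_conj[of "is" js Um] by (simp add: V_def rmult_u)
  have "T \<in> qg_Mor (qg_conj Um (twisted_O s)) k l \<longleftrightarrow> conj_map k l T \<in> classical_Mor k l"
    if T: "T \<in> tensor_maps k l" for T
  proof -
    define Y where "Y = conj_map k l T"
    have "T \<in> qg_Mor (qg_conj Um (twisted_O s)) k l \<longleftrightarrow>
        (\<forall>is js. length is = l \<longrightarrow> length js = k \<longrightarrow> lmult k T (V k) is js = rmult l (V l) T is js)"
      unfolding qg_Mor_def lmult_def rmult_def using T by (simp add: fund)
    also have "\<dots> \<longleftrightarrow> lmult k T (V k) = rmult l (V l) T"
    proof -
      have "lmult k T (V k) is js = 0 \<and> rmult l (V l) T is js = 0" if "\<not> (length is = l \<and> length js = k)" for "is" js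
      proof -
        have "T is a *\<^sub>C V k a js = 0" if "length a = k" for a
          using \<open>\<not> (length is = l \<and> length js = k)\<close> T V0[of a k js] by (auto simp: tensor_maps_def)
        moreover have "T b js *\<^sub>C V l is b = 0" if "length b = l" for b
          using \<open>\<not> (length is = l \<and> length js = k)\<close> T V0[of "is" l b] by (auto simp: tensor_maps_def)
        ultimately show ?thesis unfolding lmult_def rmult_def by (intro conjI sum.neutral; blast)
      qed
      then show ?thesis unfolding fun_eq_iff by metis
    qed
    also have "\<dots> \<longleftrightarrow> lmult k Y (u k) = rmult l (u l) Y"
    proof
      have A: "lmult k T Wt = lmult l Wt Y"
        unfolding Y_def conj_map_def using row_support[OF T] by (rule lmult_Wt_W[symmetric])
      have "rmult k T (word_id k) = T" using T by (intro rmult_word_id) (auto simp: tensor_maps_def)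
      then have B: "lmult k Y W = lmult l W T"
        by (simp add: Y_def conj_map_def lmult_lmult[symmetric] Wt_W rmult_complex)
      show "lmult k T (V k) = rmult l (V l) T" if "lmult k Y (u k) = rmult l (u l) Y"
        unfolding V_def using A B that by (rule intertwiner_transport)
      have V_u: "lmult k W (rmult k (V k) Wt) = u k" for k
      proof -
        have "lmult k W (rmult k (V k) Wt) = lmult k (lmult k W Wt) (rmult k (u k) (lmult k W Wt))"
          unfolding V_def lmult_lmult[symmetric] rmult_rmult[symmetric] lmult_rmult ..
        also have "\<dots> = u k"
          unfolding W_Wt by (subst rmult_word_id; (subst lmult_word_id)?) (auto simp: u_def split: if_splits)
        finally show ?thesis .
      qed
      show "lmult k Y (u k) = rmult l (u l) Y" if "lmult k T (V k) = rmult l (V l) T"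
        using intertwiner_transport[OF B A, of V] that unfolding V_u .
    qed
    also have "\<dots> \<longleftrightarrow> Y \<in> classical_Mor k l"
      using tensor_maps_conj_map[OF T] by (simp add: classical_Mor_def lmult_u rmult_u Y_def)
    finally show ?thesis by (simp add: Y_def)
  qed
  then show ?thesis by (auto simp: qg_Mor_def)
qed

end

section \<open>The category generated by the twisted crossing\<close>

lemma word_1E:
  assumes "length ms = 1"
  obtains i where "ms = [i]"
  using assms that by (cases ms; cases "tl ms") simp_all

lemma word_2E:
  assumes "length ms = 2"
  obtains i j where "ms = [i, j]"
  using assms that by (cases ms; cases "tl ms"; cases "tl (tl ms)") simp_all

lemma block_const_simps:
  "block_const F {}"
  "block_const F (insert {x} P) \<longleftrightarrow> block_const F P"
  "block_const F (insert {x, y} P) \<longleftrightarrow> F x = F y \<and> block_const F P"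
  unfolding block_const_def by simp_all (metis (no_types))

lemma lin_part_map_identity:
  "lin_part_map 1 1 (Poly_Mapping.single {{Inl 0, Inr 0}} 1) = word_id 1"
proof (rule tensor_maps_eqI[OF tensor_maps_lin_part_map tensor_maps_word_id])
  fix "is" js :: "'a list" assume "length is = 1" "length js = 1"
  then obtain i j where ij: "is = [i]" "js = [j]" by (metis word_1E)
  show "lin_part_map 1 1 (Poly_Mapping.single {{Inl 0, Inr 0}} 1) is js = word_id 1 is js"
    unfolding ij lin_part_map_single part_map_block_const block_const_simps word_id_def
    by (auto simp: block_const_simps)
qed

lemma lin_part_map_cup:
  "lin_part_map 0 2 (Poly_Mapping.single {{Inr 0, Inr 1}} 1) = cup"
proof (rule tensor_maps_eqI[OF tensor_maps_lin_part_map])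
  show "cup \<in> tensor_maps 0 2" by (auto simp: tensor_maps_def cup_def)
  fix "is" js :: "'a list" assume "length is = 2" "length js = 0"
  then obtain i j where ij: "is = [i, j]" "js = []" by (metis word_2E length_0_conv)
  show "lin_part_map 0 2 (Poly_Mapping.single {{Inr 0, Inr 1}} 1) is js = cup is js"
    unfolding ij lin_part_map_single part_map_block_const block_const_simps cup_def
    by (auto simp: block_const_simps)
qed

text \<open>The four partitions are the terms of an expanded product: each of the two crossing
  strands is either kept or cut into singletons. Each factor is an entry of the reflection, the
  identity minus \<open>2 / N\<close> times the all-one matrix.\<close>

lemma lin_part_map_twisted_cross:
  "lin_part_map 2 2 (twisted_cross N) [a, b] [c, d] =
    ((if b = c then 1 else 0) - 2 / N) * ((if a = d then 1 else 0) - 2 / N)"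
proof -
  have "part_map 2 2 p_cross [a, b] [c, d] = (if b = c \<and> a = d then 1 else 0)"
    "part_map 2 2 p_r1 [a, b] [c, d] = (if b = c then 1 else 0)"
    "part_map 2 2 p_r2 [a, b] [c, d] = (if a = d then 1 else 0)"
    "part_map 2 2 p_s [a, b] [c, d] = 1"
    unfolding part_map_block_const p_cross_def p_r1_def p_r2_def p_s_def block_const_simps
    by (auto simp: block_const_simps)
  then have "lin_part_map 2 2 (twisted_cross N) [a, b] [c, d] =
      (if b = c \<and> a = d then 1 else 0) - 2 / N * ((if b = c then 1 else 0) + (if a = d then 1 else 0)) + 4 / N\<^sup>2"
    by (simp only: twisted_cross_def lin_part_map_add lin_part_map_diff lin_part_map_scaleC lin_part_map_single
        mult_1 mult_1_right)
  then show ?thesis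
    by (cases "b = c"; cases "a = d") (simp_all add: power2_eq_square algebra_simps)
qed

lemma partitions_cross:
  "p_cross \<in> partitions 2 2" "p_r1 \<in> partitions 2 2" "p_r2 \<in> partitions 2 2" "p_s \<in> partitions 2 2"
proof -
  have "{..<2::nat} <+> {..<2::nat} = {Inl 0, Inl 1, Inr 0, Inr 1}"
    by (auto simp: Plus_def numeral_2_eq_2 lessThan_Suc)
  then show "p_cross \<in> partitions 2 2" "p_r1 \<in> partitions 2 2" "p_r2 \<in> partitions 2 2" "p_s \<in> partitions 2 2"
    by (auto simp: partitions_def partition_on_def disjoint_def p_cross_def p_r1_def p_r2_def p_s_def)
qed

lemma twisted_cross_Part: "twisted_cross N \<in> Part 2 2"
  unfolding twisted_cross_def
  by (intro complex_vector.subspace_add[OF subspace_Part] complex_vector.subspace_diff[OF subspace_Part]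
      complex_vector.subspace_scale[OF subspace_Part] single_Part partitions_cross)

text \<open>The properties of the data on which the computation rests: \<open>reflection\<close>
  says that \<open>U\<close> diagonalises the reflection along the all-one vector with eigenvalues
  \<open>sg\<close>, and \<open>comm\<close> that the sign for exchanging two twisted letters is the
  product of their eigenvalues.\<close>

locale reflection_twist = conj_twist s U for s U :: "'n::finite \<Rightarrow> 'n \<Rightarrow> complex" +
  fixes sg :: "'n \<Rightarrow> complex" and N :: complex
  assumes N: "N = of_nat CARD('n)" and diag: "s i i = 1" and comm: "s i j * s j i = sg i * sg j"
    and reflection: "(\<Sum>m\<in>UNIV. U i m * (\<Sum>n\<in>UNIV. ((if m = n then 1 else 0) - 2 / N) * U j n)) =
      (if i = j then sg i else 0)"
begin

lemma W_2: "W [i, j] [a, b] = s i j * (U i a * U j b)"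
  by (simp add: twist_matrix_def)

text \<open>Orthogonality of the rows of \<open>U\<close> leaves only the signs
  \<open>s i i\<close>, which are 1.\<close>

lemma conj_map_cup: "conj_map 0 2 cup = cup"
proof (rule tensor_maps_eqI)
  have "cup \<in> (tensor_maps 0 2 :: 'n tensor_map set)" by (auto simp: tensor_maps_def cup_def)
  then show "conj_map 0 2 cup \<in> tensor_maps 0 2" "cup \<in> (tensor_maps 0 2 :: 'n tensor_map set)"
    by (auto intro: tensor_maps_conj_map)
  fix "is" js :: "'n list" assume "length is = 2" "length js = 0"
  then obtain i j where ij: "is = [i, j]" "js = []" by (auto elim: word_2E)
  have "conj_map 0 2 cup [i, j] [] = (\<Sum>a\<in>UNIV. \<Sum>b\<in>UNIV. if b = a then s i j * (U i a * U j a) else 0)"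
    unfolding conj_map_def lmult_def[of 2] lmult_def[of 0] sum_words_2 sum_words_0 W_2
    by (rule sum.cong[OF refl], rule sum.cong[OF refl]) (simp add: Wt_def twist_matrix_def cup_def)
  also have "\<dots> = s i j * (\<Sum>a\<in>UNIV. U i a * U j a)" by (simp add: sum_distrib_left)
  also have "\<dots> = (if i = j then 1 else 0)"
    using orth by (simp add: orthogonal_entries_def diag)
  finally show "conj_map 0 2 cup is js = cup is js" by (simp add: ij cup_def)
qed

lemma conj_map_twisted_cross: "conj_map 2 2 (lin_part_map 2 2 (twisted_cross N)) = flip"
proof (rule tensor_maps_eqI)
  show "conj_map 2 2 (lin_part_map 2 2 (twisted_cross N)) \<in> tensor_maps 2 2"
    by (intro tensor_maps_conj_map tensor_maps_lin_part_map)
  show "flip \<in> (tensor_maps 2 2 :: 'n tensor_map set)" by (auto simp: tensor_maps_def flip_def)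
  fix "is" js :: "'n list" assume "length is = 2" "length js = 2"
  then obtain i1 i2 j1 j2 where ij: "is = [i1, i2]" "js = [j1, j2]" by (auto elim!: word_2E)
  define \<rho> where "\<rho> m n = (if m = n then 1 else 0) - 2 / N" for m n :: 'n
  define P where "P m j = (\<Sum>n\<in>UNIV. \<rho> m n * U j n)" for m j
  have R: "lin_part_map 2 2 (twisted_cross N) [a, b] [c, d] = \<rho> b c * \<rho> a d" for a b c d
    by (simp add: lin_part_map_twisted_cross \<rho>_def)
  have inner: "lmult 2 (lin_part_map 2 2 (twisted_cross N)) Wt [a, b] [j1, j2] = s j1 j2 * (P b j1 * P a j2)" for a b
    unfolding lmult_def sum_words_2 P_def sum_product unfolding sum_distrib_left
    by (intro sum.cong refl) (simp only: R Wt_def W_2 scaleC_complex_def mult_ac)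
  have "conj_map 2 2 (lin_part_map 2 2 (twisted_cross N)) [i1, i2] [j1, j2] =
      (\<Sum>a\<in>UNIV. \<Sum>b\<in>UNIV. s i1 i2 * (s j1 j2 * ((U i1 a * P a j2) * (U i2 b * P b j1))))"
    unfolding conj_map_def lmult_def[of 2 W] sum_words_2 inner
    by (intro sum.cong refl) (simp only: W_2 scaleC_complex_def mult_ac)
  also have "\<dots> = s i1 i2 * (s j1 j2 * ((\<Sum>a\<in>UNIV. U i1 a * P a j2) * (\<Sum>b\<in>UNIV. U i2 b * P b j1)))"
    unfolding sum_product unfolding sum_distrib_left by (rule refl)
  also have "\<dots> = s i1 i2 * (s j1 j2 * ((if i1 = j2 then sg i1 else 0) * (if i2 = j1 then sg i2 else 0)))"
    using reflection by (simp add: P_def \<rho>_def)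
  also have "\<dots> = (if i1 = j2 \<and> i2 = j1 then 1 else 0)"
  proof -
    \<comment> \<open>By \<open>comm\<close> the two eigenvalues contribute \<open>s i1 i2\<close>
      and \<open>s i2 i1\<close> once more, so every sign occurs squared.\<close>
    have "s i1 i2 * (s i2 i1 * (sg i1 * sg i2)) = (s i1 i2 * s i1 i2) * (s i2 i1 * s i2 i1)"
      unfolding comm[symmetric] by (simp only: mult_ac)
    then have "s i1 i2 * (s i2 i1 * (sg i1 * sg i2)) = 1" unfolding sign_square by simp
    then show ?thesis by auto
  qed
  finally show "conj_map 2 2 (lin_part_map 2 2 (twisted_cross N)) is js = flip is js"
    by (auto simp: ij flip_def)
qed

section \<open>The generated category and its conjugated image\<close>

definition K :: "nat \<Rightarrow> nat \<Rightarrow> lin_partition set" where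
  "K = generated_category N {(2, 2, twisted_cross N)}"

lemma linear_category_K: "linear_category N K"
  unfolding K_def by (rule linear_category_generated) (simp add: twisted_cross_Part)

text \<open>The preimage of the classical intertwiners. Being a linear category that contains the
  generator, it contains \<open>K\<close>.\<close>

definition M :: "nat \<Rightarrow> nat \<Rightarrow> lin_partition set" where
  "M k l = {f \<in> Part k l. conj_map k l (lin_part_map k l f) \<in> classical_Mor k l}"

lemma lin_part_map_add': "lin_part_map k l (f + g) = (\<lambda>is js. lin_part_map k l f is js + lin_part_map k l g is js)"
  by (simp add: fun_eq_iff lin_part_map_add)

lemma lin_part_map_scaleC': "lin_part_map k l (c *\<^sub>C f) = (\<lambda>is js. c * lin_part_map k l f is js)"
  by (simp add: fun_eq_iff lin_part_map_scaleC)

lemma linear_category_M: "linear_category N M"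
  unfolding linear_category_def
proof (intro conjI allI ballI)
  fix k l m k' l' f g
  show "M k l \<subseteq> Part k l" by (auto simp: M_def)
  show "complex_vector.subspace (M k l)"
  proof (rule complex_vector.subspaceI)
    show "0 \<in> M k l" by (simp add: M_def Part_def conj_map_zero classical_Mor_zero)
    show "f + g \<in> M k l" if "f \<in> M k l" "g \<in> M k l" for f g
      using that complex_vector.subspace_add[OF subspace_Part]
      by (simp add: M_def lin_part_map_add' conj_map_add classical_Mor_add)
    show "c *\<^sub>C f \<in> M k l" if "f \<in> M k l" for c f
      using that complex_vector.subspace_scale[OF subspace_Part]
      by (simp add: M_def lin_part_map_scaleC' conj_map_scale classical_Mor_scale)
  qed
  assume f: "f \<in> M k l"
  show "lin_invol f \<in> M l k"
    using f linear_category_Part[of N] unfolding linear_category_def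
    by (auto simp: M_def lin_part_map_invol conj_map_adj classical_Mor_adj)
  show "lin_comp N g f \<in> M k m" if g: "g \<in> M l m"
  proof -
    have "lin_comp N g f \<in> Part k m"
      using f g linear_category_Part[of N] unfolding linear_category_def M_def by blast
    moreover have "lin_part_map k m (lin_comp N g f) = lmult l (lin_part_map l m g) (lin_part_map k l f :: 'n tensor_map)"
      using f g unfolding N by (intro lin_part_map_comp) (auto simp: M_def)
    ultimately show ?thesis
      using f g by (simp add: M_def conj_map_comp tensor_maps_lin_part_map classical_Mor_comp)
  qed
  show "lin_tensor k l f g \<in> M (k + k') (l + l')" if g: "g \<in> M k' l'"
  proof -
    have "lin_tensor k l f g \<in> Part (k + k') (l + l')"
      using f g linear_category_Part[of N] unfolding linear_category_def M_def by blast
    then show ?thesis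
      using f g by (simp add: M_def lin_part_map_tensor conj_map_tens_classical tensor_maps_lin_part_map
          classical_Mor_tens)
  qed
next
  have P: "Poly_Mapping.single {{Inl 0, Inr 0}} 1 \<in> Part 1 1" "Poly_Mapping.single {{Inr 0, Inr 1}} 1 \<in> Part 0 2"
    using linear_category_Part[of N] unfolding linear_category_def by blast+
  show "Poly_Mapping.single {{Inl 0, Inr 0}} 1 \<in> M 1 1"
    using P by (simp add: M_def lin_part_map_identity[simplified] conj_map_word_id classical_Mor_word_id)
  show "Poly_Mapping.single {{Inr 0, Inr 1}} 1 \<in> M 0 2"
    using P by (simp add: M_def lin_part_map_cup[simplified] conj_map_cup classical_Mor_cup)
qed

lemma K_subset_M: "K k l \<subseteq> M k l"
proof -
  have "twisted_cross N \<in> M 2 2"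
    by (simp add: M_def twisted_cross_Part conj_map_twisted_cross classical_Mor_flip)
  then have "\<forall>(k', l', f)\<in>{(2, 2, twisted_cross N)}. f \<in> M k' l'" by simp
  then show ?thesis unfolding K_def generated_category_def using linear_category_M by blast
qed

text \<open>The matrices of \<open>K\<close> seen on the side of the classical group; this is the
  category to which duality is applied.\<close>

definition C :: "nat \<Rightarrow> nat \<Rightarrow> 'n tensor_map set" where
  "C k l = (\<lambda>f. conj_map k l (lin_part_map k l f)) ` K k l"

lemma K_closed:
  "0 \<in> K k l" "f \<in> K k l \<Longrightarrow> f' \<in> K k l \<Longrightarrow> f + f' \<in> K k l" "f \<in> K k l \<Longrightarrow> c *\<^sub>C f \<in> K k l"
  "f \<in> K k l \<Longrightarrow> g \<in> K k' l' \<Longrightarrow> lin_tensor k l f g \<in> K (k + k') (l + l')"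
  "f \<in> K k l \<Longrightarrow> h \<in> K l m \<Longrightarrow> lin_comp N h f \<in> K k m"
  "f \<in> K k l \<Longrightarrow> lin_invol f \<in> K l k"
  "Poly_Mapping.single {{Inl 0, Inr 0}} 1 \<in> K 1 1" "Poly_Mapping.single {{Inr 0, Inr 1}} 1 \<in> K 0 2"
  "f \<in> K k l \<Longrightarrow> f \<in> Part k l"
  using linear_category_K unfolding linear_category_def
  by (blast intro: complex_vector.subspace_0 complex_vector.subspace_add complex_vector.subspace_scale)+

lemma C_tens:
  assumes "S \<in> C k l" "T \<in> C k' l'"
  shows "tens k l S T \<in> C (k + k') (l + l')"
proof -
  obtain f g where f: "f \<in> K k l" "S = conj_map k l (lin_part_map k l f)"
    and g: "g \<in> K k' l'" "T = conj_map k' l' (lin_part_map k' l' g)"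
    using assms by (auto simp: C_def)
  have "f \<in> M k l" "g \<in> M k' l'" using f g K_subset_M by blast+
  then have "tens k l S T = conj_map (k + k') (l + l') (lin_part_map (k + k') (l + l') (lin_tensor k l f g))"
    unfolding f(2) g(2) M_def
    by (simp add: lin_part_map_tensor conj_map_tens_classical tensor_maps_lin_part_map)
  then show ?thesis using K_closed(4)[OF f(1) g(1)] by (simp add: C_def)
qed

lemma CI: "f \<in> K k l \<Longrightarrow> T = conj_map k l (lin_part_map k l f) \<Longrightarrow> T \<in> C k l"
  by (simp add: C_def)

lemma C_adj: "T \<in> C k l \<Longrightarrow> adj T \<in> C l k"
proof (unfold C_def, elim imageE)
  fix f assume "f \<in> K k l" "T = conj_map k l (lin_part_map k l f)"
  then show "adj T \<in> (\<lambda>f. conj_map l k (lin_part_map l k f)) ` K l k"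
    by (intro image_eqI[of _ _ "lin_invol f"] K_closed) (simp add: conj_map_adj lin_part_map_invol)
qed

lemma C_comp: "S \<in> C l m \<Longrightarrow> T \<in> C k l \<Longrightarrow> lmult l S T \<in> C k m"
proof (unfold C_def, elim imageE)
  fix f g assume g: "g \<in> K l m" "S = conj_map l m (lin_part_map l m g)"
    and f: "f \<in> K k l" "T = conj_map k l (lin_part_map k l f)"
  have "lmult l S T = conj_map k m (lin_part_map k m (lin_comp N g f))"
    using lin_part_map_comp[OF K_closed(9)[OF f(1)] K_closed(9)[OF g(1)], where 'n = 'n]
    by (simp add: f g conj_map_comp tensor_maps_lin_part_map N)
  then show "lmult l S T \<in> (\<lambda>f. conj_map k m (lin_part_map k m f)) ` K k m"
    using K_closed(5)[OF f(1) g(1)] by blast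
qed

lemma C_scale: "T \<in> C k l \<Longrightarrow> (\<lambda>is js. c * T is js) \<in> C k l"
proof (unfold C_def, elim imageE)
  fix f assume "f \<in> K k l" "T = conj_map k l (lin_part_map k l f)"
  then show "(\<lambda>is js. c * T is js) \<in> (\<lambda>f. conj_map k l (lin_part_map k l f)) ` K k l"
    by (intro image_eqI[of _ _ "c *\<^sub>C f"] K_closed) (simp add: conj_map_scale lin_part_map_scaleC')
qed

lemma C_add: "S \<in> C k l \<Longrightarrow> T \<in> C k l \<Longrightarrow> (\<lambda>is js. S is js + T is js) \<in> C k l"
proof (unfold C_def, elim imageE)
  fix f g assume "f \<in> K k l" "S = conj_map k l (lin_part_map k l f)"
    "g \<in> K k l" "T = conj_map k l (lin_part_map k l g)"
  then show "(\<lambda>is js. S is js + T is js) \<in> (\<lambda>f. conj_map k l (lin_part_map k l f)) ` K k l"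
    by (intro image_eqI[of _ _ "f + g"] K_closed) (simp add: conj_map_add lin_part_map_add')
qed

lemma C_cup: "cup \<in> C 0 2"
  by (rule CI[OF K_closed(8)]) (simp add: lin_part_map_cup[simplified] conj_map_cup)

lemma C_flip: "flip \<in> C 2 2"
proof (rule CI)
  show "twisted_cross N \<in> K 2 2"
    unfolding K_def by (rule linear_category_generated(2)) (auto simp: twisted_cross_Part)
qed (simp add: conj_map_twisted_cross)

lemma C_word_id: "word_id k \<in> C k k"
proof (induction k)
  case 0
  \<comment> \<open>The identity of degree zero, the empty partition, is not postulated in a linear
    category. It is obtained from a closed loop, which equals \<open>N\<close> times it.\<close>
  have "(\<lambda>is js. 1 / N * lmult 2 (adj cup) cup is js) \<in> C 0 0"
    by (rule C_scale[OF C_comp[OF C_adj[OF C_cup] C_cup]])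
  moreover have "(\<lambda>is js. 1 / N * lmult 2 (adj cup) cup is js) = (word_id 0 :: 'n tensor_map)"
  proof (intro ext)
    fix "is" js :: "'n list"
    have "lmult 2 (adj cup) cup is js = (\<Sum>a\<in>UNIV. \<Sum>b\<in>UNIV. if b = (a :: 'n) then (if is = [] \<and> js = [] then 1 else 0) else 0)"
      unfolding lmult_def sum_words_2 by (intro sum.cong refl) (auto simp: adj_def cup_def)
    then show "1 / N * lmult 2 (adj cup) cup is js = word_id 0 is js"
      by (auto simp: word_id_def N)
  qed
  ultimately show ?case by simp
next
  case (Suc k)
  have "word_id 1 \<in> C 1 1"
    by (rule CI[OF K_closed(7)]) (simp add: lin_part_map_identity[simplified] conj_map_word_id)
  from C_tens[OF this Suc] have "tens 1 1 (word_id 1) (word_id k) \<in> C (1 + k) (1 + k)" .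
  moreover have "tens 1 1 (word_id 1) (word_id k) = (word_id (1 + k) :: 'n tensor_map)"
    by (rule tensor_maps_add_eqI[OF tensor_maps_tens[OF tensor_maps_word_id tensor_maps_word_id] tensor_maps_word_id])
      (auto simp: tens_append word_id_def)
  ultimately show ?case by simp
qed

sublocale brauer_category C
proof
  show "C k l \<subseteq> tensor_maps k l" for k l
    by (auto simp: C_def intro: tensor_maps_conj_map tensor_maps_lin_part_map)
  show "(\<lambda>is js. 0) \<in> C k l" for k l
    by (rule CI[OF K_closed(1)]) (simp add: conj_map_zero)
  show "(\<lambda>is js. S is js + T is js) \<in> C k l" if "S \<in> C k l" "T \<in> C k l" for S T k l
    using that by (rule C_add)
  show "(\<lambda>is js. c * T is js) \<in> C k l" if "T \<in> C k l" for c T k l using that by (rule C_scale)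
  show "lmult l S T \<in> C k m" if "S \<in> C l m" "T \<in> C k l" for S T k l m using that by (rule C_comp)
  show "adj T \<in> C l k" if "T \<in> C k l" for T k l using that by (rule C_adj)
  show "word_id k \<in> C k k" for k by (rule C_word_id)
  show "tens a a (word_id a) (tens 2 2 flip (word_id b)) \<in> C (a + (2 + b)) (a + (2 + b))" for a b
    by (intro C_tens C_word_id C_flip)
  show "tens 0 2 cup (word_id b) \<in> C b (2 + b)" for b
    using C_tens[OF C_cup C_word_id, of b] by simp
qed

text \<open>One inclusion is \<open>K_subset_M\<close>. For the other, duality provides an element
  of \<open>K\<close> with the same conjugate as \<open>T\<close>, and \<open>conj_map\<close> is
  injective.\<close>

theorem qg_Mor_eq:
  assumes "\<And>i j. U i j = complex_of_real (Um $ i $ j)"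
  shows "qg_Mor (qg_conj Um (twisted_O s)) k l = lin_part_map k l ` K k l"
proof -
  have "T \<in> lin_part_map k l ` K k l"
    if T: "T \<in> tensor_maps k l" "conj_map k l T \<in> classical_Mor k l" for T
  proof -
    obtain f where f: "f \<in> K k l" "conj_map k l T = conj_map k l (lin_part_map k l f)"
      using T(2) classical_Mor_subset[of k l] by (auto simp: C_def)
    have "T = lin_part_map k l f" by (rule conj_map_inj[OF T(1) tensor_maps_lin_part_map f(2)])
    then show ?thesis using f(1) by blast
  qed
  then show ?thesis
    unfolding qg_Mor_conj[OF assms] using K_subset_M by (auto simp: M_def tensor_maps_lin_part_map)
qed

end

section \<open>The orthogonal matrix \<open>U\<close> and the theorem\<close>

lemma U_matrix_simps:
  fixes i j :: "'n::{finite, linorder}"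
  shows "U_matrix \<epsilon> $ last_index $ j = 1 / sqrt (real CARD('n))"
    and "i \<noteq> last_index \<Longrightarrow> U_matrix \<epsilon> $ i $ last_index = \<epsilon> / sqrt (real CARD('n))"
    and "i \<noteq> last_index \<Longrightarrow> j \<noteq> last_index \<Longrightarrow> U_matrix \<epsilon> $ i $ j =
      (if i = j then 1 else 0) - 1 / (real CARD('n) - 1) * (1 + \<epsilon> / sqrt (real CARD('n)))"
  by (simp_all add: U_matrix_def Let_def)

lemma sum_rank_one_shift:
  fixes c :: real
  assumes "finite A" "i \<in> A" "j \<in> A"
  shows "(\<Sum>k\<in>A. ((if i = k then 1 else 0) - c) * ((if j = k then 1 else 0) - c)) =
    (if i = j then 1 else 0) - 2 * c + of_nat (card A) * c\<^sup>2"
proof -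
  have "((if i = k then 1 else 0) - c) * ((if j = k then 1 else 0) - c) =
      (if k = i then (if i = j then 1 else 0) else 0) - (if k = i then c else 0) - (if k = j then c else 0) + c\<^sup>2"
    for k by (simp add: power2_eq_square algebra_simps)
  then show ?thesis
    using assms by (simp add: sum.distrib sum_subtractf)
qed

lemma U_matrix_rows:
  fixes i j :: "'n::{finite, linorder}"
  assumes N2: "CARD('n) \<ge> 2" and \<epsilon>: "\<epsilon> = 1 \<or> \<epsilon> = -1"
  shows "(\<Sum>k\<in>UNIV. U_matrix \<epsilon> $ i $ k * U_matrix \<epsilon> $ j $ k) = (if i = j then 1 else 0)"
proof -
  define N where "N = real CARD('n)"
  define r where "r = sqrt N"
  define c where "c = 1 / (N - 1) * (1 + \<epsilon> / r)"
  let ?L = "last_index :: 'n"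
  have N: "N \<ge> 2" using N2 by (simp add: N_def)
  then have r: "r > 0" "r * r = N" by (simp_all add: r_def)
  have e: "\<epsilon> * \<epsilon> = 1" using \<epsilon> by auto
  have N1: "N - 1 \<noteq> 0" using N by simp
  have cN: "(N - 1) * c = 1 + \<epsilon> / r" unfolding c_def using N1 by simp
  have split: "(\<Sum>k\<in>UNIV. f k) = f ?L + (\<Sum>k\<in>UNIV - {?L}. f k)" for f :: "'n \<Rightarrow> real"
    by (rule sum.remove) auto
  have card: "real (card (UNIV - {?L})) = N - 1"
    using N2 by (simp add: N_def)
  note simps = U_matrix_simps[where 'n = 'n and \<epsilon> = \<epsilon>, folded N_def, folded r_def, folded c_def]
  have last: "(\<Sum>k\<in>UNIV. U_matrix \<epsilon> $ i $ k * U_matrix \<epsilon> $ ?L $ k) = (if i = ?L then 1 else 0)" for i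
  proof (cases "i = ?L")
    case True
    then have "(\<Sum>k\<in>UNIV. U_matrix \<epsilon> $ i $ k * U_matrix \<epsilon> $ ?L $ k) = N * (1 / r * (1 / r))"
      by (simp add: simps N_def)
    also have "\<dots> = 1" using r N by (simp add: field_simps)
    finally show ?thesis using True by simp
  next
    case False
    have "(\<Sum>k\<in>UNIV - {?L}. U_matrix \<epsilon> $ i $ k * U_matrix \<epsilon> $ ?L $ k) =
        (\<Sum>k\<in>UNIV - {?L}. (if k = i then 1 / r else 0) - c / r)"
      by (intro sum.cong refl) (use False in \<open>auto simp: simps diff_divide_distrib\<close>)
    also have "\<dots> = 1 / r - (N - 1) * c / r"
    proof -
      have "(\<Sum>k\<in>UNIV - {?L}. if k = i then 1 / r else 0) = 1 / r" using False by simp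
      moreover have "(\<Sum>k\<in>UNIV - {?L}. c / r) = (N - 1) * c / r"
        by (simp only: sum_constant card times_divide_eq_right)
      ultimately show ?thesis by (simp only: sum_subtractf)
    qed
    finally have "(\<Sum>k\<in>UNIV - {?L}. U_matrix \<epsilon> $ i $ k * U_matrix \<epsilon> $ ?L $ k) = 1 / r - (1 + \<epsilon> / r) / r"
      unfolding cN .
    then show ?thesis
      unfolding split[of "\<lambda>k. U_matrix \<epsilon> $ i $ k * U_matrix \<epsilon> $ ?L $ k"]
      using False by (simp add: simps(1,2) add_divide_distrib)
  qed
  show ?thesis
  proof (cases "i = ?L \<or> j = ?L")
    case True
    then show ?thesis
    proof
      assume "j = ?L"
      then show ?thesis using last[of i] by simp
    next
      assume i: "i = ?L"
      have "(\<Sum>k\<in>UNIV. U_matrix \<epsilon> $ i $ k * U_matrix \<epsilon> $ j $ k) = (\<Sum>k\<in>UNIV. U_matrix \<epsilon> $ j $ k * U_matrix \<epsilon> $ ?L $ k)"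
        unfolding i by (intro sum.cong refl mult.commute)
      then show ?thesis using last[of j] i by auto
    qed
  next
    case False
    have "(\<Sum>k\<in>UNIV - {?L}. U_matrix \<epsilon> $ i $ k * U_matrix \<epsilon> $ j $ k) =
        (\<Sum>k\<in>UNIV - {?L}. ((if i = k then 1 else 0) - c) * ((if j = k then 1 else 0) - c))"
      by (intro sum.cong refl) (use False in \<open>auto simp: simps\<close>)
    also have "\<dots> = (if i = j then 1 else 0) - 2 * c + (N - 1) * c\<^sup>2"
      using False by (subst sum_rank_one_shift) (simp_all only: card finite Diff_iff UNIV_I singleton_iff simp_thms de_Morgan_disj)
    finally have "(\<Sum>k\<in>UNIV. U_matrix \<epsilon> $ i $ k * U_matrix \<epsilon> $ j $ k) =
        \<epsilon> / r * (\<epsilon> / r) + ((if i = j then 1 else 0) - 2 * c + (N - 1) * c\<^sup>2)"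
      unfolding split[of "\<lambda>k. U_matrix \<epsilon> $ i $ k * U_matrix \<epsilon> $ j $ k"] using False by (simp add: simps(2))
    moreover have "\<epsilon> / r * (\<epsilon> / r) - 2 * c + (N - 1) * c\<^sup>2 = 0"
    proof -
      define x where "x = \<epsilon> / r"
      have "x * x = \<epsilon> * \<epsilon> / (r * r)" by (simp add: x_def)
      then have x: "N * (x * x) = 1" using e r N by simp
      \<comment> \<open>After multiplication by \<open>N - 1\<close> the constant \<open>c\<close>
        occurs only in the product \<open>(N - 1) * c\<close>, which is
        \<open>1 + x\<close>.\<close>
      have "(N - 1) * (x * x - 2 * c + (N - 1) * c\<^sup>2) =
          N * (x * x) - x * x - 2 * ((N - 1) * c) + ((N - 1) * c) * ((N - 1) * c)"
        unfolding power2_eq_square by algebra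
      also have "\<dots> = 0"
        unfolding cN[folded x_def] x by algebra
      finally show ?thesis using N1 by (simp add: x_def)
    qed
    ultimately show ?thesis by simp
  qed
qed

lemma orthogonal_entries_U_matrix:
  assumes N2: "CARD('n::{finite, linorder}) \<ge> 2" and \<epsilon>: "\<epsilon> = 1 \<or> \<epsilon> = -1"
  shows "orthogonal_entries (\<lambda>i j :: 'n. complex_of_real (U_matrix \<epsilon> $ i $ j))"
proof -
  let ?U = "U_matrix \<epsilon> :: ((real, 'n) vec, 'n) vec"
  have 1: "?U ** transpose ?U = mat 1"
    using U_matrix_rows[OF N2 \<epsilon>] by (simp add: vec_eq_iff matrix_matrix_mult_def transpose_def mat_def)
  then have "transpose ?U ** ?U = mat 1"
    by (simp add: matrix_left_right_inverse)
  then have 2: "(\<Sum>k\<in>UNIV. ?U $ k $ i * ?U $ k $ j) = (if i = j then 1 else 0)" for i j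
    by (simp add: vec_eq_iff matrix_matrix_mult_def transpose_def mat_def)
  show ?thesis
    unfolding orthogonal_entries_def of_real_mult[symmetric] of_real_sum[symmetric] U_matrix_rows[OF N2 \<epsilon>] 2
    by simp
qed

text \<open>The last row is constant, so a row sum is a multiple of the inner product with the last
  row. In other words, \<open>U\<close> sends the all-one vector to a multiple of the last basis
  vector.\<close>

lemma U_matrix_row_sum:
  fixes i :: "'n::{finite, linorder}"
  assumes N2: "CARD('n) \<ge> 2" and \<epsilon>: "\<epsilon> = 1 \<or> \<epsilon> = -1"
  shows "(\<Sum>k\<in>UNIV. U_matrix \<epsilon> $ i $ k) = (if i = last_index then sqrt (real CARD('n)) else 0)"
proof -
  have "(\<Sum>k\<in>UNIV. U_matrix \<epsilon> $ i $ k) / sqrt (real CARD('n)) = (if i = last_index then 1 else 0)"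
    using U_matrix_rows[OF N2 \<epsilon>, of i last_index] by (simp add: U_matrix_simps sum_divide_distrib)
  then show ?thesis by (auto simp: field_simps split: if_splits)
qed

section \<open>Non-easiness\<close>

context reflection_twist begin

text \<open>A space spanned by partitions contains every partition that occurs in one of its
  elements, and \<open>p_s\<close> occurs in the generator with the nonzero coefficient
  \<open>4 / N\<^sup>2\<close>.\<close>

lemma p_s_in_K:
  assumes "easy_category K"
  shows "Poly_Mapping.single p_s 1 \<in> K 2 2"
proof -
  obtain P where P: "K 2 2 = complex_vector.span ((\<lambda>p. Poly_Mapping.single p 1) ` P)"
    using assms unfolding easy_category_def by blast
  have "Poly_Mapping.keys f \<subseteq> P" if "f \<in> K 2 2" for f
    using that unfolding P
  proof (induction rule: complex_vector.span_induct_alt)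
    case (step c x y)
    then show ?case using keys_add[of "c *\<^sub>C x" y] by (force simp: scaleC_single split: if_splits)
  qed simp
  moreover have "twisted_cross N \<in> K 2 2"
    unfolding K_def by (rule linear_category_generated(2)) (auto simp: twisted_cross_Part)
  moreover have "p_s \<in> Poly_Mapping.keys (twisted_cross N)"
  proof -
    have "{Inl 0} \<in> p_s \<and> {Inl 1} \<in> p_s \<and> {Inr 0} \<in> p_s" by (simp add: p_s_def)
    moreover have "{Inl 0} \<notin> p_cross" "{Inl 0} \<notin> p_r1" "{Inl 1} \<notin> p_r2"
      by (auto simp: p_cross_def p_r1_def p_r2_def)
    ultimately have "p_cross \<noteq> p_s" "p_r1 \<noteq> p_s" "p_r2 \<noteq> p_s" by auto
    then show ?thesis
      by (simp add: in_keys_iff twisted_cross_def lookup_add lookup_minus lookup_single N)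
  qed
  ultimately have "p_s \<in> P" by blast
  then show ?thesis unfolding P by (intro complex_vector.span_base) auto
qed

lemma not_easy:
  fixes L :: 'n
  assumes rows: "\<And>i. (\<Sum>m\<in>UNIV. U i m) = (if i = L then c else 0)" and c: "c * c = N" "c * U L j = 1" "j \<noteq> L"
    and UL: "U L L \<noteq> 0"
  shows "\<not> easy_category K"
proof
  assume "easy_category K"
  then have "Poly_Mapping.single p_s 1 \<in> M 2 2" using p_s_in_K K_subset_M by blast
  then have E: "conj_map 2 2 (lin_part_map 2 2 (Poly_Mapping.single p_s 1)) \<in> classical_Mor 2 2"
    by (simp add: M_def)
  have T: "lin_part_map 2 2 (Poly_Mapping.single p_s 1) [a, b] [d, e] = 1" for a b d e :: 'n
    by (simp add: lin_part_map_single part_map_def p_s_def)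
  \<comment> \<open>All entries of the map of \<open>p_s\<close> are 1, so its conjugate is made of
    row sums of \<open>U\<close>, which vanish outside the row \<open>L\<close>.\<close>
  have val: "conj_map 2 2 (lin_part_map 2 2 (Poly_Mapping.single p_s 1)) [a, b] [d, e] =
      (if a = L \<and> b = L \<and> d = L \<and> e = L then N * N else 0)" for a b d e
  proof -
    have inner: "lmult 2 (lin_part_map 2 2 (Poly_Mapping.single p_s 1)) Wt [x, y] [d, e] =
        s d e * ((\<Sum>m\<in>UNIV. U d m) * (\<Sum>m\<in>UNIV. U e m))" for x y
      unfolding lmult_def sum_words_2 sum_product unfolding sum_distrib_left
      by (intro sum.cong refl) (simp only: T Wt_def W_2 scaleC_complex_def mult_1)
    have "conj_map 2 2 (lin_part_map 2 2 (Poly_Mapping.single p_s 1)) [a, b] [d, e] =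
        (s a b * ((\<Sum>m\<in>UNIV. U a m) * (\<Sum>m\<in>UNIV. U b m))) * (s d e * ((\<Sum>m\<in>UNIV. U d m) * (\<Sum>m\<in>UNIV. U e m)))"
      unfolding conj_map_def lmult_def[of 2 W] sum_words_2 inner
      by (simp only: W_2 scaleC_complex_def sum_distrib_left[symmetric] sum_distrib_right[symmetric])
    also have "\<dots> = (if a = L \<and> b = L \<and> d = L \<and> e = L then (c * c) * (c * c) else 0)"
      unfolding rows by (auto simp: diag)
    finally show ?thesis unfolding c(1) .
  qed
  let ?E = "conj_map 2 2 (lin_part_map 2 2 (Poly_Mapping.single p_s 1))"
  \<comment> \<open>The column word \<open>[L, j]\<close> lies outside the support of the matrix
    unit, so the right-hand side vanishes, while the left-hand side is a multiple of
    \<open>U L L * U L j\<close>.\<close>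
  have "lmult 2 ?E (wprod U) [L, L] [L, j] = rmult 2 (wprod U) ?E [L, L] [L, j]"
    using classical_Mor_hom[OF E orth] by simp
  moreover have "rmult 2 (wprod U) ?E [L, L] [L, j] = 0"
    using c(3) by (simp add: rmult_def sum_words_2 val)
  moreover have "lmult 2 ?E (wprod U) [L, L] [L, j] = N * N * (U L L * U L j)"
  proof -
    have "lmult 2 ?E (wprod U) [L, L] [L, j] =
        (\<Sum>a\<in>UNIV. \<Sum>b\<in>UNIV. if b = L then if a = L then N * N * (U L L * U L j) else 0 else 0)"
      unfolding lmult_def sum_words_2 by (intro sum.cong refl) (simp add: val)
    then show ?thesis by simp
  qed
  moreover have "U L j \<noteq> 0" "N \<noteq> 0" using c(2) by (auto simp: N)
  ultimately show False using UL by simp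
qed

end

lemma reflection_twist_sigma:
  assumes N2: "CARD('n::{finite, linorder}) \<ge> 2" and \<epsilon>: "\<epsilon> = 1 \<or> \<epsilon> = -1"
  shows "reflection_twist sigma_matrix (\<lambda>i j :: 'n. complex_of_real (U_matrix \<epsilon> $ i $ j)) sigma_sign (of_nat CARD('n))"
proof
  let ?U = "\<lambda>i j :: 'n. complex_of_real (U_matrix \<epsilon> $ i $ j)" and ?N = "of_nat CARD('n) :: complex"
  show "sigma_matrix i j \<in> {1, -1}" for i j :: 'n
    by (simp add: sigma_matrix_def sigma_sign_def)
  show "orthogonal_entries ?U" by (rule orthogonal_entries_U_matrix[OF N2 \<epsilon>])
  show "cnj (?U i j) = ?U i j" for i j by simp
  show "sigma_matrix i i = 1" for i :: 'n by (simp add: sigma_matrix_def)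
  \<comment> \<open>For distinct indices one factor is the product of the two signs and the other is
    1; for equal indices both sides are 1.\<close>
  show "sigma_matrix i j * sigma_matrix j i = sigma_sign i * sigma_sign j" for i j :: 'n
    by (cases i j rule: linorder_cases) (auto simp: sigma_matrix_def sigma_sign_def)
  show "(\<Sum>m\<in>UNIV. ?U i m * (\<Sum>n\<in>UNIV. ((if m = n then 1 else 0) - 2 / ?N) * ?U j n)) =
      (if i = j then sigma_sign i else 0)" for i j
  proof -
    \<comment> \<open>The all-one matrix contributes the product of the row sums \<open>r i\<close>
      and \<open>r j\<close>. It equals \<open>N\<close> at the last diagonal entry and 0 elsewhere,
      so subtracting \<open>2 / N\<close> times it flips exactly one sign of the identity
      matrix.\<close>
    define r where "r i = (\<Sum>m\<in>UNIV. ?U i m)" for i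
    have r: "r i = (if i = last_index then complex_of_real (sqrt (real CARD('n))) else 0)" for i
      unfolding r_def of_real_sum[symmetric] U_matrix_row_sum[OF N2 \<epsilon>] by simp
    have sq: "complex_of_real (sqrt (real CARD('n))) * complex_of_real (sqrt (real CARD('n))) = ?N"
      unfolding of_real_mult[symmetric] by simp
    have "(\<Sum>n\<in>UNIV. ((if m = n then 1 else 0) - 2 / ?N) * ?U j n) = ?U j m - 2 / ?N * r j" for m
    proof -
      have "(\<Sum>n\<in>UNIV. ((if m = n then 1 else 0) - 2 / ?N) * ?U j n) =
          (\<Sum>n\<in>UNIV. (if n = m then ?U j m else 0) - 2 / ?N * ?U j n)"
        by (intro sum.cong refl) (simp add: left_diff_distrib)
      then show ?thesis by (simp add: sum_subtractf r_def sum_distrib_left)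
    qed
    then have "(\<Sum>m\<in>UNIV. ?U i m * (\<Sum>n\<in>UNIV. ((if m = n then 1 else 0) - 2 / ?N) * ?U j n)) =
        (\<Sum>m\<in>UNIV. ?U i m * ?U j m) - r i * (2 / ?N * r j)"
      by (simp only: right_diff_distrib sum_subtractf r_def sum_distrib_right)
    also have "(\<Sum>m\<in>UNIV. ?U i m * ?U j m) = (if i = j then 1 else 0)"
      using orthogonal_entries_U_matrix[OF N2 \<epsilon>] by (simp add: orthogonal_entries_def)
    also have "r i * (2 / ?N * r j) = (if i = last_index \<and> j = last_index then 2 else 0)"
    proof -
      have "complex_of_real (sqrt (real CARD('n))) * (2 / ?N * complex_of_real (sqrt (real CARD('n)))) = 2 / ?N * ?N"
        unfolding sq[symmetric] by (simp only: mult_ac)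
      then show ?thesis by (auto simp: r)
    qed
    finally show ?thesis by (auto simp: sigma_sign_def)
  qed
qed simp

theorem proposition7p12:
  fixes \<epsilon> :: real
  assumes "CARD('n::{finite, linorder}) \<ge> 2"
    and "\<epsilon> = 1 \<or> \<epsilon> = -1"
  shows "let N = of_nat CARD('n) :: complex;
             K = generated_category N {(2, 2, twisted_cross N)};
             G = qg_conj (U_matrix \<epsilon>) (twisted_O sigma_matrix :: ('n polO, 'n) quantum_group)
         in linear_category N K \<and> \<not> easy_category K \<and>
            (\<forall>k l. qg_Mor G k l = lin_part_map k l ` K k l)"
proof -
  let ?U = "\<lambda>i j :: 'n. complex_of_real (U_matrix \<epsilon> $ i $ j)" and ?N = "of_nat CARD('n) :: complex"
  let ?L = "last_index :: 'n" and ?c = "complex_of_real (sqrt (real CARD('n)))"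
  interpret reflection_twist sigma_matrix ?U sigma_sign ?N
    by (rule reflection_twist_sigma[OF assms])
  have "\<exists>j. j \<noteq> ?L"
  proof (rule ccontr)
    assume "\<not> (\<exists>j. j \<noteq> ?L)"
    then have "(UNIV :: 'n set) = {?L}" by auto
    then have "CARD('n) = 1" by (metis card_1_singleton_iff One_nat_def)
    then show False using assms(1) by simp
  qed
  then obtain j where j: "j \<noteq> ?L" by blast
  have "\<not> easy_category K"
  proof (rule not_easy[of ?L ?c j])
    show "(\<Sum>m\<in>UNIV. ?U i m) = (if i = ?L then ?c else 0)" for i
      unfolding of_real_sum[symmetric] U_matrix_row_sum[OF assms] by simp
    show "?c * ?c = ?N" unfolding of_real_mult[symmetric] by simp
    show "?c * ?U ?L j = 1" unfolding of_real_mult[symmetric] U_matrix_simps(1) by simp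
    show "?U ?L ?L \<noteq> 0" by (simp add: U_matrix_simps(1))
  qed (rule j)
  then show ?thesis
    using linear_category_K qg_Mor_eq[OF refl] unfolding Let_def K_def by blast
qed

end
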